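(* For given $F, D \in B^a(H_{\mathcal A})$, $$\tilde W(F,D) \subseteq \bigcap_{C \in B^a(H_{\mathcal A})} \sigma_e^{\mathcal A}(\mathbf M_C^{\mathcal A}) \subseteq W(F,D),$$ where $\mathbf M_C^{\mathcal A} = \begin{pmatrix} F & C \\ 0 & D\end{pmatrix}$ acts on $H_{\mathcal A}\oplus H_{\mathcal A}$.
   Context: $\mathcal A$ is a unital $C^*$-algebra with center $Z(\mathcal A)$, and $H_{\mathcal A} = \ell^2(\mathcal A)$ is the standard Hilbert $\mathcal A$-module. For Hilbert $\mathcal A$-modules $H,K$, $B^a(H,K)$ denotes the bounded adjointable $\mathcal A$-linear operators $H\to K$, and $B^a(H) = B^a(H,H)$. For $\alpha\in Z(\mathcal A)$, $\alpha I$ (also written $\alpha 1$) is the $\mathcal A$-linear adjointable operator of multiplication by $\alpha$ (coordinatewise) on $H_{\mathcal A}$ or on $H_{\mathcal A}\oplus H_{\mathcal A}$. $\oplus$ is the orthogonal direct sum; $\tilde\oplus$ denotes a direct sum of closed submodules that need not be orthogonal. A Hilbert module is finitely generated if it equals the linear span (over $\mathbb C$ and $\mathcal A$) of a finite subset. An isomorphism is a bounded $\mathcal A$-linear bijection with bounded inverse, and $\cong$ means existence of an isomorphism. For a decomposition $H = M_1\tilde\oplus N_1 \stackrel{T}{\longrightarrow} M_2\tilde\oplus N_2 = H$ into closed submodules, saying $T$ has matrix $\begin{pmatrix} T_1 & 0\\ 0& T_4\end{pmatrix}$ means $T(M_1)\subseteq M_2$, $T(N_1)\subseteq N_2$, $T_1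 = T|_{M_1}: M_1\to M_2$, $T_4 = T|_{N_1}:N_1\to N_2$. An operator $T\in B^a(H)$ ($H = H_{\mathcal A}$ or $H_{\mathcal A}\oplus H_{\mathcal A}$) is $\mathcal A$-Fredholm if there is such a decomposition with diagonal matrix, $T_1$ an isomorphism and $N_1,N_2$ finitely generated. $\sigma_e^{\mathcal A}(\mathbf M_C^{\mathcal A})$ is the set of $\alpha\in Z(\mathcal A)$ such that $\mathbf M_C^{\mathcal A}-\alpha I$ is not $\mathcal A$-Fredholm. $\tilde W(F,D)$ is the set of all $\alpha\in Z(\mathcal A)$ such that there exist decompositions $$H_{\mathcal A} = M_1 \tilde\oplus N_1 \stackrel{F-\alpha 1}{\longrightarrow} M_2 \tilde\oplus N_2 = H_{\mathcal A}, \qquad H_{\mathcal A} = M_1' \tilde\oplus N_1' \stackrel{D-\alpha 1}{\longrightarrow} M_2' \tilde\oplus N_2' = H_{\mathcal A}$$ with respect to which $F-\alpha1$, $D-\alpha1$ have diagonal matrices with $(F-\alpha 1)_1$, $(D-\alpha 1)_1$ isomorphisms, $N_1, N_2'$ are finitely generated, and there are no closed submodules $\tilde N_2, \tilde{\tilde N}_2, \tilde N_1', \tilde{\tilde N}_1'$ of $H_{\mathcal A}$ with the property that $N_2\cong\tilde N_2$, $N_1'\cong\tilde N_1'$, $\tilde{\tilde N}_2$ and $\tilde{\tilde N}_1'$ are finitely generated, and $\tilde N_2\tilde\oplus\tilde{\tilde N}_2\cong\tilde N_1'\tilde\oplus\tilde{\tilde N}_1'$. $W(F,D)$ is the set of all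 $\alpha\in Z(\mathcal A)$ such that there are no decompositions $$H_{\mathcal A} = M_1 \tilde\oplus N_1 \stackrel{F-\alpha 1}{\longrightarrow} N_2^\perp \oplus N_2 = H_{\mathcal A}, \qquad H_{\mathcal A} = {N_1'}^\perp \oplus N_1' \stackrel{D-\alpha 1}{\longrightarrow} M_2' \tilde\oplus N_2' = H_{\mathcal A}$$ with respect to which $F-\alpha1$, $D-\alpha1$ have diagonal matrices with $(F-\alpha 1)_1$, $(D-\alpha 1)_1$ isomorphisms, $N_1, N_2'$ finitely generated, and such that a) or b) holds: a) there exists $J\in B^a(N_2,N_1')$ such that $N_2\cong\operatorname{Im}J$ and the orthogonal complement of $\operatorname{Im}J$ in $N_1'$ is finitely generated; b) there exists $J'\in B^a(N_1',N_2)$ such that $N_1'\cong\operatorname{Im}J'$ and the orthogonal complement of $\operatorname{Im}J'$ in $N_2$ is finitely generated. *)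

theory Defs
  imports "HOL-Analysis.Analysis" "HOL-Library.Function_Algebras"
begin

section \<open>Unital C*-algebras\<close>

text \<open>Completeness and \<open>norm 1 = 1\<close> (hence \<open>0 \<noteq> 1\<close>) come from the superclasses.\<close>

class unital_cstar_algebra = real_normed_algebra_1 + banach +
  fixes cscale :: "complex \<Rightarrow> 'a \<Rightarrow> 'a"
    and star :: "'a \<Rightarrow> 'a"
  assumes cscale_add_right: "cscale l (x + y) = cscale l x + cscale l y"
    and cscale_add_left: "cscale (l + m) x = cscale l x + cscale m x"
    and cscale_cscale: "cscale l (cscale m x) = cscale (l * m) x"
    and cscale_of_real: "cscale (complex_of_real r) x = r *\<^sub>R x"
    and cscale_mult_left: "cscale l x * y = cscale l (x * y)"
    and cscale_mult_right: "x * cscale l y = cscale l (x * y)"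
    and norm_cscale: "norm (cscale l x) = cmod l * norm x"
    and star_add: "star (x + y) = star x + star y"
    and star_cscale: "star (cscale l x) = cscale (cnj l) (star x)"
    and star_star: "star (star x) = x"
    and star_mult: "star (x * y) = star y * star x"
    and cstar_identity: "norm (star x * x) = (norm x)\<^sup>2"

instantiation complex :: unital_cstar_algebra
begin

definition cscale_complex :: "complex \<Rightarrow> complex \<Rightarrow> complex" where
  "cscale_complex l x = l * x"

definition star_complex :: "complex \<Rightarrow> complex" where
  "star_complex x = cnj x"

instance
  by standard
    (auto simp: cscale_complex_def star_complex_def algebra_simps norm_mult power2_eq_square
      scaleR_conv_of_real)

end

definition alg_center :: "'a::unital_cstar_algebra set" where
  "alg_center = {\<alpha>. \<forall>x. \<alpha> * x = x * \<alpha>}"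


section \<open>Hilbert modules\<close>

text \<open>
  Right modules, with inner product conjugate-linear in the first argument.  Addition is that of
  the ambient type; the complex action is \<open>x \<lambda> = x (\<lambda> 1)\<close>, as the algebra is unital.  The record
  carries no axioms: it is only used for \<open>\<ell>\<^sup>2(A)\<close>, \<open>\<ell>\<^sup>2(A) \<oplus> \<ell>\<^sup>2(A)\<close> and their submodules.
\<close>

record ('a, 'h) hmodule =
  mcarrier :: "'h set"
  mact :: "'h \<Rightarrow> 'a \<Rightarrow> 'h"
  mip :: "'h \<Rightarrow> 'h \<Rightarrow> 'a"

definition mnorm :: "('a::unital_cstar_algebra, 'h) hmodule \<Rightarrow> 'h \<Rightarrow> real" where
  "mnorm H x = sqrt (norm (mip H x x))"

definition std_module :: "('a::unital_cstar_algebra, nat \<Rightarrow> 'a) hmodule" where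
  "std_module =
    \<lparr>mcarrier = {x. summable (\<lambda>n. star (x n) * x n)},
     mact = (\<lambda>x a n. x n * a),
     mip = (\<lambda>x y. \<Sum>n. star (x n) * y n)\<rparr>"

definition hsum :: "('a::unital_cstar_algebra, 'h) hmodule \<Rightarrow> ('a, 'k) hmodule \<Rightarrow>
    ('a, 'h \<times> 'k) hmodule" where
  "hsum H K =
    \<lparr>mcarrier = mcarrier H \<times> mcarrier K,
     mact = (\<lambda>x a. (mact H (fst x) a, mact K (snd x) a)),
     mip = (\<lambda>x y. mip H (fst x) (fst y) + mip K (snd x) (snd y))\<rparr>"

abbreviation submod :: "('a, 'h) hmodule \<Rightarrow> 'h set \<Rightarrow> ('a, 'h) hmodule" where
  "submod H M \<equiv> H\<lparr>mcarrier := M\<rparr>"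

definition closed_submodule ::
  "('a::unital_cstar_algebra, 'h::ab_group_add) hmodule \<Rightarrow> 'h set \<Rightarrow> bool" where
  "closed_submodule H M \<longleftrightarrow>
    M \<subseteq> mcarrier H \<and> 0 \<in> M \<and>
    (\<forall>x\<in>M. \<forall>y\<in>M. x + y \<in> M) \<and>
    (\<forall>x\<in>M. \<forall>a. mact H x a \<in> M) \<and>
    (\<forall>X x. (\<forall>n::nat. X n \<in> M) \<longrightarrow> x \<in> mcarrier H \<longrightarrow>
       (\<lambda>n. mnorm H (X n - x)) \<longlonglongrightarrow> 0 \<longrightarrow> x \<in> M)"

text \<open>The span over the algebra contains the span over the complex numbers.\<close>

definition finitely_generated ::
  "('a::unital_cstar_algebra, 'h::ab_group_add) hmodule \<Rightarrow> bool" where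
  "finitely_generated H \<longleftrightarrow>
    (\<exists>S. finite S \<and> S \<subseteq> mcarrier H \<and>
      mcarrier H = {y. \<exists>c. y = (\<Sum>s\<in>S. mact H s (c s))})"

definition orth_compl ::
  "('a::unital_cstar_algebra, 'h) hmodule \<Rightarrow> 'h set \<Rightarrow> 'h set" where
  "orth_compl H M = {x \<in> mcarrier H. \<forall>y\<in>M. mip H x y = 0}"

text \<open>
  \<open>direct_sum H M N L\<close>: inside \<open>H\<close>, the closed submodule \<open>L\<close> is the (not necessarily orthogonal)
  direct sum of the closed submodules \<open>M\<close> and \<open>N\<close>.
\<close>

definition direct_sum ::
  "('a::unital_cstar_algebra, 'h::ab_group_add) hmodule \<Rightarrow> 'h set \<Rightarrow> 'h set \<Rightarrow> 'h set \<Rightarrow> bool" where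
  "direct_sum H M N L \<longleftrightarrow>
    closed_submodule H M \<and> closed_submodule H N \<and> closed_submodule H L \<and>
    M \<inter> N = {0} \<and> L = {x + y |x y. x \<in> M \<and> y \<in> N}"


section \<open>Operators\<close>

text \<open>
  Operators are functions on the ambient types of which only the restriction to the carrier
  matters.  Additivity and linearity over the (unital) algebra give complex linearity.
\<close>

definition bounded_module_map ::
  "('a::unital_cstar_algebra, 'h::ab_group_add) hmodule \<Rightarrow> ('a, 'k::ab_group_add) hmodule \<Rightarrow>
    ('h \<Rightarrow> 'k) \<Rightarrow> bool" where
  "bounded_module_map H K T \<longleftrightarrow>
    (\<forall>x\<in>mcarrier H. T x \<in> mcarrier K) \<and>
    (\<forall>x\<in>mcarrier H. \<forall>y\<in>mcarrier H. T (x + y) = T x + T y) \<and>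
    (\<forall>x\<in>mcarrier H. \<forall>a. T (mact H x a) = mact K (T x) a) \<and>
    (\<exists>B. \<forall>x\<in>mcarrier H. mnorm K (T x) \<le> B * mnorm H x)"

definition adjointable_ops ::
  "('a::unital_cstar_algebra, 'h::ab_group_add) hmodule \<Rightarrow> ('a, 'k::ab_group_add) hmodule \<Rightarrow>
    ('h \<Rightarrow> 'k) set" where
  "adjointable_ops H K =
    {T. bounded_module_map H K T \<and>
      (\<exists>S. \<forall>y\<in>mcarrier K. S y \<in> mcarrier H \<and>
        (\<forall>x\<in>mcarrier H. mip K (T x) y = mip H x (S y)))}"

definition module_iso ::
  "('a::unital_cstar_algebra, 'h::ab_group_add) hmodule \<Rightarrow> ('a, 'k::ab_group_add) hmodule \<Rightarrow>
    ('h \<Rightarrow> 'k) \<Rightarrow> bool" where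
  "module_iso H K T \<longleftrightarrow>
    bounded_module_map H K T \<and> bij_betw T (mcarrier H) (mcarrier K) \<and>
    bounded_module_map K H (inv_into (mcarrier H) T)"

definition isomorphic ::
  "('a::unital_cstar_algebra, 'h::ab_group_add) hmodule \<Rightarrow> ('a, 'k::ab_group_add) hmodule \<Rightarrow>
    bool" where
  "isomorphic H K \<longleftrightarrow> (\<exists>T. module_iso H K T)"

text \<open>
  With respect to \<open>H = M1 \<oplus> N1 \<rightarrow> M2 \<oplus> N2 = H\<close>, the operator \<open>T\<close> has a diagonal matrix whose
  first entry is an isomorphism.
\<close>

definition diag_iso_decomp ::
  "('a::unital_cstar_algebra, 'h::ab_group_add) hmodule \<Rightarrow> ('h \<Rightarrow> 'h) \<Rightarrow>
    'h set \<Rightarrow> 'h set \<Rightarrow> 'h set \<Rightarrow> 'h set \<Rightarrow> bool" where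
  "diag_iso_decomp H T M1 N1 M2 N2 \<longleftrightarrow>
    direct_sum H M1 N1 (mcarrier H) \<and> direct_sum H M2 N2 (mcarrier H) \<and>
    T ` M1 \<subseteq> M2 \<and> T ` N1 \<subseteq> N2 \<and>
    module_iso (submod H M1) (submod H M2) T"

definition fredholm ::
  "('a::unital_cstar_algebra, 'h::ab_group_add) hmodule \<Rightarrow> ('h \<Rightarrow> 'h) \<Rightarrow> bool" where
  "fredholm H T \<longleftrightarrow>
    T \<in> adjointable_ops H H \<and>
    (\<exists>M1 N1 M2 N2. diag_iso_decomp H T M1 N1 M2 N2 \<and>
      finitely_generated (submod H N1) \<and> finitely_generated (submod H N2))"

text \<open>
  \<open>T - \<alpha> I\<close>.  For central \<open>\<alpha>\<close>, coordinatewise multiplication by \<open>\<alpha>\<close> is the module action of \<open>\<alpha>\<close>.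
\<close>

definition shift_op ::
  "('a::unital_cstar_algebra, 'h::ab_group_add) hmodule \<Rightarrow> ('h \<Rightarrow> 'h) \<Rightarrow> 'a \<Rightarrow> 'h \<Rightarrow> 'h" where
  "shift_op H T \<alpha> x = T x - mact H x \<alpha>"

definition ess_spectrum ::
  "('a::unital_cstar_algebra, 'h::ab_group_add) hmodule \<Rightarrow> ('h \<Rightarrow> 'h) \<Rightarrow> 'a set" where
  "ess_spectrum H T = {\<alpha> \<in> alg_center. \<not> fredholm H (shift_op H T \<alpha>)}"

definition upper_triangular ::
  "('h::ab_group_add \<Rightarrow> 'h) \<Rightarrow> ('h \<Rightarrow> 'h) \<Rightarrow> ('h \<Rightarrow> 'h) \<Rightarrow> 'h \<times> 'h \<Rightarrow> 'h \<times> 'h" where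
  "upper_triangular F C D = (\<lambda>(x, y). (F x + C y, D y))"


section \<open>The sets bounding the intersection of the spectra\<close>

definition W_tilde ::
  "((nat \<Rightarrow> 'a::unital_cstar_algebra) \<Rightarrow> nat \<Rightarrow> 'a) \<Rightarrow> ((nat \<Rightarrow> 'a) \<Rightarrow> nat \<Rightarrow> 'a) \<Rightarrow> 'a set" where
  "W_tilde F D = {\<alpha> \<in> alg_center.
    \<exists>M1 N1 M2 N2 M1' N1' M2' N2'.
      diag_iso_decomp std_module (shift_op std_module F \<alpha>) M1 N1 M2 N2 \<and>
      diag_iso_decomp std_module (shift_op std_module D \<alpha>) M1' N1' M2' N2' \<and>
      finitely_generated (submod std_module N1) \<and>
      finitely_generated (submod std_module N2') \<and>
      \<not> (\<exists>P2 Q2 P1' Q1' L2 L1'.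
          direct_sum std_module P2 Q2 L2 \<and>
          direct_sum std_module P1' Q1' L1' \<and>
          isomorphic (submod std_module N2) (submod std_module P2) \<and>
          isomorphic (submod std_module N1') (submod std_module P1') \<and>
          finitely_generated (submod std_module Q2) \<and>
          finitely_generated (submod std_module Q1') \<and>
          isomorphic (submod std_module L2) (submod std_module L1'))}"

text \<open>
  Conditions a) and b) are both instances of \<open>embeds_cofinitely N N'\<close>: some adjointable
  \<open>J : N \<rightarrow> N'\<close> has image isomorphic to \<open>N\<close> and finitely generated orthogonal complement of the
  image in \<open>N'\<close>.
\<close>

definition embeds_cofinitely ::
  "(nat \<Rightarrow> 'a::unital_cstar_algebra) set \<Rightarrow> (nat \<Rightarrow> 'a) set \<Rightarrow> bool" where
  "embeds_cofinitely N N' \<longleftrightarrow>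
    (\<exists>J \<in> adjointable_ops (submod std_module N) (submod std_module N').
      isomorphic (submod std_module N) (submod std_module (J ` N)) \<and>
      finitely_generated (submod std_module (orth_compl (submod std_module N') (J ` N))))"

definition W_set ::
  "((nat \<Rightarrow> 'a::unital_cstar_algebra) \<Rightarrow> nat \<Rightarrow> 'a) \<Rightarrow> ((nat \<Rightarrow> 'a) \<Rightarrow> nat \<Rightarrow> 'a) \<Rightarrow> 'a set" where
  "W_set F D = {\<alpha> \<in> alg_center.
    \<not> (\<exists>M1 N1 N2 N1' M2' N2'.
      diag_iso_decomp std_module (shift_op std_module F \<alpha>)
        M1 N1 (orth_compl std_module N2) N2 \<and>
      diag_iso_decomp std_module (shift_op std_module D \<alpha>)
        (orth_compl std_module N1') N1' M2' N2' \<and>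
      finitely_generated (submod std_module N1) \<and>
      finitely_generated (submod std_module N2') \<and>
      (embeds_cofinitely N2 N1' \<or> embeds_cofinitely N1' N2))}"

end

theory Submission
  imports Defs
begin

text \<open>
  Interleaving of sequences identifies \<open>\<ell>\<^sup>2(A) \<oplus> \<ell>\<^sup>2(A)\<close> with \<open>\<ell>\<^sup>2(A)\<close>, so that all modules are
  submodules of one Banach space.

  First inclusion: suppose the operator matrix minus \<open>\<alpha>\<close> is Fredholm with finitely generated
  complements \<open>R1\<close>, \<open>R2\<close>, and take decompositions for \<open>F - \<alpha>\<close> and \<open>D - \<alpha>\<close>.  Bordering the matrix
  with the embeddings of \<open>N2\<close>, \<open>N2'\<close> and the projections to \<open>N1\<close>, \<open>N1'\<close> makes it invertible, and the
  Schur complement of its invertible Fredholm corner is an isomorphism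
  \<open>N2 \<oplus> R1 \<oplus> N2' \<cong> N1' \<oplus> R2 \<oplus> N1\<close>, which contradicts \<open>\<alpha> \<in> W_tilde F D\<close>.

  Second inclusion: under condition a) or b), the image of \<open>J\<close> is closed, hence an orthogonal summand,
  and the given Banach isomorphism onto it can be replaced by an adjointable one: if \<open>T\<close> is a
  (not necessarily adjointable) isomorphism of orthogonal summands and \<open>k\<close> is a compact operator with
  dense range, then \<open>T k\<close> is adjointable and the unitary factor of its polar decomposition is an
  isomorphism of the same summands.  Taking it as \<open>C\<close> makes the operator matrix invertible between
  submodules with finitely generated complements.
\<close>

text \<open>Square roots come from the binomial series, which still converges absolutely at norm 1;
  the order theory rests on this and on no spectral theory. It is developed for a type class because
  it is needed twice: for the coefficient algebra, where it yields Cauchy-Schwarz and the norm of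
  \<open>ell2\<close>, and for the operator algebra \<open>aop\<close>, where it yields polar
  decompositions. The obstacle is a mismatch between two kinds of maps. The complements and
  isomorphisms in the statement are Banach space objects, and for the first inclusion bounded
  idempotents and the open mapping theorem suffice. The entry C, however, has to be adjointable,
  while a bounded module map may have no adjoint and a closed submodule no orthogonal complement.
  Conditions a) and b) supply two different maps: J has an adjoint but may have a kernel, and the
  isomorphism onto the image of J may have no adjoint. The isomorphism gives closedness of the
  image, and only then does the adjoint of J give its orthogonal complement.\<close>

section \<open>Positive elements of a C*-algebra\<close>

lemma cscale_zero_left [simp]: "cscale 0 x = (0::'a::unital_cstar_algebra)"
  using cscale_of_real[of 0 x] by simp

lemma star_scaleR: "star (r *\<^sub>R x) = r *\<^sub>R star (x::'a::unital_cstar_algebra)"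
  using star_cscale[of "complex_of_real r" x] by (simp add: cscale_of_real)

lemma star_zero [simp]: "star 0 = (0::'a::unital_cstar_algebra)"
  using star_scaleR[of 0 0] by simp

lemma star_minus: "star (- x) = - star (x::'a::unital_cstar_algebra)"
  using star_scaleR[of "-1" x] by simp

lemma star_diff: "star (x - y) = star x - star (y::'a::unital_cstar_algebra)"
  using star_add[of x "- y"] by (simp add: star_minus)

lemma star_one [simp]: "star 1 = (1::'a::unital_cstar_algebra)"
  by (metis star_mult star_star mult_1 mult_1_right)

lemma star_of_real [simp]: "star (of_real r) = (of_real r :: 'a::unital_cstar_algebra)"
  by (simp add: of_real_def star_scaleR)

lemma star_sum: "star (sum f I) = (\<Sum>i\<in>I. star (f i :: 'a::unital_cstar_algebra))"
  by (induction I rule: infinite_finite_induct) (simp_all add: star_add)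

lemma star_power: "star (x ^ n) = star (x::'a::unital_cstar_algebra) ^ n"
  by (induction n) (simp_all add: star_mult power_commutes)

lemma norm_star [simp]: "norm (star x) = norm (x::'a::unital_cstar_algebra)"
proof -
  have le: "norm x \<le> norm (star x)" for x :: 'a
  proof (cases "x = 0")
    case False
    have "norm x * norm x \<le> norm (star x) * norm x"
      using cstar_identity[of x] norm_mult_ineq[of "star x" x] by (simp add: power2_eq_square)
    then show ?thesis using False by simp
  qed simp
  show ?thesis using le[of x] le[of "star x"] by (simp add: star_star)
qed

lemma bounded_linear_star: "bounded_linear (star :: 'a::unital_cstar_algebra \<Rightarrow> 'a)"
  by (rule bounded_linear_intro[where K=1]) (simp_all add: star_add star_scaleR)

lemma tendsto_star [tendsto_intros]:
  "(f \<longlongrightarrow> l) F \<Longrightarrow> ((\<lambda>x. star (f x :: 'a::unital_cstar_algebra)) \<longlongrightarrow> star l) F"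
  using bounded_linear.tendsto[OF bounded_linear_star] .

text \<open>Coefficients of the Taylor series of \<open>\<lambda>x. sqrt (1 - x)\<close>.\<close>

definition sqrt_coeff :: "nat \<Rightarrow> real" where
  "sqrt_coeff n = (-1) ^ n * ((1/2) gchoose n)"

lemma sqrt_coeff_0: "sqrt_coeff 0 = 1"
  by (simp add: sqrt_coeff_def)

lemma sqrt_coeff_Suc: "sqrt_coeff (Suc n) = sqrt_coeff n * ((real n - 1/2) / (real n + 1))"
proof -
  have "((1/2::real) gchoose (Suc n)) = ((1/2) gchoose n) * ((1/2 - real n) / (real n + 1))"
    using gbinomial_mult_1[of "1/2::real" n] by (simp add: field_simps)
  moreover have "(1/2 - real n) / (real n + 1) = - ((real n - 1/2) / (real n + 1))"
    by (metis minus_diff_eq minus_divide_left)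
  ultimately show ?thesis by (simp add: sqrt_coeff_def)
qed

lemma sqrt_coeff_nonpos: "sqrt_coeff (Suc n) \<le> 0"
proof (induction n)
  case 0 show ?case by (simp add: sqrt_coeff_Suc sqrt_coeff_0)
next
  case (Suc n)
  show ?case unfolding sqrt_coeff_Suc[of "Suc n"]
    by (rule mult_nonpos_nonneg[OF Suc]) simp
qed

text \<open>Vandermonde's identity for 1/2 + 1/2 = 1: the Cauchy square of the series is the
  polynomial 1 - x.\<close>

lemma sqrt_coeff_convolution:
  "(\<Sum>i\<le>n. sqrt_coeff i * sqrt_coeff (n - i)) = (if n = 0 then 1 else if n = 1 then -1 else 0)"
proof -
  have "(\<Sum>i\<le>n. sqrt_coeff i * sqrt_coeff (n - i)) =
      (\<Sum>i\<le>n. (-1)^n * (((1/2) gchoose i) * ((1/2) gchoose (n - i))))"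
  proof (rule sum.cong)
    fix i assume "i \<in> {..n}"
    then have "(-1::real)^n = (-1)^i * (-1)^(n-i)" by (simp flip: power_add)
    then show "sqrt_coeff i * sqrt_coeff (n - i) =
        (-1)^n * (((1/2) gchoose i) * ((1/2) gchoose (n - i)))"
      by (simp only: sqrt_coeff_def mult_ac)
  qed simp
  also have "\<dots> = (-1)^n * ((1::real) gchoose n)"
    using gbinomial_Vandermonde[of "1/2::real" "1/2" n]
    by (simp add: atLeast0AtMost flip: sum_distrib_left)
  also have "\<dots> = (if n = 0 then 1 else if n = 1 then -1 else 0)"
    using binomial_gbinomial[of 1 n, where 'a=real] by (cases n) (auto simp: binomial_eq_0)
  finally show ?thesis .
qed

text \<open>The closed form shows that all partial sums are nonnegative, since
  \<open>sqrt_coeff (Suc n)\<close> is nonpositive.\<close>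

lemma sqrt_coeff_partial_sum: "(\<Sum>i\<le>n. sqrt_coeff i) = - (2 * real n + 2) * sqrt_coeff (Suc n)"
proof (induction n)
  case 0 show ?case by (simp add: sqrt_coeff_Suc sqrt_coeff_0)
next
  case (Suc n)
  have "(2 * real (Suc n) + 2) * sqrt_coeff (Suc (Suc n)) = (2 * real n + 1) * sqrt_coeff (Suc n)"
    unfolding sqrt_coeff_Suc[of "Suc n"] by (simp add: field_simps)
  then show ?case using Suc by (simp add: algebra_simps)
qed

text \<open>All coefficients after the leading 1 are nonpositive, so the absolute partial sums are 2
  minus the plain ones, which are nonnegative. Summability at the boundary admits every x of norm at
  most 1, and the bound 2 leaves the bound 1 for the series without its constant term.\<close>

lemma summable_abs_sqrt_coeff:
  "summable (\<lambda>n. \<bar>sqrt_coeff n\<bar>)" "(\<Sum>n. \<bar>sqrt_coeff n\<bar>) \<le> 2"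
proof -
  have *: "(\<Sum>i\<le>n. \<bar>sqrt_coeff i\<bar>) = 2 - (\<Sum>i\<le>n. sqrt_coeff i)" for n
  proof (induction n)
    case 0 show ?case by (simp add: sqrt_coeff_0)
  next
    case (Suc n) then show ?case using sqrt_coeff_nonpos[of n] by simp
  qed
  have "(\<Sum>i\<le>n. \<bar>sqrt_coeff i\<bar>) \<le> 2" for n
    unfolding * sqrt_coeff_partial_sum
    using mult_nonneg_nonpos[OF _ sqrt_coeff_nonpos[of n], of "2 * real n + 2"] by (simp add: algebra_simps)
  then have "(\<Sum>i<n. \<bar>sqrt_coeff i\<bar>) \<le> 2" for n
    by (cases n) (auto simp: lessThan_Suc_atMost)
  then show "summable (\<lambda>n. \<bar>sqrt_coeff n\<bar>)" "(\<Sum>n. \<bar>sqrt_coeff n\<bar>) \<le> 2"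
    by (auto intro!: summableI_nonneg_bounded[where x=2] suminf_le_const)
qed

definition sqrt_series :: "'a::unital_cstar_algebra \<Rightarrow> 'a" where
  "sqrt_series x = (\<Sum>n. sqrt_coeff n *\<^sub>R x ^ n)"

lemma norm_sqrt_series_term:
  assumes "norm (x::'a::unital_cstar_algebra) \<le> 1"
  shows "norm (sqrt_coeff n *\<^sub>R x ^ n) \<le> \<bar>sqrt_coeff n\<bar>"
  using norm_power_ineq[of x n] power_le_one[OF norm_ge_zero assms, of n] by (simp add: mult_left_le)

lemma summable_norm_sqrt_series:
  assumes "norm (x::'a::unital_cstar_algebra) \<le> 1"
  shows "summable (\<lambda>n. norm (sqrt_coeff n *\<^sub>R x ^ n))"
  by (rule summable_comparison_test[OF _ summable_abs_sqrt_coeff(1)])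
    (use norm_sqrt_series_term[OF assms] in auto)

text \<open>Because of this estimate a root passes the same norm test as the element it comes from,
  so roots are positive and not merely selfadjoint.\<close>

lemma norm_one_minus_sqrt_series:
  assumes "norm (x::'a::unital_cstar_algebra) \<le> 1"
  shows "norm (1 - sqrt_series x) \<le> 1"
proof -
  let ?f = "\<lambda>n. sqrt_coeff n *\<^sub>R x ^ n"
  note sm = summable_norm_sqrt_series[OF assms]
  have sm1: "summable (\<lambda>n. norm (?f (Suc n)))"
    using sm summable_Suc_iff[of "\<lambda>n. norm (?f n)"] by simp
  have sm2: "summable (\<lambda>n. \<bar>sqrt_coeff (Suc n)\<bar>)"
    using summable_abs_sqrt_coeff(1) summable_Suc_iff[of "\<lambda>n. \<bar>sqrt_coeff n\<bar>"] by simp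
  have "norm (1 - sqrt_series x) = norm (\<Sum>n. ?f (Suc n))"
    using suminf_split_head[OF summable_norm_cancel[OF sm]]
    by (simp add: sqrt_series_def sqrt_coeff_0 norm_minus_commute)
  also have "\<dots> \<le> (\<Sum>n. norm (?f (Suc n)))"
    by (rule summable_norm[OF sm1])
  also have "\<dots> \<le> (\<Sum>n. \<bar>sqrt_coeff (Suc n)\<bar>)"
    by (rule suminf_le[OF norm_sqrt_series_term[OF assms] sm1 sm2])
  also have "\<dots> \<le> 1"
    using suminf_split_head[OF summable_abs_sqrt_coeff(1)] summable_abs_sqrt_coeff(2)
    by (simp add: sqrt_coeff_0)
  finally show ?thesis .
qed

lemma sqrt_series_square:
  assumes "norm (x::'a::unital_cstar_algebra) \<le> 1"
  shows "sqrt_series x * sqrt_series x = 1 - x"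
proof -
  have "sqrt_series x * sqrt_series x =
      (\<Sum>n. \<Sum>i\<le>n. (sqrt_coeff i *\<^sub>R x ^ i) * (sqrt_coeff (n - i) *\<^sub>R x ^ (n - i)))"
    unfolding sqrt_series_def
    by (rule Cauchy_product[OF summable_norm_sqrt_series summable_norm_sqrt_series])
      (use assms in auto)
  also have "\<dots> = (\<Sum>n. (\<Sum>i\<le>n. sqrt_coeff i * sqrt_coeff (n - i)) *\<^sub>R x ^ n)"
    by (rule arg_cong[where f=suminf], rule ext, unfold scaleR_sum_left, rule sum.cong)
      (auto simp flip: power_add)
  also have "\<dots> = (\<Sum>n. (if n = 0 then 1 else if n = 1 then -1 else 0) *\<^sub>R x ^ n)"
    by (simp only: sqrt_coeff_convolution)
  also have "\<dots> = (\<Sum>n\<in>{0,1}. (if n = 0 then 1 else if n = 1 then -1 else 0) *\<^sub>R x ^ n)"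
    by (rule suminf_finite) auto
  finally show ?thesis by simp
qed

lemma star_sqrt_series:
  assumes "norm (x::'a::unital_cstar_algebra) \<le> 1"
  shows "star (sqrt_series x) = sqrt_series (star x)"
  unfolding sqrt_series_def
  using bounded_linear.suminf[OF bounded_linear_star
      summable_norm_cancel[OF summable_norm_sqrt_series[OF assms]]]
  by (simp add: star_scaleR star_power)

lemma sqrt_series_commute:
  assumes "norm (x::'a::unital_cstar_algebra) \<le> 1" "y * x = x * y"
  shows "y * sqrt_series x = sqrt_series x * y"
proof -
  note sm = summable_norm_cancel[OF summable_norm_sqrt_series[OF assms(1)]]
  have "y * x ^ n = x ^ n * y" for n
    by (induction n) (simp_all add: mult.assoc, metis assms(2) mult.assoc)
  then show ?thesis
    unfolding sqrt_series_def suminf_mult[OF sm, symmetric] suminf_mult2[OF sm] by simp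
qed

text \<open>
  That \<open>star x * x\<close> is positive in this sense is the theorem of Kelley and Vaught,
  \<open>positive_star_mult\<close> below.
\<close>

definition positive :: "'a::unital_cstar_algebra \<Rightarrow> bool" where
  "positive a \<longleftrightarrow> (\<exists>s. star s = s \<and> s * s = a)"

lemma positive_selfadjoint: "positive a \<Longrightarrow> star a = a"
  by (auto simp: positive_def star_mult)

lemma positive_square: "star s = s \<Longrightarrow> positive (s * s)"
  by (auto simp: positive_def)

lemma positive_of_real: "0 \<le> r \<Longrightarrow> positive (of_real r)"
  using positive_square[of "of_real (sqrt r)"] by (simp flip: of_real_mult)

lemma positive_zero [simp]: "positive 0"
  using positive_of_real[of 0] by simp

lemma norm_square_selfadjoint:
  "star s = s \<Longrightarrow> norm (s * s) = (norm (s::'a::unital_cstar_algebra))\<^sup>2"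
  using cstar_identity[of s] by simp

text \<open>The root is a power series in \<open>1 - a / t\<close>, so it commutes with whatever commutes with \<open>a\<close>.\<close>

lemma sqrt_exists:
  fixes a :: "'a::unital_cstar_algebra"
  assumes "star a = a" "norm (of_real t - a) \<le> t"
  shows "\<exists>s. star s = s \<and> s * s = a \<and> norm (of_real (sqrt t) - s) \<le> sqrt t \<and>
    (\<forall>y. y * a = a * y \<longrightarrow> y * s = s * y)"
proof (cases "t = 0")
  case True
  then have "a = 0" using assms by simp
  then show ?thesis by (intro exI[of _ 0]) (simp add: True)
next
  case False
  then have t: "t > 0" using assms(2) norm_ge_zero[of "of_real t - a"] by linarith
  define x where "x = 1 - (1/t) *\<^sub>R a"
  have "x = (1/t) *\<^sub>R (of_real t - a)" using t by (simp add: x_def scaleR_diff_right of_real_def)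
  then have "norm x = norm (of_real t - a) / t" using t by simp
  then have x: "norm x \<le> 1" using assms(2) t by simp
  have sx: "star x = x" using assms(1) by (simp add: x_def star_diff star_scaleR)
  have sq: "sqrt_series x * sqrt_series x = (1/t) *\<^sub>R a"
    using sqrt_series_square[OF x] by (simp add: x_def)
  show ?thesis
  proof (intro exI[of _ "sqrt t *\<^sub>R sqrt_series x"] conjI allI impI)
    show "star (sqrt t *\<^sub>R sqrt_series x) = sqrt t *\<^sub>R sqrt_series x"
      by (simp add: star_scaleR star_sqrt_series[OF x] sx)
    show "sqrt t *\<^sub>R sqrt_series x * sqrt t *\<^sub>R sqrt_series x = a"
      using t by (simp add: sq flip: real_sqrt_mult)
    have "of_real (sqrt t) - sqrt t *\<^sub>R sqrt_series x = sqrt t *\<^sub>R (1 - sqrt_series x)"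
      by (simp add: scaleR_diff_right of_real_def)
    then show "norm (of_real (sqrt t) - sqrt t *\<^sub>R sqrt_series x) \<le> sqrt t"
      using t norm_one_minus_sqrt_series[OF x] by (simp add: mult_left_le)
    fix y assume "y * a = a * y"
    then have "y * x = x * y" by (simp add: x_def algebra_simps)
    then show "y * sqrt t *\<^sub>R sqrt_series x = sqrt t *\<^sub>R sqrt_series x * y"
      using sqrt_series_commute[OF x] by simp
  qed
qed

definition imag_unit :: "'a::unital_cstar_algebra" where
  "imag_unit = cscale \<i> 1"

lemma imag_unit:
  "star imag_unit = (- imag_unit :: 'a::unital_cstar_algebra)"
  "imag_unit * imag_unit = (- 1 :: 'a)"
  "imag_unit * x = x * (imag_unit :: 'a)"
  "norm (imag_unit :: 'a) = 1"
proof -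
  have neg: "cscale (- l) x = - cscale l (x::'a)" for l x
    using cscale_add_left[of l "- l" x] by (simp add: eq_neg_iff_add_eq_0 add.commute)
  show "star imag_unit = (- imag_unit :: 'a)"
    by (simp add: imag_unit_def star_cscale neg)
  have "cscale (- 1) (1::'a) = - 1" using cscale_of_real[of "-1" "1::'a"] by simp
  then show "imag_unit * imag_unit = (- 1 :: 'a)"
    by (simp add: imag_unit_def cscale_mult_left cscale_cscale)
  show "imag_unit * x = x * (imag_unit :: 'a)"
    by (simp add: imag_unit_def cscale_mult_left cscale_mult_right)
  show "norm (imag_unit :: 'a) = 1" by (simp add: imag_unit_def norm_cscale)
qed

text \<open>The element \<open>(h + i w) / t\<close> is unitary.\<close>

lemma norm_le_if_sum_squares:
  fixes h w :: "'a::unital_cstar_algebra"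
  assumes h: "star h = h" and w: "star w = w" and "h * w = w * h"
    and "h * h + w * w = of_real (t\<^sup>2)" "0 \<le> t"
  shows "norm h \<le> t" "norm w \<le> t"
proof -
  define u where "u = h + imag_unit * w"
  have su: "star u = h - imag_unit * w"
    by (simp add: u_def star_add star_mult h w imag_unit(1)) (simp add: imag_unit(3))
  have "star u * u = h * h + h * imag_unit * w - imag_unit * w * h - imag_unit * w * imag_unit * w"
    unfolding su by (simp add: u_def algebra_simps)
  also have "h * imag_unit * w = imag_unit * w * h"
    by (metis assms(3) imag_unit(3) mult.assoc)
  also have "imag_unit * w * imag_unit * w = - (w * w)"
    by (metis imag_unit(2,3) mult.assoc mult_minus1)
  finally have "star u * u = of_real (t\<^sup>2)" using assms(4) by simp
  then have "(norm u)\<^sup>2 = t\<^sup>2" using cstar_identity[of u] by (simp flip: of_real_power)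
  then have nu: "norm u = t" using assms(5) by (simp add: power2_eq_iff_nonneg)
  have "2 *\<^sub>R h = u + star u" by (simp add: u_def su[unfolded u_def] scaleR_2)
  then have "2 * norm h \<le> norm u + norm (star u)"
    by (metis norm_scaleR abs_numeral norm_triangle_ineq)
  then show "norm h \<le> t" using nu by simp
  have "2 *\<^sub>R (imag_unit * w) = u - star u" by (simp add: u_def su[unfolded u_def] scaleR_2)
  then have "2 * norm (imag_unit * w) \<le> norm u + norm (star u)"
    by (metis norm_scaleR abs_numeral norm_triangle_ineq4)
  moreover have "w = - (imag_unit * (imag_unit * w))"
    by (simp add: imag_unit(2) flip: mult.assoc)
  then have "norm w \<le> norm (imag_unit * w)"
    by (metis norm_minus_cancel norm_mult_ineq imag_unit(4) mult_1)
  ultimately show "norm w \<le> t" using nu by simp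
qed

text \<open>After scaling to norm at most 1, \<open>g * g\<close> and the square of
  \<open>sqrt_series (g * g)\<close> add up to 1, so this root has norm at most 1, and so has its
  square 1 - \<open>g * g\<close>. Together with the converse \<open>positive_if_norm_test\<close>,
  positivity of a selfadjoint element becomes a norm inequality.\<close>

lemma positive_norm_test:
  fixes a :: "'a::unital_cstar_algebra"
  assumes "positive a" "norm a \<le> t"
  shows "norm (of_real t - a) \<le> t"
proof -
  obtain h where h: "star h = h" "h * h = a" using assms(1) by (auto simp: positive_def)
  have t: "0 \<le> t" using assms(2) norm_ge_zero[of a] by linarith
  show ?thesis
  proof (cases "t = 0")
    case True then show ?thesis using assms(2) by simp
  next
    case False
    define g where "g = (1 / sqrt t) *\<^sub>R h"
    have sg: "star g = g" by (simp add: g_def star_scaleR h)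
    have gg: "g * g = (1/t) *\<^sub>R a" using t by (simp add: g_def h flip: real_sqrt_mult)
    have n: "norm (g * g) \<le> 1" using assms(2) t False by (simp add: gg field_simps)
    let ?w = "sqrt_series (g * g)"
    have "norm ?w \<le> 1"
    proof (rule norm_le_if_sum_squares(2)[of g])
      show "star ?w = ?w" by (simp add: star_sqrt_series[OF n] star_mult sg)
      show "g * ?w = ?w * g" by (rule sqrt_series_commute[OF n]) (simp add: mult.assoc)
      show "g * g + ?w * ?w = of_real (1\<^sup>2)" by (simp add: sqrt_series_square[OF n])
    qed (simp_all add: sg)
    then have "norm (?w * ?w) \<le> 1"
      by (metis norm_mult_ineq mult_le_one norm_ge_zero order_trans)
    then have "norm (1 - g * g) \<le> 1" by (simp add: sqrt_series_square[OF n])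
    moreover have "of_real t - a = t *\<^sub>R (1 - g * g)"
      using False by (simp add: gg algebra_simps of_real_def)
    ultimately show ?thesis using t by (simp add: mult_left_le)
  qed
qed

lemma positive_if_norm_test:
  fixes a :: "'a::unital_cstar_algebra"
  assumes "star a = a" "norm (of_real t - a) \<le> t"
  shows "positive a"
  using sqrt_exists[OF assms] by (auto simp: positive_def)

section \<open>The positive cone: roots, sums, products, limits and norm monotonicity\<close>

lemma positive_sqrt:
  fixes a :: "'a::unital_cstar_algebra"
  assumes "positive a"
  obtains s where "positive s" "star s = s" "s * s = a" "\<And>y. y * a = a * y \<Longrightarrow> y * s = s * y"
  using sqrt_exists[OF positive_selfadjoint positive_norm_test, OF assms assms order_refl]
    positive_if_norm_test by blast

text \<open>A sum of two squares is not visibly a square; the norm test reduces additivity to the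
  triangle inequality.\<close>

lemma positive_add:
  fixes a b :: "'a::unital_cstar_algebra"
  assumes "positive a" "positive b"
  shows "positive (a + b)"
proof (rule positive_if_norm_test)
  show "star (a + b) = a + b" using assms by (simp add: star_add positive_selfadjoint)
  have "norm ((of_real (norm a) - a) + (of_real (norm b) - b)) \<le> norm a + norm b"
    by (rule norm_triangle_le) (intro add_mono positive_norm_test assms order_refl)
  then show "norm (of_real (norm a + norm b) - (a + b)) \<le> norm a + norm b"
    by (simp add: algebra_simps)
qed

lemma positive_sum:
  "(\<And>i. i \<in> I \<Longrightarrow> positive (f i)) \<Longrightarrow> positive (sum f I)"
  by (induction I rule: infinite_finite_induct) (simp_all add: positive_add)

lemma positive_scaleR:
  fixes a :: "'a::unital_cstar_algebra"
  assumes "positive a" "0 \<le> r"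
  shows "positive (r *\<^sub>R a)"
proof -
  obtain h where "star h = h" "h * h = a" using assms(1) by (auto simp: positive_def)
  then show ?thesis using positive_square[of "sqrt r *\<^sub>R h"] assms(2)
    by (simp add: star_scaleR flip: real_sqrt_mult)
qed

lemma positive_mult:
  fixes a b :: "'a::unital_cstar_algebra"
  assumes "positive a" "positive b" "a * b = b * a"
  shows "positive (a * b)"
proof -
  obtain s where s: "star s = s" "s * s = a" "\<And>y. y * a = a * y \<Longrightarrow> y * s = s * y"
    using positive_sqrt[OF assms(1)] by blast
  obtain r where r: "star r = r" "r * r = b" "\<And>y. y * b = b * y \<Longrightarrow> y * r = r * y"
    using positive_sqrt[OF assms(2)] by blast
  have rs: "s * r = r * s" using assms(3) r(3) s(3) by metis
  have "star (s * r) = s * r" using r(1) s(1) rs by (simp add: star_mult)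
  moreover have "(s * r) * (s * r) = a * b"
    by (metis rs r(2) s(2) mult.assoc)
  ultimately show ?thesis using positive_square by metis
qed

text \<open>A convergent sequence has a common norm bound K, and the norm test with this single K
  passes to the limit.\<close>

lemma positive_tendsto:
  fixes f :: "nat \<Rightarrow> 'a::unital_cstar_algebra"
  assumes lim: "f \<longlonglongrightarrow> a" and pos: "\<And>n. positive (f n)"
  shows "positive a"
proof -
  obtain K where K: "\<And>n. norm (f n) \<le> K"
    using convergent_imp_Bseq[OF convergentI[OF lim]] by (auto simp: Bseq_def)
  show ?thesis
  proof (rule positive_if_norm_test)
    show "star a = a"
      using tendsto_star[OF lim] lim LIMSEQ_unique pos by (simp add: positive_selfadjoint)
    have "(\<lambda>n. norm (of_real K - f n)) \<longlonglongrightarrow> norm (of_real K - a)"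
      by (intro tendsto_intros lim)
    then show "norm (of_real K - a) \<le> K"
      by (rule LIMSEQ_le_const2) (use positive_norm_test[OF pos K] in auto)
  qed
qed

lemma positive_of_real_diff:
  fixes a :: "'a::unital_cstar_algebra"
  assumes "star a = a" "norm a \<le> t"
  shows "positive (of_real t - a)"
  by (rule positive_if_norm_test[of _ t]) (use assms in \<open>simp_all add: star_diff\<close>)

text \<open>The product (t - h)(t + h) = t^2 - h^2 of commuting positive elements has a root w that
  commutes with h, so \<open>norm_le_if_sum_squares\<close> applies.\<close>

lemma norm_le_if_between:
  fixes h :: "'a::unital_cstar_algebra"
  assumes "positive (of_real t - h)" "positive (of_real t + h)" "0 \<le> t"
  shows "norm h \<le> t"
proof -
  have h: "star h = h"
    using positive_selfadjoint[OF assms(2)] by (simp add: star_add)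
  have "positive ((of_real t - h) * (of_real t + h))"
    by (rule positive_mult[OF assms(1,2)]) (simp add: algebra_simps of_real_def)
  moreover have eq: "(of_real t - h) * (of_real t + h) = of_real (t\<^sup>2) - h * h"
    by (simp add: algebra_simps of_real_def power2_eq_square)
  ultimately obtain w where w: "star w = w" "w * w = of_real (t\<^sup>2) - h * h"
    "\<And>y. y * (of_real (t\<^sup>2) - h * h) = (of_real (t\<^sup>2) - h * h) * y \<Longrightarrow> y * w = w * y"
    using positive_sqrt[of "of_real (t\<^sup>2) - h * h"] by metis
  have "h * w = w * h"
    by (rule w(3)) (simp add: algebra_simps of_real_def)
  then show ?thesis
    using norm_le_if_sum_squares(1)[OF h w(1) _ _ assms(3)] by (simp add: w(2))
qed

lemma norm_le_if_positive_diff: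
  fixes a :: "'a::unital_cstar_algebra"
  assumes "positive a" "positive (of_real t - a)" "0 \<le> t"
  shows "norm a \<le> t"
proof -
  \<comment> \<open>Centering: if a lies between 0 and t, then 2 a - t lies between -t and
    t.\<close>
  have "norm (2 *\<^sub>R a - of_real t) \<le> t"
    by (rule norm_le_if_between)
      (use positive_scaleR[OF assms(2), of 2] positive_scaleR[OF assms(1), of 2] assms(3)
        in \<open>simp_all add: algebra_simps scaleR_2\<close>)
  then have "norm (2 *\<^sub>R a) \<le> t + norm (of_real t :: 'a)"
    using norm_triangle_sub[of "2 *\<^sub>R a" "of_real t"] by linarith
  then show ?thesis using assms(3) by simp
qed

lemma positive_norm_mono:
  fixes a b :: "'a::unital_cstar_algebra"
  assumes "positive a" "positive (b - a)"
  shows "norm a \<le> norm b"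
proof (rule norm_le_if_positive_diff[OF assms(1)])
  have "star b = b"
    using positive_add[OF assms] positive_selfadjoint[of b] by simp
  then show "positive (of_real (norm b) - a)"
    using positive_add[OF positive_of_real_diff[of b "norm b"] assms(2)] by simp
qed simp

text \<open>Neumann series: c + e is T (1 - x), where x has norm less than 1 because c passes the
  norm test. The inverses replace those of noninvertible c and are used with e tending to 0.\<close>

lemma positive_inverse:
  fixes c :: "'a::unital_cstar_algebra"
  assumes "positive c" "0 < e"
  obtains r where "positive r" "r * (c + of_real e) = 1" "(c + of_real e) * r = 1"
    "\<And>y. y * c = c * y \<Longrightarrow> y * r = r * y" "norm (e *\<^sub>R r) \<le> 1"
proof -
  define T where "T = norm c + e"
  have T: "T > 0" using assms(2) by (simp add: T_def add_nonneg_pos)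
  define x where "x = (1/T) *\<^sub>R (of_real (norm c) - c)"
  have "norm x = norm (of_real (norm c) - c) / T" using T by (simp add: x_def)
  moreover have "norm (of_real (norm c) - c) < T"
    using positive_norm_test[OF assms(1) order_refl] assms(2) by (simp add: T_def)
  ultimately have "norm x < 1" using T by simp
  then have sm: "summable (\<lambda>n. x ^ n)" by (rule complete_algebra_summable_geometric)
  define q where "q = (\<Sum>n. x ^ n)"
  have Suc: "(\<Sum>n. x ^ Suc n) = q - 1"
    using suminf_split_head[OF sm] by (simp add: q_def)
  have xq: "x * q = q - 1" and qx: "q * x = q - 1"
    using suminf_mult[OF sm, of x] suminf_mult2[OF sm, of x] Suc
    by (simp_all add: q_def power_commutes)
  have ce: "c + of_real e = T *\<^sub>R (1 - x)"
  proof -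
    have "T *\<^sub>R x = of_real (norm c) - c" using T by (simp add: x_def)
    then show ?thesis by (simp add: scaleR_diff_right T_def algebra_simps of_real_def)
  qed
  define r where "r = (1/T) *\<^sub>R q"
  have r1: "r * (c + of_real e) = 1" using T by (simp add: ce r_def algebra_simps qx)
  have r2: "(c + of_real e) * r = 1" using T by (simp add: ce r_def algebra_simps xq)
  have comm: "y * r = r * y" if "y * c = c * y" for y
  proof -
    have "y * (c + of_real e) = (c + of_real e) * y"
      using that by (simp add: algebra_simps of_real_def)
    then show ?thesis by (metis r1 r2 mult.assoc mult_1 mult_1_right)
  qed
  have sce: "star (c + of_real e) = c + of_real e"
    using positive_selfadjoint[OF assms(1)] by (simp add: star_add)
  have sr: "star r = r"
  proof -
    have "star r * (c + of_real e) = 1" using arg_cong[OF r2, of star] by (simp add: star_mult sce)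
    then show ?thesis by (metis r2 mult.assoc mult_1 mult_1_right)
  qed
  have pce: "positive (c + of_real e)"
    by (rule positive_add[OF assms(1) positive_of_real]) (use assms(2) in simp)
  \<comment> \<open>The inverse r equals (c + e) r^2, a product of commuting positive
    elements.\<close>
  have "positive ((c + of_real e) * (r * r))"
    by (rule positive_mult[OF pce positive_square[OF sr]]) (metis r1 r2 mult.assoc mult_1 mult_1_right)
  then have pr: "positive r" by (metis r2 mult.assoc mult_1)
  have cr: "c * r = r * c" using comm[of c] by simp
  have "positive (1 - e *\<^sub>R r)"
  proof -
    have "1 - e *\<^sub>R r = c * r" using r2 by (simp add: algebra_simps of_real_def)
    then show ?thesis using positive_mult[OF assms(1) pr cr] by simp
  qed
  then have "norm (e *\<^sub>R r) \<le> 1"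
    using norm_le_if_positive_diff[OF positive_scaleR[OF pr], of e 1] assms(2) by simp
  then show ?thesis using that pr r1 r2 comm by blast
qed

lemma positive_add_of_real_limit:
  fixes a :: "'a::unital_cstar_algebra"
  assumes "\<And>e. 0 < e \<Longrightarrow> positive (a + of_real e)"
  shows "positive a"
proof (rule positive_tendsto)
  have "(\<lambda>n. a + of_real (inverse (real (Suc n)))) \<longlonglongrightarrow> a + of_real 0"
    by (intro tendsto_intros LIMSEQ_inverse_real_of_nat)
  then show "(\<lambda>n. a + of_real (inverse (real (Suc n)))) \<longlonglongrightarrow> a" by simp
  show "positive (a + of_real (inverse (real (Suc n))))" for n
    by (rule assms) simp
qed

text \<open>
  With \<open>h = c + b + e\<close> one has \<open>2 (c + e) h = h\<^sup>2 + 2 e c + e\<^sup>2\<close>, so \<open>h\<close> is a product of commuting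
  positive elements.
\<close>

lemma positive_add_if_squares_eq:
  fixes b c :: "'a::unital_cstar_algebra"
  assumes b: "star b = b" and c: "positive c" and bc: "b * c = c * b" and sq: "c * c = b * b"
  shows "positive (c + b)"
proof (rule positive_add_of_real_limit)
  fix e :: real assume e: "0 < e"
  obtain r where r: "positive r" "r * (c + of_real e) = 1" "(c + of_real e) * r = 1"
    "\<And>y. y * c = c * y \<Longrightarrow> y * r = r * y"
    using positive_inverse[OF c e] by metis
  define h where "h = c + b + of_real e"
  have sh: "star h = h" by (simp add: h_def star_add b positive_selfadjoint[OF c])
  define k where "k = h * h + e *\<^sub>R c + e *\<^sub>R c + of_real (e * e)"
  have pk: "positive k" unfolding k_def
    by (intro positive_add positive_square sh positive_scaleR c positive_of_real) (use e in auto)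
  have k: "k = (c + of_real e) * h + (c + of_real e) * h"
    using sq bc by (simp add: k_def h_def algebra_simps of_real_def)
  have hc: "h * c = c * h" using bc by (simp add: h_def algebra_simps of_real_def)
  have kc: "k * c = c * k" by (simp add: k algebra_simps of_real_def)
      (metis hc mult.assoc)
  have "positive (r * k)"
    by (rule positive_mult[OF r(1) pk]) (simp add: r(4)[OF kc])
  then have "positive ((1/2) *\<^sub>R (r * k))" by (rule positive_scaleR) simp
  moreover have "(1/2) *\<^sub>R (r * k) = h" using r(2) by (simp add: k distrib_left flip: mult.assoc)
  ultimately show "positive (c + b + of_real e)" by (simp add: h_def)
qed

text \<open>Here c is the absolute value of b, and m and n are (c + b)/2 and (c - b)/2; their
  products vanish because c^2 = b^2 and c commutes with b.\<close>

lemma selfadjoint_decomposition: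
  fixes b :: "'a::unital_cstar_algebra"
  assumes b: "star b = b"
  obtains m n where "positive m" "positive n" "b = m - n" "m * n = 0" "n * m = 0"
proof -
  obtain c where c: "positive c" "c * c = b * b" "\<And>y. y * (b * b) = (b * b) * y \<Longrightarrow> y * c = c * y"
    using positive_sqrt[OF positive_square[OF b]] by metis
  have bc: "b * c = c * b" by (rule c(3)) (simp add: mult.assoc)
  have "positive (c + b)" "positive (c + - b)"
    by (rule positive_add_if_squares_eq; use b c(1,2) bc in \<open>simp add: star_minus\<close>)+
  then have "positive ((1/2) *\<^sub>R (c + b))" "positive ((1/2) *\<^sub>R (c - b))"
    by (simp_all add: positive_scaleR)
  moreover have "b = (1/2) *\<^sub>R (c + b) - (1/2) *\<^sub>R (c - b)"
    by (simp add: algebra_simps flip: scaleR_2)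
  moreover have "(c + b) * (c - b) = 0" "(c - b) * (c + b) = 0"
    using c(2) bc by (simp_all add: algebra_simps)
  ultimately show ?thesis
    using that[of "(1/2) *\<^sub>R (c + b)" "(1/2) *\<^sub>R (c - b)"] by simp
qed

text \<open>
  For \<open>y = x n\<close>, where \<open>n\<close> is the negative part of \<open>star x * x\<close>, the element \<open>star y * y\<close> is
  negative and \<open>p = y * star y\<close> is positive.  With \<open>t = norm p\<close>, the element
  \<open>(t + p) p = y (t + star y * y) star y\<close> has norm at most \<open>t\<^sup>2\<close>, but it dominates \<open>2 p\<^sup>2\<close>.
\<close>

theorem positive_star_mult: "positive (star x * (x::'a::unital_cstar_algebra))"
proof -
  define b where "b = star x * x"
  have "star b = b" by (simp add: b_def star_mult star_star)
  then obtain m n where mn: "positive m" "positive n" "b = m - n" "m * n = 0" "n * m = 0"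
    using selfadjoint_decomposition by blast
  note sn = positive_selfadjoint[OF mn(2)]
  define y where "y = x * n"
  define q where "q = n * (n * n)"
  have "star y * y = n * b * n" by (simp add: y_def b_def star_mult sn mult.assoc)
  then have yy: "star y * y = - q" by (simp add: mn(3) q_def algebra_simps mn(4,5) flip: mult.assoc)
  have pq: "positive q"
    unfolding q_def by (rule positive_mult[OF mn(2) positive_square[OF sn]]) (simp add: mult.assoc)
  define p where "p = y * star y"
  have pp: "positive p"
  proof -
    \<comment> \<open>Twice the real and the imaginary part of y: their squares add up to 2 (p +
      \<open>star y * y\<close>). Since \<open>star y * y\<close> is -q, adding the positive q
      leaves p alone.\<close>
    define h where "h = y + star y"
    define k where "k = imag_unit * (star y - y)"
    have "star h = h" by (simp add: h_def star_add star_star add.commute)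
    moreover have "star k = k"
      by (simp add: k_def star_mult star_diff star_star imag_unit(1) algebra_simps
          imag_unit(3)[of y] imag_unit(3)[of "star y"])
    ultimately have "positive (h * h + k * k)"
      by (intro positive_add positive_square)
    moreover have "h * h + k * k = 2 *\<^sub>R (p + star y * y)"
    proof -
      have "k * k = (imag_unit * imag_unit) * ((star y - y) * (star y - y))"
        unfolding k_def by (metis imag_unit(3) mult.assoc)
      then show ?thesis
        by (simp add: imag_unit(2) h_def p_def algebra_simps scaleR_2)
    qed
    ultimately have "positive ((1/2) *\<^sub>R (2 *\<^sub>R (p + star y * y)))"
      by (metis positive_scaleR zero_le_divide_1_iff zero_le_numeral)
    then have "positive (p + star y * y)" by simp
    from positive_add[OF this pq] show ?thesis by (simp add: yy)
  qed
  define t where "t = norm p"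
  have t: "t = (norm y)\<^sup>2" using cstar_identity[of "star y"] by (simp add: t_def p_def star_star)
  have nq: "norm q = t" using cstar_identity[of y] by (simp add: yy t)
  have t0: "0 \<le> t" by (simp add: t_def)
  have "norm (y * (of_real t - q) * star y) \<le> norm y * t * norm y"
    by (intro order_trans[OF norm_mult_ineq] mult_mono positive_norm_test[OF pq])
      (simp_all add: nq t0)
  also have "y * (of_real t - q) * star y = t *\<^sub>R p + p * p"
  proof -
    have "q = - (star y * y)" by (simp add: yy)
    then show ?thesis by (simp add: p_def algebra_simps of_real_def)
  qed
  also have "norm y * t * norm y = t\<^sup>2" by (simp add: t power2_eq_square mult_ac)
  finally have le: "norm (t *\<^sub>R p + p * p) \<le> t\<^sup>2" .
  have "norm (2 *\<^sub>R (p * p)) \<le> norm (t *\<^sub>R p + p * p)"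
  proof (rule positive_norm_mono)
    show "positive (2 *\<^sub>R (p * p))"
      by (intro positive_scaleR positive_square positive_selfadjoint pp) simp
    have "positive (p * (of_real t - p))"
      by (rule positive_mult[OF pp positive_of_real_diff])
        (simp_all add: t_def positive_selfadjoint[OF pp] algebra_simps of_real_def)
    then show "positive (t *\<^sub>R p + p * p - 2 *\<^sub>R (p * p))"
      by (simp add: algebra_simps of_real_def scaleR_2)
  qed
  moreover have "norm (p * p) = t\<^sup>2"
    using norm_square_selfadjoint[OF positive_selfadjoint[OF pp]] by (simp add: t_def)
  ultimately have "2 * t\<^sup>2 \<le> norm (t *\<^sub>R p + p * p)" by simp
  then have "t\<^sup>2 \<le> 0" using le by linarith
  then have "t = 0" by simp
  then have "q = 0" using nq by simp
  then have "n * n * (n * n) = 0" by (simp add: q_def mult.assoc)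
  then have "n = 0"
    using norm_square_selfadjoint[of "n * n"] norm_square_selfadjoint[OF sn] by (simp add: star_mult sn)
  then show ?thesis using mn(1,3) by (simp add: b_def)
qed

lemma positive_conj:
  fixes a y :: "'a::unital_cstar_algebra"
  assumes "positive a"
  shows "positive (star y * a * y)"
proof -
  obtain s where s: "star s = s" "s * s = a" using assms by (auto simp: positive_def)
  have "star (s * y) * (s * y) = star y * a * y"
    by (simp add: star_mult s(1) flip: s(2)) (simp add: mult.assoc)
  then show ?thesis using positive_star_mult by metis
qed

section \<open>The Hilbert module of square-summable sequences\<close>

text \<open>
  The hypothesis is positivity of \<open>\<langle>x a - y, x a - y\<rangle>\<close>, where \<open>X = \<langle>x, x\<rangle>\<close>, \<open>Y = \<langle>y, y\<rangle>\<close> and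
  \<open>Z = \<langle>x, y\<rangle>\<close>; it is applied to \<open>a = Z / s\<close> with \<open>s\<close> slightly larger than \<open>norm X\<close>.
\<close>

lemma cauchy_schwarz_abstract:
  fixes X Y Z :: "'a::unital_cstar_algebra"
  assumes pos: "\<And>a. positive (star a * X * a - star a * Z - star Z * a + Y)" and X: "star X = X"
  shows "(norm Z)\<^sup>2 \<le> norm X * norm Y"
proof -
  have *: "(norm Z)\<^sup>2 \<le> s * norm Y" if s: "norm X < s" for s
  proof -
    have s0: "0 < s" using s norm_ge_zero[of X] by linarith
    have "positive (star Z * (of_real s - X) * Z)"
      by (rule positive_conj, rule positive_of_real_diff[OF X]) (use s in simp)
    then have "positive ((1/s\<^sup>2) *\<^sub>R (star Z * (of_real s - X) * Z))"
      by (rule positive_scaleR) simp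
    from positive_add[OF this pos[of "(1/s) *\<^sub>R Z"]]
    have "positive (Y - (1/s) *\<^sub>R (star Z * Z))"
      using s0 by (simp add: star_scaleR algebra_simps of_real_def power2_eq_square)
    then have "norm ((1/s) *\<^sub>R (star Z * Z)) \<le> norm Y"
      by (rule positive_norm_mono[rotated]) (use s0 in \<open>intro positive_scaleR positive_star_mult, simp\<close>)
    then show ?thesis using s0 by (simp add: cstar_identity field_simps)
  qed
  have "(\<lambda>n. (norm X + inverse (real (Suc n))) * norm Y) \<longlonglongrightarrow> (norm X + 0) * norm Y"
    by (intro tendsto_intros LIMSEQ_inverse_real_of_nat)
  then have "(norm Z)\<^sup>2 \<le> (norm X + 0) * norm Y"
    by (rule LIMSEQ_le_const) (use * in auto)
  then show ?thesis by simp
qed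

lemma cauchy_schwarz_sum:
  fixes x y :: "'i \<Rightarrow> 'a::unital_cstar_algebra"
  shows "(norm (\<Sum>i\<in>I. star (x i) * y i))\<^sup>2 \<le>
    norm (\<Sum>i\<in>I. star (x i) * x i) * norm (\<Sum>i\<in>I. star (y i) * y i)"
proof (rule cauchy_schwarz_abstract)
  fix a
  have "star a * (\<Sum>i\<in>I. star (x i) * x i) * a - star a * (\<Sum>i\<in>I. star (x i) * y i) -
      star (\<Sum>i\<in>I. star (x i) * y i) * a + (\<Sum>i\<in>I. star (y i) * y i) =
      (\<Sum>i\<in>I. star (x i * a - y i) * (x i * a - y i))"
    by (simp add: star_sum star_mult star_star star_diff sum_distrib_left sum_distrib_right
        sum_subtractf sum.distrib algebra_simps)
  then show "positive (star a * (\<Sum>i\<in>I. star (x i) * x i) * a - star a * (\<Sum>i\<in>I. star (x i) * y i) -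
      star (\<Sum>i\<in>I. star (x i) * y i) * a + (\<Sum>i\<in>I. star (y i) * y i))"
    by (simp add: positive_sum positive_star_mult)
qed (simp add: star_sum star_mult star_star)

section \<open>Finite-section seminorms and unordered summation\<close>

definition seminorm_on :: "'i set \<Rightarrow> ('i \<Rightarrow> 'a::unital_cstar_algebra) \<Rightarrow> real" where
  "seminorm_on I x = sqrt (norm (\<Sum>i\<in>I. star (x i) * x i))"

lemma seminorm_on_nonneg [simp]: "0 \<le> seminorm_on I x"
  by (simp add: seminorm_on_def)

lemma seminorm_on_power2: "(seminorm_on I x)\<^sup>2 = norm (\<Sum>i\<in>I. star (x i) * x i)"
  by (simp add: seminorm_on_def)

lemma norm_inner_sum_le: "norm (\<Sum>i\<in>I. star (x i) * y i) \<le> seminorm_on I x * seminorm_on I y"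
  by (rule power2_le_imp_le)
    (simp_all add: power_mult_distrib seminorm_on_power2 cauchy_schwarz_sum)

lemma seminorm_on_triangle: "seminorm_on I (\<lambda>i. x i + y i) \<le> seminorm_on I x + seminorm_on I y"
proof (rule power2_le_imp_le)
  have "(\<Sum>i\<in>I. star (x i + y i) * (x i + y i)) =
      (\<Sum>i\<in>I. star (x i) * x i) + (\<Sum>i\<in>I. star (x i) * y i) +
      ((\<Sum>i\<in>I. star (y i) * x i) + (\<Sum>i\<in>I. star (y i) * y i))"
    by (simp add: star_add algebra_simps sum.distrib)
  then have "(seminorm_on I (\<lambda>i. x i + y i))\<^sup>2 \<le>
      ((seminorm_on I x)\<^sup>2 + seminorm_on I x * seminorm_on I y) +
      (seminorm_on I y * seminorm_on I x + (seminorm_on I y)\<^sup>2)"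
    unfolding seminorm_on_power2
    by (simp only:) (intro norm_triangle_mono norm_inner_sum_le order_refl)
  then show "(seminorm_on I (\<lambda>i. x i + y i))\<^sup>2 \<le> (seminorm_on I x + seminorm_on I y)\<^sup>2"
    by (simp add: power2_eq_square algebra_simps)
qed simp

lemma seminorm_on_mono:
  assumes "finite J" "I \<subseteq> J"
  shows "seminorm_on I x \<le> seminorm_on J x"
proof -
  have "(\<Sum>i\<in>J. star (x i) * x i) - (\<Sum>i\<in>I. star (x i) * x i) = (\<Sum>i\<in>J - I. star (x i) * x i)"
    using assms by (simp add: sum_diff)
  then show ?thesis unfolding seminorm_on_def
    by (auto intro!: positive_norm_mono positive_sum positive_star_mult)
qed

text \<open>\<open>suminf\<close> adds in a fixed order, whereas splitting a sequence into even and
  odd positions rearranges series. Smallness of the sums over all finite sets beyond an initial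
  segment makes the sum independent of the order.\<close>

lemma has_sum_if_unordered_Cauchy:
  fixes g :: "nat \<Rightarrow> 'b::banach"
  assumes C: "\<And>e. 0 < e \<Longrightarrow> \<exists>N. \<forall>F. finite F \<longrightarrow> F \<inter> {..<N} = {} \<longrightarrow> norm (sum g F) < e"
  shows "(g has_sum suminf g) UNIV"
proof -
  have "summable g" unfolding summable_Cauchy
  proof (intro allI impI)
    fix e :: real assume "0 < e"
    then obtain N where N: "\<forall>F. finite F \<longrightarrow> F \<inter> {..<N} = {} \<longrightarrow> norm (sum g F) < e"
      using C by metis
    have "norm (sum g {m..<n}) < e" if "m \<ge> N" for m n
      by (rule N[rule_format]) (use that in auto)
    then show "\<exists>N. \<forall>m\<ge>N. \<forall>n. norm (sum g {m..<n}) < e" by blast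
  qed
  then have lim: "(\<lambda>n. sum g {..<n}) \<longlonglongrightarrow> suminf g" by (rule summable_LIMSEQ)
  show ?thesis unfolding has_sum_def tendsto_iff eventually_finite_subsets_at_top
  proof (intro allI impI)
    fix e :: real assume "0 < e"
    then obtain N where N: "\<forall>F. finite F \<longrightarrow> F \<inter> {..<N} = {} \<longrightarrow> norm (sum g F) < e/2"
      using C half_gt_zero by metis
    obtain M where M: "\<forall>n\<ge>M. dist (sum g {..<n}) (suminf g) < e/2"
      using lim \<open>0 < e\<close> by (metis half_gt_zero lim_sequentially)
    have "dist (sum g Y) (suminf g) < e" if Y: "finite Y" "{..<max N M} \<subseteq> Y" for Y
    proof -
      have "sum g Y = sum g {..<max N M} + sum g (Y - {..<max N M})"
        using Y by (metis sum.subset_diff add.commute)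
      moreover have "norm (sum g (Y - {..<max N M})) < e/2"
        by (rule N[rule_format]) (use Y in auto)
      moreover have "dist (sum g {..<max N M}) (suminf g) < e/2" using M by simp
      ultimately show ?thesis
        using norm_triangle_ineq[of "sum g {..<max N M} - suminf g" "sum g (Y - {..<max N M})"]
        by (simp add: dist_norm algebra_simps)
    qed
    then show "\<exists>X. finite X \<and> X \<subseteq> UNIV \<and> (\<forall>Y. finite Y \<and> X \<subseteq> Y \<and> Y \<subseteq> UNIV \<longrightarrow>
        dist (sum g Y) (suminf g) < e)"
      by (intro exI[of _ "{..<max N M}"]) auto
  qed
qed

text \<open>The terms are positive, so the seminorm grows with the index set and F can be enlarged
  to an interval, where the ordinary Cauchy condition applies.\<close>

lemma square_summable_tail:
  fixes x :: "nat \<Rightarrow> 'a::unital_cstar_algebra"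
  assumes "summable (\<lambda>n. star (x n) * x n)" "0 < e"
  shows "\<exists>N. \<forall>F. finite F \<longrightarrow> F \<inter> {..<N} = {} \<longrightarrow> seminorm_on F x < e"
proof -
  obtain N where N: "\<forall>m\<ge>N. \<forall>n. norm (\<Sum>i=m..<n. star (x i) * x i) < e\<^sup>2"
    using assms unfolding summable_Cauchy by (metis zero_less_power)
  have "seminorm_on F x < e" if F: "finite F" "F \<inter> {..<N} = {}" for F
  proof -
    obtain M where "\<forall>i\<in>F. i < M" using F(1) finite_nat_bounded[of F] by (auto simp: lessThan_def)
    then have "F \<subseteq> {N..<M}" using F(2) by fastforce
    then have "seminorm_on F x \<le> seminorm_on {N..<M} x" by (rule seminorm_on_mono[rotated]) simp
    also have "\<dots> < e" unfolding seminorm_on_def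
      using N assms(2) by (simp add: real_less_lsqrt)
    finally show ?thesis .
  qed
  then show ?thesis by blast
qed

lemma square_summable_if_tail:
  fixes x :: "nat \<Rightarrow> 'a::unital_cstar_algebra"
  assumes "\<And>e. 0 < e \<Longrightarrow> \<exists>N. \<forall>F. finite F \<longrightarrow> F \<inter> {..<N} = {} \<longrightarrow> seminorm_on F x < e"
  shows "summable (\<lambda>n. star (x n) * x n)"
proof (rule summable_on_imp_summable, rule has_sum_imp_summable, rule has_sum_if_unordered_Cauchy)
  fix e :: real assume "0 < e"
  then obtain N where "\<forall>F. finite F \<longrightarrow> F \<inter> {..<N} = {} \<longrightarrow> seminorm_on F x < sqrt e"
    using assms real_sqrt_gt_zero by metis
  then show "\<exists>N. \<forall>F. finite F \<longrightarrow> F \<inter> {..<N} = {} \<longrightarrow> norm (\<Sum>n\<in>F. star (x n) * x n) < e"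
    by (intro exI[of _ N]) (auto simp: seminorm_on_def)
qed

lemma inner_has_sum:
  fixes x y :: "nat \<Rightarrow> 'a::unital_cstar_algebra"
  assumes x: "summable (\<lambda>n. star (x n) * x n)" and y: "summable (\<lambda>n. star (y n) * y n)"
  shows "((\<lambda>n. star (x n) * y n) has_sum (\<Sum>n. star (x n) * y n)) UNIV"
proof (rule has_sum_if_unordered_Cauchy)
  fix e :: real assume e: "0 < e"
  obtain N where N: "\<forall>F. finite F \<longrightarrow> F \<inter> {..<N} = {} \<longrightarrow> seminorm_on F x < e"
    using square_summable_tail[OF x e] by blast
  \<comment> \<open>One small factor is enough in Cauchy-Schwarz; the other tail is merely kept
    below 1.\<close>
  obtain M where M: "\<forall>F. finite F \<longrightarrow> F \<inter> {..<M} = {} \<longrightarrow> seminorm_on F y < 1"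
    using square_summable_tail[OF y zero_less_one] by blast
  have "norm (\<Sum>n\<in>F. star (x n) * y n) < e" if F: "finite F" "F \<inter> {..<max N M} = {}" for F
  proof -
    have "F \<inter> {..<N} = {}" "F \<inter> {..<M} = {}" using F(2) by (auto simp: disjoint_iff)
    then have "seminorm_on F x < e" "seminorm_on F y < 1" using N M F(1) by auto
    then have "seminorm_on F x * seminorm_on F y < e * 1"
      by (intro mult_strict_mono) (use e in auto)
    then show ?thesis using norm_inner_sum_le[of x y F] by simp
  qed
  then show "\<exists>N. \<forall>F. finite F \<longrightarrow> F \<inter> {..<N} = {} \<longrightarrow> norm (\<Sum>n\<in>F. star (x n) * y n) < e" by blast
qed

lemmas inner_summable = inner_has_sum[THEN has_sum_imp_sums, THEN sums_summable]

lemma square_summable_add: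
  fixes x y :: "nat \<Rightarrow> 'a::unital_cstar_algebra"
  assumes x: "summable (\<lambda>n. star (x n) * x n)" and y: "summable (\<lambda>n. star (y n) * y n)"
  shows "summable (\<lambda>n. star (x n + y n) * (x n + y n))"
  using summable_add[OF summable_add[OF x inner_summable[OF x y]]
      summable_add[OF inner_summable[OF y x] y]]
  by (simp add: star_add algebra_simps)

lemma square_summable_mult:
  fixes x :: "nat \<Rightarrow> 'a::unital_cstar_algebra"
  assumes "summable (\<lambda>n. star (x n) * x n)"
  shows "summable (\<lambda>n. star (x n * a) * (x n * a))"
  using summable_mult[OF summable_mult2[OF assms, of a], of "star a"]
  by (simp add: star_mult mult.assoc)

text \<open>Making the sequences a type, not a carrier set, turns them into an instance of
  \<open>banach\<close> and gives access to series, Baire category and fixed point theorems.\<close>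

typedef (overloaded) 'a ell2 = "{x. summable (\<lambda>n. star (x n) * x n)} :: (nat \<Rightarrow> 'a::unital_cstar_algebra) set"
  morphisms coord Ell2
  by (rule exI[of _ "\<lambda>_. 0"]) simp

setup_lifting type_definition_ell2

lemma summable_coord: "summable (\<lambda>n. star (coord x n) * coord x n)"
  using coord[of x] by simp

lemma ell2_eqI: "(\<And>n. coord x n = coord y n) \<Longrightarrow> x = y"
  by (simp add: coord_inject[symmetric] fun_eq_iff)

section \<open>Inner product, action and norm on the sequence space\<close>

lift_definition ip :: "'a::unital_cstar_algebra ell2 \<Rightarrow> 'a ell2 \<Rightarrow> 'a" is
  "\<lambda>x y. \<Sum>n. star (x n) * y n" .

lift_definition act :: "'a::unital_cstar_algebra ell2 \<Rightarrow> 'a \<Rightarrow> 'a ell2" (infixl "\<odot>" 75) is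
  "\<lambda>x a n. x n * a"
  by (rule square_summable_mult)

instantiation ell2 :: (unital_cstar_algebra) real_normed_vector
begin

lift_definition zero_ell2 :: "'a ell2" is "\<lambda>_. 0" by simp

lift_definition plus_ell2 :: "'a ell2 \<Rightarrow> 'a ell2 \<Rightarrow> 'a ell2" is "\<lambda>x y n. x n + y n"
  by (rule square_summable_add)

lift_definition scaleR_ell2 :: "real \<Rightarrow> 'a ell2 \<Rightarrow> 'a ell2" is "\<lambda>r x n. r *\<^sub>R x n"
  using square_summable_mult[where a="of_real _"] by (simp add: of_real_def)

lift_definition uminus_ell2 :: "'a ell2 \<Rightarrow> 'a ell2" is "\<lambda>x n. - x n"
  by (simp add: star_minus)

lift_definition minus_ell2 :: "'a ell2 \<Rightarrow> 'a ell2 \<Rightarrow> 'a ell2" is "\<lambda>x y n. x n - y n"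
  using square_summable_add[where y="\<lambda>n. - _ n"] by (simp add: star_minus)

definition norm_ell2 :: "'a ell2 \<Rightarrow> real" where "norm_ell2 x = sqrt (norm (ip x x))"
definition dist_ell2 :: "'a ell2 \<Rightarrow> 'a ell2 \<Rightarrow> real" where "dist_ell2 x y = norm (x - y)"
definition sgn_ell2 :: "'a ell2 \<Rightarrow> 'a ell2" where "sgn_ell2 x = scaleR (inverse (norm x)) x"
definition [code del]: "(uniformity :: ('a ell2 \<times> 'a ell2) filter) =
  (INF e\<in>{0 <..}. principal {(x, y). dist x y < e})"
definition open_ell2 :: "'a ell2 set \<Rightarrow> bool" where
  [code del]: "open_ell2 S = (\<forall>x\<in>S. \<forall>\<^sub>F (x', y) in uniformity. x' = x \<longrightarrow> y \<in> S)"

text \<open>The triangle and Cauchy-Schwarz inequalities for sequences are obtained as limits of the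
  finite ones.\<close>

lemma seminorm_on_tendsto_norm: "(\<lambda>N. seminorm_on {..<N} (coord x)) \<longlonglongrightarrow> norm (x :: 'a ell2)"
  unfolding norm_ell2_def seminorm_on_def ip.rep_eq
  by (intro tendsto_intros summable_LIMSEQ summable_coord)

lemma seminorm_on_le_norm:
  assumes "finite F"
  shows "seminorm_on F (coord x) \<le> norm (x :: 'a ell2)"
proof -
  obtain M where M: "F \<subseteq> {..<M}" using finite_nat_bounded[OF assms] by blast
  show ?thesis
    by (rule LIMSEQ_le_const[OF seminorm_on_tendsto_norm[of x]])
      (use M in \<open>auto intro!: exI[of _ M] seminorm_on_mono\<close>)
qed

lemma norm_coord_le: "norm (coord x n) \<le> norm (x :: 'a ell2)"
  using seminorm_on_le_norm[of "{n}" x] by (simp add: seminorm_on_def cstar_identity)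

instance
proof
  fix x y :: "'a ell2" and a :: real
  show "norm x = 0 \<longleftrightarrow> x = 0"
  proof
    assume "norm x = 0"
    then show "x = 0" using norm_coord_le[of x] by (auto intro!: ell2_eqI simp: zero_ell2.rep_eq)
  qed (simp add: norm_ell2_def ip.rep_eq zero_ell2.rep_eq)
  show "norm (x + y) \<le> norm x + norm y"
  proof (rule LIMSEQ_le[OF seminorm_on_tendsto_norm
        tendsto_add[OF seminorm_on_tendsto_norm seminorm_on_tendsto_norm]])
    show "\<exists>N. \<forall>n\<ge>N. seminorm_on {..<n} (coord (x + y)) \<le>
        seminorm_on {..<n} (coord x) + seminorm_on {..<n} (coord y)"
      using seminorm_on_triangle by (auto simp: plus_ell2.rep_eq)
  qed
  have "ip (a *\<^sub>R x) (a *\<^sub>R x) = (a * a) *\<^sub>R ip x x"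
    unfolding ip.rep_eq scaleR_ell2.rep_eq
    using suminf_scaleR_right[OF summable_coord, of "a * a" x] by (simp add: star_scaleR)
  then show "norm (a *\<^sub>R x) = \<bar>a\<bar> * norm x"
    by (simp add: norm_ell2_def real_sqrt_mult)
qed (auto intro!: ell2_eqI simp: plus_ell2.rep_eq zero_ell2.rep_eq scaleR_ell2.rep_eq
    uminus_ell2.rep_eq minus_ell2.rep_eq algebra_simps dist_ell2_def sgn_ell2_def
    uniformity_ell2_def open_ell2_def)

end

lemmas coord_simps = plus_ell2.rep_eq zero_ell2.rep_eq scaleR_ell2.rep_eq
    uminus_ell2.rep_eq minus_ell2.rep_eq act.rep_eq

lemma norm_power2_ell2: "(norm x)\<^sup>2 = norm (ip x x)"
  by (simp add: norm_ell2_def)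

lemma ip_sums: "(\<lambda>n. star (coord x n) * coord y n) sums ip x y"
  using inner_has_sum[OF summable_coord summable_coord, THEN has_sum_imp_sums] by (simp add: ip.rep_eq)

lemma ip_add_right: "ip x (y + z) = ip x y + ip x z"
proof (rule sums_unique2[OF ip_sums])
  show "(\<lambda>n. star (coord x n) * coord (y + z) n) sums (ip x y + ip x z)"
    using sums_add[OF ip_sums[of x y] ip_sums[of x z]] by (simp add: coord_simps distrib_left)
qed

lemma ip_act_right: "ip x (y \<odot> a) = ip x y * a"
proof (rule sums_unique2[OF ip_sums])
  show "(\<lambda>n. star (coord x n) * coord (y \<odot> a) n) sums (ip x y * a)"
    using sums_mult2[OF ip_sums[of x y], of a] by (simp add: coord_simps mult.assoc)
qed

lemma star_ip: "star (ip x y) = ip y x"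
proof -
  have "(\<lambda>n. star (star (coord x n) * coord y n)) sums star (ip x y)"
    using bounded_linear.sums[OF bounded_linear_star ip_sums] .
  then have "(\<lambda>n. star (coord y n) * coord x n) sums star (ip x y)"
    by (simp add: star_mult star_star)
  then show ?thesis by (rule sums_unique2) (rule ip_sums)
qed

lemma ip_add_left: "ip (x + y) z = ip x z + ip y z"
  by (metis ip_add_right star_add star_ip)

lemma ip_act_left: "ip (x \<odot> a) y = star a * ip x y"
  by (metis ip_act_right star_mult star_ip)

lemma act_one [simp]: "x \<odot> 1 = x"
  by (rule ell2_eqI) (simp add: coord_simps)

lemma act_act: "x \<odot> a \<odot> b = x \<odot> (a * b)"
  by (rule ell2_eqI) (simp add: coord_simps mult.assoc)

lemma act_add_left: "(x + y) \<odot> a = x \<odot> a + y \<odot> a"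
  by (rule ell2_eqI) (simp add: coord_simps algebra_simps)

lemma act_add_right: "x \<odot> (a + b) = x \<odot> a + x \<odot> b"
  by (rule ell2_eqI) (simp add: coord_simps algebra_simps)

lemma act_of_real: "x \<odot> of_real r = r *\<^sub>R x"
  by (rule ell2_eqI) (simp add: coord_simps of_real_def)

lemma act_scaleR_right: "x \<odot> (r *\<^sub>R a) = r *\<^sub>R (x \<odot> a)"
  by (rule ell2_eqI) (simp add: coord_simps)

lemma act_scaleR_left: "(r *\<^sub>R x) \<odot> a = r *\<^sub>R (x \<odot> a)"
  by (rule ell2_eqI) (simp add: coord_simps)

lemma ip_scaleR_right: "ip x (r *\<^sub>R y) = r *\<^sub>R ip x y"
  using ip_act_right[of x y "of_real r"] by (simp only: act_of_real) (simp add: of_real_def)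

lemma ip_scaleR_left: "ip (r *\<^sub>R x) y = r *\<^sub>R ip x y"
  using ip_act_left[of x "of_real r" y]
  by (simp only: act_of_real star_of_real) (simp add: of_real_def)

lemma norm_ip_le: "norm (ip x y) \<le> norm x * norm y"
proof (rule LIMSEQ_le[OF tendsto_norm[OF ip_sums[unfolded sums_def]]
      tendsto_mult[OF seminorm_on_tendsto_norm seminorm_on_tendsto_norm]])
  show "\<exists>N. \<forall>n\<ge>N. norm (\<Sum>i<n. star (coord x i) * coord y i) \<le>
      seminorm_on {..<n} (coord x) * seminorm_on {..<n} (coord y)"
    using norm_inner_sum_le by blast
qed

lemma bounded_bilinear_ip: "bounded_bilinear ip"
  by (rule bounded_bilinear.intro)
    (auto simp: ip_add_left ip_add_right ip_scaleR_left ip_scaleR_right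
      intro!: exI[of _ 1] norm_ip_le)

lemmas tendsto_ip [tendsto_intros] = bounded_bilinear.tendsto[OF bounded_bilinear_ip]
lemmas ip_diff_left = bounded_bilinear.diff_left[OF bounded_bilinear_ip]
lemmas ip_diff_right = bounded_bilinear.diff_right[OF bounded_bilinear_ip]
lemmas ip_zero_left [simp] = bounded_bilinear.zero_left[OF bounded_bilinear_ip]
lemmas ip_zero_right [simp] = bounded_bilinear.zero_right[OF bounded_bilinear_ip]

lemma positive_ip: "positive (ip x x)"
proof (rule positive_tendsto[OF ip_sums[unfolded sums_def]])
  show "positive (\<Sum>i<n. star (coord x i) * coord x i)" for n
    by (intro positive_sum positive_star_mult)
qed

lemma ip_self_zero_iff [simp]: "ip x x = 0 \<longleftrightarrow> x = 0"
proof
  assume "ip x x = 0"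
  then have "norm x = 0" by (simp add: norm_ell2_def)
  then show "x = 0" by simp
qed simp

lemma norm_act_le: "norm (x \<odot> a) \<le> norm x * norm a"
proof (rule power2_le_imp_le)
  have "(norm (x \<odot> a))\<^sup>2 \<le> norm (star a) * norm (ip x x) * norm a"
    unfolding norm_power2_ell2 ip_act_left ip_act_right mult.assoc[symmetric]
    by (intro order_trans[OF norm_mult_ineq] mult_right_mono norm_mult_ineq norm_ge_zero)
  then show "(norm (x \<odot> a))\<^sup>2 \<le> (norm x * norm a)\<^sup>2"
    by (simp add: power_mult_distrib flip: norm_power2_ell2)
      (simp add: power2_eq_square mult_ac)
qed simp

lemma bounded_bilinear_act: "bounded_bilinear act"
  by (rule bounded_bilinear.intro)
    (auto simp: act_add_left act_add_right act_scaleR_left act_scaleR_right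
      intro!: exI[of _ 1] norm_act_le)

lemmas tendsto_act [tendsto_intros] = bounded_bilinear.tendsto[OF bounded_bilinear_act]
lemmas act_diff_left = bounded_bilinear.diff_left[OF bounded_bilinear_act]
lemmas act_zero_left [simp] = bounded_bilinear.zero_left[OF bounded_bilinear_act]
lemmas act_zero_right [simp] = bounded_bilinear.zero_right[OF bounded_bilinear_act]

instance ell2 :: (unital_cstar_algebra) banach
proof
  fix X :: "nat \<Rightarrow> 'a ell2" assume X: "Cauchy X"
  have coord_diff: "coord (x - y) n = coord x n - coord y n" for x y :: "'a ell2" and n
    by (simp add: coord_simps)
  have "Cauchy (\<lambda>k. coord (X k) n)" for n
    unfolding Cauchy_altdef2 dist_norm coord_diff[symmetric]
  proof (intro allI impI)
    fix e :: real assume "0 < e"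
    then obtain N where "\<forall>k\<ge>N. norm (X k - X N) < e"
      using X unfolding Cauchy_altdef2 dist_norm by blast
    then show "\<exists>N. \<forall>k\<ge>N. norm (coord (X k - X N) n) < e"
      using norm_coord_le order_le_less_trans by blast
  qed
  then have "\<forall>n. \<exists>l. (\<lambda>k. coord (X k) n) \<longlonglongrightarrow> l"
    using Cauchy_convergent convergent_def by blast
  then obtain x where x: "\<And>n. (\<lambda>k. coord (X k) n) \<longlonglongrightarrow> x n" by metis
  \<comment> \<open>N must not depend on F. The Cauchy property supplies N first; then, with a
    finite F fixed, the bound for \<open>X l - X k\<close> survives the limit in l taken coordinate
    by coordinate.\<close>
  have close: "\<exists>N. \<forall>k\<ge>N. \<forall>F. finite F \<longrightarrow> seminorm_on F (\<lambda>n. x n - coord (X k) n) \<le> e"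
    if "0 < e" for e
  proof -
    obtain N where N: "\<forall>k\<ge>N. \<forall>l\<ge>N. norm (X l - X k) < e"
      using X \<open>0 < e\<close> unfolding Cauchy_iff by blast
    have "seminorm_on F (\<lambda>n. x n - coord (X k) n) \<le> e" if k: "k \<ge> N" and F: "finite F" for k F
    proof (rule LIMSEQ_le_const2)
      show "(\<lambda>l. seminorm_on F (\<lambda>n. coord (X l) n - coord (X k) n)) \<longlonglongrightarrow>
          seminorm_on F (\<lambda>n. x n - coord (X k) n)"
        unfolding seminorm_on_def by (intro tendsto_intros x)
      have "seminorm_on F (\<lambda>n. coord (X l) n - coord (X k) n) \<le> e" if "l \<ge> N" for l
        using seminorm_on_le_norm[OF F, of "X l - X k"] N k that
        by (force simp: coord_diff[abs_def])
      then show "\<exists>M. \<forall>l\<ge>M. seminorm_on F (\<lambda>n. coord (X l) n - coord (X k) n) \<le> e" by blast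
    qed
    then show ?thesis by blast
  qed
  have "summable (\<lambda>n. star (x n) * x n)"
  proof (rule square_summable_if_tail)
    fix e :: real assume e: "0 < e"
    obtain k where k: "\<forall>F. finite F \<longrightarrow> seminorm_on F (\<lambda>n. x n - coord (X k) n) \<le> e/2"
      using close[of "e/2"] e by auto
    obtain N where N: "\<forall>F. finite F \<longrightarrow> F \<inter> {..<N} = {} \<longrightarrow> seminorm_on F (coord (X k)) < e/2"
      using square_summable_tail[OF summable_coord half_gt_zero[OF e]] by metis
    have "seminorm_on F x < e" if F: "finite F" "F \<inter> {..<N} = {}" for F
    proof -
      have "seminorm_on F x \<le> seminorm_on F (\<lambda>n. x n - coord (X k) n) + seminorm_on F (coord (X k))"
        using seminorm_on_triangle[of F "\<lambda>n. x n - coord (X k) n" "coord (X k)"] by simp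
      moreover have "seminorm_on F (\<lambda>n. x n - coord (X k) n) \<le> e/2" using k F by blast
      moreover have "seminorm_on F (coord (X k)) < e/2" using N F by blast
      ultimately show ?thesis by linarith
    qed
    then show "\<exists>N. \<forall>F. finite F \<longrightarrow> F \<inter> {..<N} = {} \<longrightarrow> seminorm_on F x < e" by blast
  qed
  then have cx: "coord (Ell2 x) = x" by (simp add: Ell2_inverse)
  have "X \<longlonglongrightarrow> Ell2 x" unfolding lim_sequentially dist_norm
  proof (intro allI impI)
    fix e :: real assume "0 < e"
    then obtain N where N: "\<forall>k\<ge>N. \<forall>F. finite F \<longrightarrow> seminorm_on F (\<lambda>n. x n - coord (X k) n) \<le> e/2"
      using close[of "e/2"] by auto
    have "norm (X k - Ell2 x) < e" if "k \<ge> N" for k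
    proof -
      have "norm (Ell2 x - X k) \<le> e/2"
        by (rule LIMSEQ_le_const2[OF seminorm_on_tendsto_norm])
          (use N that in \<open>simp add: coord_diff[abs_def] cx\<close>)
      then show ?thesis using \<open>0 < e\<close> by (simp add: norm_minus_commute)
    qed
    then show "\<exists>N. \<forall>k\<ge>N. norm (X k - Ell2 x) < e" by blast
  qed
  then show "convergent X" by (rule convergentI)
qed

section \<open>Open mapping theorem between closed subspaces\<close>

text \<open>W may have empty interior in the whole space, so Baire's theorem is applied in its
  subspace topology and the ball is taken relative to W.\<close>

lemma Baire_ball_in_closure:
  fixes W :: "'b::banach set" and K :: "nat \<Rightarrow> 'b set"
  assumes "closed W" "W \<noteq> {}" "W \<subseteq> (\<Union>n. K n)" "\<And>n. K n \<subseteq> W"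
  obtains n y r where "y \<in> W" "0 < r" "ball y r \<inter> W \<subseteq> closure (K n)"
proof -
  let ?X = "top_of_set W"
  have KW: "closure (K n) \<subseteq> W" for n using assms(1,4) by (simp add: closure_minimal)
  have cmp: "completely_metrizable_space ?X"
    using completely_metrizable_space_closedin[OF completely_metrizable_space_euclidean] assms(1) by simp
  have un: "(\<Union>n. closure (K n)) = W"
  proof
    show "(\<Union>n. closure (K n)) \<subseteq> W" using KW by blast
    show "W \<subseteq> (\<Union>n. closure (K n))"
      by (rule order_trans[OF assms(3)]) (intro UN_mono closure_subset order_refl)
  qed
  have "\<exists>n. ?X interior_of (closure (K n)) \<noteq> {}"
  proof (rule ccontr)
    assume no: "\<not> ?thesis"
    have "?X interior_of \<Union>(range (\<lambda>n. closure (K n))) = {}"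
    proof (rule Baire_category_alt)
      fix T assume "T \<in> range (\<lambda>n. closure (K n))"
      then show "closedin ?X T \<and> ?X interior_of T = {}"
        using no closed_subset[OF KW closed_closure] by auto
    qed (use cmp in auto)
    then have "?X interior_of W = {}" by (simp add: un)
    then show False using assms(2) interior_of_topspace[of ?X] by simp
  qed
  then obtain n y where y: "y \<in> ?X interior_of (closure (K n))" by blast
  then obtain T where T: "openin ?X T" "y \<in> T" "T \<subseteq> closure (K n)"
    by (auto simp: interior_of_def)
  then obtain r where "0 < r" "ball y r \<inter> W \<subseteq> T" "y \<in> W"
    by (metis openin_contains_ball openin_subset subsetD topspace_euclidean_subtopology)
  then show ?thesis using that T(3) by blast
qed

text \<open>Preimages of controlled norm are a form of openness that also serves maps with a kernel,
  such as T in \<open>closed_range_orthogonal_projection\<close>.\<close>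

theorem open_mapping_subspaces:
  fixes f :: "'a::banach \<Rightarrow> 'b::banach"
  assumes f: "bounded_linear f" and V: "subspace V" "closed V" and W: "subspace W" "closed W"
    and fV: "f ` V = W"
  obtains C where "0 < C" "\<And>y. y \<in> W \<Longrightarrow> \<exists>x\<in>V. f x = y \<and> norm x \<le> C * norm y"
proof -
  interpret f: bounded_linear f by (rule f)
  have sub: "W \<subseteq> (\<Union>n::nat. f ` (V \<inter> cball 0 (real n)))"
  proof
    fix y assume "y \<in> W"
    then obtain x where x: "x \<in> V" "f x = y" using fV by blast
    obtain n where "norm x \<le> real n" using real_arch_simple by blast
    then show "y \<in> (\<Union>n::nat. f ` (V \<inter> cball 0 (real n)))" using x by force
  qed
  obtain n :: nat and y0 r where y0: "y0 \<in> W" "0 < r"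
    and ball: "ball y0 r \<inter> W \<subseteq> closure (f ` (V \<inter> cball 0 (real n)))"
  proof (rule Baire_ball_in_closure[OF W(2) _ sub])
    show "W \<noteq> {}" using subspace_0[OF W(1)] by blast
    show "f ` (V \<inter> cball 0 (real n)) \<subseteq> W" for n using fV by blast
  qed
  \<comment> \<open>Subtracting approximate preimages of y0 + y and of y0 moves the ball from y0 to
    0 and doubles the norm bound n.\<close>
  have approx: "\<exists>x\<in>V. norm x \<le> 2 * real n \<and> norm (y - f x) < e"
    if y: "y \<in> W" "norm y < r" and e: "0 < e" for y e
  proof -
    have "y0 + y \<in> closure (f ` (V \<inter> cball 0 (real n)))"
      using ball y0 y subspace_add[OF W(1)] by (auto simp: dist_norm)
    then have "\<exists>c\<in>f ` (V \<inter> cball 0 (real n)). dist c (y0 + y) < e/2"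
      using half_gt_zero[OF e] unfolding closure_approachable by blast
    then obtain a where a: "a \<in> V" "norm a \<le> real n" "norm (f a - (y0 + y)) < e/2"
      by (auto simp: dist_norm)
    have "y0 \<in> closure (f ` (V \<inter> cball 0 (real n)))" using ball y0 by auto
    then have "\<exists>c\<in>f ` (V \<inter> cball 0 (real n)). dist c y0 < e/2"
      using half_gt_zero[OF e] unfolding closure_approachable by blast
    then obtain b where b: "b \<in> V" "norm b \<le> real n" "norm (f b - y0) < e/2"
      by (auto simp: dist_norm)
    have eq: "y - f (a - b) = (f b - y0) - (f a - (y0 + y))" by (simp add: f.diff)
    have "norm (y - f (a - b)) < e"
      unfolding eq using norm_triangle_ineq4[of "f b - y0" "f a - (y0 + y)"] a(3) b(3) by linarith
    moreover have "norm (a - b) \<le> 2 * real n"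
      using norm_triangle_ineq4[of a b] a(2) b(2) by simp
    ultimately show ?thesis using a b subspace_diff[OF V(1)] by blast
  qed
  \<comment> \<open>Scaling y to norm r/2 and back costs the factor 2 \<open>norm y\<close> / r,
    which turns the bound 2 n into 4 n / r times \<open>norm y\<close>; the added 1 keeps M positive
    for n = 0.\<close>
  define M where "M = (4 * real n + 1) / r"
  have M: "0 < M" using y0 by (simp add: M_def)
  have "\<exists>x\<in>V. norm x \<le> M * norm y \<and> norm (y - f x) \<le> norm y / 2" if y: "y \<in> W" for y
  proof (cases "y = 0")
    case True
    then show ?thesis using subspace_0[OF V(1)] by (intro bexI[of _ 0]) simp_all
  next
    case False
    define s where "s = r / (2 * norm y)"
    have s: "0 < s" "s * norm y = r/2" using False y0 by (simp_all add: s_def)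
    obtain x where x: "x \<in> V" "norm x \<le> 2 * real n" "norm (s *\<^sub>R y - f x) < s * norm y / 2"
      using approx[of "s *\<^sub>R y" "s * norm y / 2"] y s y0 False subspace_scale[OF W(1)] by auto
    have "norm ((1/s) *\<^sub>R x) \<le> M * norm y"
    proof -
      have "norm x * (2 * norm y) = 2 * (norm x * norm y)" by simp
      also have "\<dots> \<le> 2 * (2 * real n * norm y)"
        using mult_right_mono[OF x(2) norm_ge_zero[of y]] by linarith
      also have "\<dots> \<le> (4 * real n + 1) * norm y" by (simp add: distrib_right)
      finally have "norm x * (2 * norm y) \<le> (4 * real n + 1) * norm y" .
      then show ?thesis using y0 False by (simp add: s_def M_def divide_right_mono)
    qed
    moreover have eq: "y - f ((1/s) *\<^sub>R x) = (1/s) *\<^sub>R (s *\<^sub>R y - f x)"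
      using s(1) by (simp add: f.scaleR algebra_simps)
    have "norm (y - f ((1/s) *\<^sub>R x)) \<le> norm y / 2"
      unfolding eq norm_scaleR using x(3) s(1) by (simp add: field_simps)
    ultimately show ?thesis using x(1) subspace_scale[OF V(1)] by blast
  qed
  then obtain g where g: "\<And>y. y \<in> W \<Longrightarrow> g y \<in> V" "\<And>y. y \<in> W \<Longrightarrow> norm (g y) \<le> M * norm y"
    "\<And>y. y \<in> W \<Longrightarrow> norm (y - f (g y)) \<le> norm y / 2" by metis
  show ?thesis
  proof (rule that[of "2 * M"])
    show "0 < 2 * M" using M by simp
    fix y assume y: "y \<in> W"
    \<comment> \<open>R k is the remainder after k corrections. It halves each time, so the
      corrections sum up to norm at most 2 M \<open>norm y\<close>.\<close>
    define R where "R k = ((\<lambda>z. z - f (g z)) ^^ k) y" for k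
    have R: "R k \<in> W \<and> norm (R k) \<le> norm y * (1/2)^k" for k
    proof (induction k)
      case 0 show ?case by (simp add: R_def y)
    next
      case (Suc k)
      have eq: "R (Suc k) = R k - f (g (R k))" by (simp add: R_def)
      have "f (g (R k)) \<in> W" using Suc g(1) fV by blast
      then show ?case unfolding eq using Suc subspace_diff[OF W(1)] g(3)[of "R k"] by auto
    qed
    have bd: "norm (g (R k)) \<le> M * norm y * (1/2)^k" for k
    proof -
      have "norm (g (R k)) \<le> M * norm (R k)" using g(2) R by blast
      also have "\<dots> \<le> M * (norm y * (1/2)^k)" by (rule mult_left_mono) (use R M in auto)
      finally show ?thesis by (simp only: mult.assoc)
    qed
    have geo: "summable (\<lambda>k. M * norm y * (1/2::real)^k)"
      by (intro summable_mult summable_geometric) simp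
    have sn: "summable (\<lambda>k. norm (g (R k)))"
      by (rule summable_comparison_test[OF _ geo]) (use bd in auto)
    define x where "x = (\<Sum>k. g (R k))"
    have "norm x \<le> (\<Sum>k. norm (g (R k)))" unfolding x_def by (rule summable_norm[OF sn])
    also have "\<dots> \<le> (\<Sum>k. M * norm y * (1/2::real)^k)" by (rule suminf_le[OF bd sn geo])
    also have "\<dots> = M * norm y * 2"
      by (subst suminf_mult) (simp_all add: suminf_geometric summable_geometric)
    finally have nx: "norm x \<le> 2 * M * norm y" by simp
    have lim: "(\<lambda>n. \<Sum>k<n. g (R k)) \<longlonglongrightarrow> x"
      unfolding x_def by (rule summable_LIMSEQ[OF summable_norm_cancel[OF sn]])
    have xV: "x \<in> V"
      by (rule closed_sequentially[OF V(2) _ lim]) (use R g(1) in \<open>intro subspace_sum[OF V(1)]; blast\<close>)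
    have part: "f (\<Sum>k<n. g (R k)) = y - R n" for n
      by (induction n) (simp_all add: R_def f.add f.zero)
    have "(\<lambda>n. norm y * (1/2::real)^n) \<longlonglongrightarrow> norm y * 0"
      by (intro tendsto_intros LIMSEQ_realpow_zero) auto
    then have "R \<longlonglongrightarrow> 0"
      by (intro Lim_null_comparison[of R "\<lambda>n. norm y * (1/2)^n"]) (use R in auto)
    then have "(\<lambda>n. y - R n) \<longlonglongrightarrow> y - 0" by (intro tendsto_intros)
    then have "(\<lambda>n. f (\<Sum>k<n. g (R k))) \<longlonglongrightarrow> y" by (simp add: part)
    then have "f x = y" using f.tendsto[OF lim] LIMSEQ_unique by blast
    then show "\<exists>x\<in>V. f x = y \<and> norm x \<le> 2 * M * norm y" using xV nx by blast
  qed
qed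

section \<open>Module maps and closed ranges\<close>

text \<open>All maps live on the whole space: a map on a submodule enters through its composite with
  a map into that submodule, usually a projection, so no partial operators occur.\<close>

definition alin :: "('a::unital_cstar_algebra ell2 \<Rightarrow> 'a ell2) \<Rightarrow> bool" where
  "alin f \<longleftrightarrow> bounded_linear f \<and> (\<forall>x a. f (x \<odot> a) = f x \<odot> a)"

definition smod :: "'a::unital_cstar_algebra ell2 set \<Rightarrow> bool" where
  "smod M \<longleftrightarrow> 0 \<in> M \<and> (\<forall>x\<in>M. \<forall>y\<in>M. x + y \<in> M) \<and> (\<forall>x\<in>M. \<forall>a. x \<odot> a \<in> M) \<and> closed M"

definition adj :: "('a::unital_cstar_algebra ell2 \<Rightarrow> 'a ell2) \<Rightarrow> ('a ell2 \<Rightarrow> 'a ell2) \<Rightarrow> bool" where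
  "adj T S \<longleftrightarrow> alin T \<and> alin S \<and> (\<forall>x y. ip (T x) y = ip x (S y))"

lemma alin_bounded_linear: "alin f \<Longrightarrow> bounded_linear f"
  by (simp add: alin_def)

lemma alin_act: "alin f \<Longrightarrow> f (x \<odot> a) = f x \<odot> a"
  by (simp add: alin_def)

lemma alin_add: "alin f \<Longrightarrow> f (x + y) = f x + f y"
  and alin_diff: "alin f \<Longrightarrow> f (x - y) = f x - f y"
  and alin_zero: "alin f \<Longrightarrow> f 0 = 0"
  by (simp_all add: alin_def linear_simps)

lemma alin_bound:
  assumes "alin f"
  obtains K where "0 < K" "\<And>x. norm (f x) \<le> norm x * K"
  using bounded_linear.pos_bounded[OF alin_bounded_linear[OF assms]] by blast

lemma alin_tendsto: "alin f \<Longrightarrow> (X \<longlongrightarrow> l) F \<Longrightarrow> ((\<lambda>x. f (X x)) \<longlongrightarrow> f l) F"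
  using bounded_linear.tendsto[OF alin_bounded_linear] by blast

lemma alin_id: "alin (\<lambda>x. x)"
  by (simp add: alin_def bounded_linear_ident)

lemma alin_compose: "alin f \<Longrightarrow> alin g \<Longrightarrow> alin (\<lambda>x. f (g x))"
  by (simp add: alin_def bounded_linear_compose)

lemma alin_plus: "alin f \<Longrightarrow> alin g \<Longrightarrow> alin (\<lambda>x. f x + g x)"
  by (simp add: alin_def bounded_linear_add act_add_left)

lemma alin_minus: "alin f \<Longrightarrow> alin g \<Longrightarrow> alin (\<lambda>x. f x - g x)"
  by (simp add: alin_def bounded_linear_sub act_diff_left)

lemma alin_const_zero: "alin (\<lambda>x. 0)"
  by (simp add: alin_def)

lemma smod_subspace: "smod M \<Longrightarrow> subspace M"
  unfolding smod_def subspace_def by (metis act_of_real)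

lemma smod_closed: "smod M \<Longrightarrow> closed M"
  and smod_zero: "smod M \<Longrightarrow> 0 \<in> M"
  and smod_add: "smod M \<Longrightarrow> x \<in> M \<Longrightarrow> y \<in> M \<Longrightarrow> x + y \<in> M"
  and smod_act: "smod M \<Longrightarrow> x \<in> M \<Longrightarrow> x \<odot> a \<in> M"
  by (simp_all add: smod_def)

lemma smod_diff: "smod M \<Longrightarrow> x \<in> M \<Longrightarrow> y \<in> M \<Longrightarrow> x - y \<in> M"
  by (simp add: smod_subspace subspace_diff)

lemma smod_UNIV: "smod UNIV"
  by (simp add: smod_def)

lemma smod_range:
  assumes T: "alin T" and cl: "closed (range T)"
  shows "smod (range T)"
  unfolding smod_def
proof (intro conjI ballI allI cl)
  show "0 \<in> range T" using alin_zero[OF T] by (metis rangeI)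
  show "x + y \<in> range T" if "x \<in> range T" "y \<in> range T" for x y
    using that alin_add[OF T, symmetric] by auto
  show "x \<odot> a \<in> range T" if "x \<in> range T" for x a
    using that alin_act[OF T, symmetric] by auto
qed

lemma ell2_eq_if_ip_eq: "(\<And>z. ip z x = ip z y) \<Longrightarrow> x = y"
  using ip_self_zero_iff[of "x - y"] ip_diff_right[of "x - y" x y] by simp

text \<open>Taking x = S y bounds S by the bound of T; additivity and module linearity follow
  because inner products separate points.\<close>

lemma adj_if_ip_eq:
  assumes T: "alin T" and S: "\<And>x y. ip (T x) y = ip x (S y)"
  shows "adj T S"
proof -
  obtain K where K: "0 < K" "\<And>x. norm (T x) \<le> norm x * K" using alin_bound[OF T] by blast
  have "norm (S y) \<le> norm y * K" for y
  proof -
    have "norm (S y) * norm (S y) = norm (ip (T (S y)) y)"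
      by (simp add: S flip: norm_power2_ell2 power2_eq_square)
    also have "\<dots> \<le> (norm (S y) * K) * norm y"
      by (rule order_trans[OF norm_ip_le]) (intro mult_right_mono K norm_ge_zero)
    finally have "norm (S y) * norm (S y) \<le> norm (S y) * (norm y * K)" by (simp add: mult_ac)
    then show ?thesis using K(1) by (cases "S y = 0") (auto simp: mult_le_cancel_left)
  qed
  then have "bounded_linear S"
    by (intro bounded_linear_intro[where K=K])
      (auto intro!: ell2_eq_if_ip_eq simp: S[symmetric] ip_add_right ip_scaleR_right)
  moreover have "S (y \<odot> a) = S y \<odot> a" for y a
    by (rule ell2_eq_if_ip_eq) (simp add: S[symmetric] ip_act_right)
  ultimately show ?thesis using T S by (simp add: adj_def alin_def)
qed

lemma adj_sym: "adj T S \<Longrightarrow> adj S T"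
  unfolding adj_def by (metis star_ip)

text \<open>
  Paschke's trick: the norm inequality is applied to \<open>x b\<close>, where \<open>b\<close> is the inverse of the square
  root of \<open>\<langle>v x, v x\<rangle> + e\<close>.
\<close>

lemma ip_le_if_norm_le:
  assumes le: "\<And>x. x \<in> V \<Longrightarrow> norm (u x) \<le> C * norm (v x)"
    and V: "\<And>x a. x \<in> V \<Longrightarrow> x \<odot> a \<in> V"
    and u: "\<And>x a. u (x \<odot> a) = u x \<odot> a" and v: "\<And>x a. v (x \<odot> a) = v x \<odot> a"
    and C: "0 \<le> C" and x: "x \<in> V"
  shows "positive (C\<^sup>2 *\<^sub>R ip (v x) (v x) - ip (u x) (u x))"
proof -
  define A where "A = ip (v x) (v x)"
  define B where "B = ip (u x) (u x)"
  have pA: "positive A" and pB: "positive B" by (simp_all add: A_def B_def positive_ip)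
  have step: "positive (C\<^sup>2 *\<^sub>R (A + of_real e) - B)" if e: "0 < e" for e
  proof -
    define c where "c = A + of_real e"
    have pc: "positive c" unfolding c_def
      by (rule positive_add[OF pA positive_of_real]) (use e in simp)
    obtain s where s: "star s = s" "s * s = c" "\<And>y. y * c = c * y \<Longrightarrow> y * s = s * y"
      using positive_sqrt[OF pc] by metis
    obtain r where r: "positive r" "r * c = 1" "c * r = 1" "\<And>y. y * A = A * y \<Longrightarrow> y * r = r * y"
      using positive_inverse[OF pA e] unfolding c_def by metis
    define b where "b = s * r"
    have sr: "s * r = r * s"
    proof -
      have "s * c = c * s" by (metis s(2) mult.assoc)
      then show ?thesis by (metis r(2,3) mult.assoc mult_1 mult_1_right)
    qed
    have bs: "b * s = 1" unfolding b_def by (metis sr s(2) r(2) mult.assoc)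
    have sb: "s * b = 1" unfolding b_def by (metis s(2) r(3) mult.assoc)
    have stb: "star b = b" by (simp add: b_def star_mult s(1) positive_selfadjoint[OF r(1)] sr)
    have bcb: "b * c * b = 1" by (metis bs sb s(2) mult.assoc mult_1_right)
    have "norm (b * A * b) \<le> norm (1 :: 'a)"
    proof (rule positive_norm_mono)
      show "positive (b * A * b)" using positive_conj[OF pA, of b] by (simp add: stb)
      have "1 - b * A * b = b * of_real e * b"
        using bcb by (simp add: c_def algebra_simps)
      then show "positive (1 - b * A * b)"
        using positive_conj[OF positive_of_real, of e b] e by (simp add: stb)
    qed
    then have "(norm (v (x \<odot> b)))\<^sup>2 \<le> 1"
      by (simp add: norm_power2_ell2 v ip_act_left ip_act_right A_def stb mult.assoc)
    then have "norm (v (x \<odot> b)) \<le> 1" by (simp add: abs_square_le_1)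
    then have "norm (u (x \<odot> b)) \<le> C"
      using le[OF V[OF x], of b] mult_left_mono[OF _ C] by fastforce
    then have "(norm (u (x \<odot> b)))\<^sup>2 \<le> C\<^sup>2" by (simp add: power_mono)
    then have "norm (b * B * b) \<le> C\<^sup>2"
      by (simp add: norm_power2_ell2 u ip_act_left ip_act_right B_def stb mult.assoc)
    then have "positive (of_real (C\<^sup>2) - b * B * b)"
      by (rule positive_of_real_diff[rotated])
        (simp add: star_mult stb positive_selfadjoint[OF pB] mult.assoc)
    from positive_conj[OF this, of s]
    have "positive (C\<^sup>2 *\<^sub>R (s * s) - (s * b) * B * (b * s))"
      by (simp add: s(1) algebra_simps of_real_def)
    then show ?thesis by (simp add: s(2) sb bs c_def)
  qed
  have "positive (C\<^sup>2 *\<^sub>R A - B)"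
  proof (rule positive_tendsto)
    have "(\<lambda>n. C\<^sup>2 *\<^sub>R (A + of_real (inverse (real (Suc n)))) - B) \<longlonglongrightarrow> C\<^sup>2 *\<^sub>R (A + of_real 0) - B"
      by (intro tendsto_intros LIMSEQ_inverse_real_of_nat)
    then show "(\<lambda>n. C\<^sup>2 *\<^sub>R (A + of_real (inverse (real (Suc n)))) - B) \<longlonglongrightarrow> C\<^sup>2 *\<^sub>R A - B" by simp
  qed (rule step, simp)
  then show ?thesis by (simp add: A_def B_def)
qed

text \<open>
  On a closed range \<open>I\<close> of \<open>T\<close> the operator \<open>T S\<close> is bounded below, hence \<open>1 - T S / t\<close> is a
  contraction of \<open>I\<close> for large \<open>t\<close> and \<open>T S\<close> maps \<open>I\<close> onto \<open>I\<close>.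
\<close>

lemma closed_range_orthogonal_projection:
  assumes TS: "adj T S" and cl: "closed (range T)"
  shows "\<exists>y\<in>range T. \<forall>w\<in>range T. ip (z - y) w = 0"
proof -
  have T: "alin T" and S: "alin S" and ad: "\<And>x y. ip (T x) y = ip x (S y)"
    using TS by (auto simp: adj_def)
  have ad': "ip x (T y) = ip (S x) y" for x y by (metis ad star_ip)
  define I where "I = range T"
  have I: "smod I" unfolding I_def by (rule smod_range[OF T cl])
  obtain C0 where C0: "0 < C0" "\<And>y. y \<in> I \<Longrightarrow> \<exists>x\<in>UNIV. T x = y \<and> norm x \<le> C0 * norm y"
    using open_mapping_subspaces[OF alin_bounded_linear[OF T] subspace_UNIV closed_UNIV
        smod_subspace[OF I] smod_closed[OF I]] by (auto simp: I_def)
  \<comment> \<open>Constants that are at least 1 make K^2 C^2 at least 1, so that q below is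
    nonnegative.\<close>
  define C where "C = max C0 1"
  have C: "1 \<le> C" "\<And>y. y \<in> I \<Longrightarrow> \<exists>x. T x = y \<and> norm x \<le> C * norm y"
    using C0 unfolding C_def by (auto, meson max.cobounded1 mult_right_mono norm_ge_zero order_trans)
  obtain K0 where K0: "0 < K0" "\<And>x. norm (T x) \<le> norm x * K0" using alin_bound[OF T] by blast
  define K where "K = max K0 1"
  have K: "1 \<le> K" "norm (T x) \<le> K * norm x" for x
    using order_trans[OF K0(2)[of x] mult_left_mono[of K0 K "norm x"]] by (simp_all add: K_def mult.commute)
  have lower: "positive (C\<^sup>2 *\<^sub>R ip (S y) (S y) - ip y y)" if "y \<in> I" for y
  proof (rule ip_le_if_norm_le[where V=I and u="\<lambda>x. x" and v=S, OF _ _ _ _ _ that])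
    fix y assume "y \<in> I"
    then obtain x where x: "T x = y" "norm x \<le> C * norm y" using C(2) by blast
    have "norm y * norm y = norm (ip x (S y))"
      using norm_power2_ell2[of y] ad[of x y] by (simp add: x power2_eq_square)
    also have "\<dots> \<le> (C * norm y) * norm (S y)"
      by (rule order_trans[OF norm_ip_le]) (intro mult_right_mono x norm_ge_zero)
    finally have "norm y * norm y \<le> norm y * (C * norm (S y))" by (simp add: mult_ac)
    then show "norm y \<le> C * norm (S y)"
      using C(1) by (cases "y = 0") (auto simp: mult_le_cancel_left)
  qed (use C(1) alin_act[OF S] smod_act[OF I] in auto)
  have upper: "positive (K\<^sup>2 *\<^sub>R ip (S y) (S y) - ip (T (S y)) (T (S y)))" for y
    by (rule ip_le_if_norm_le[where V=UNIV])
      (use K alin_act[OF S] alin_act[OF T] in auto)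
  \<comment> \<open>With A and B the inner squares of S y and T (S y), that of g y is
    \<open>ip y y\<close> - 2 A / K^2 + B / K^4. The bounds B <= K^2 A and \<open>ip y y\<close> <=
    C^2 A leave at most q times \<open>ip y y\<close>, which makes g a contraction of I with factor
    sqrt q.\<close>
  define g where "g y = y - (1/K\<^sup>2) *\<^sub>R T (S y)" for y
  define q where "q = 1 - 1/(K\<^sup>2 * C\<^sup>2)"
  have "1 * 1 \<le> K\<^sup>2 * C\<^sup>2" by (intro mult_mono one_le_power K(1) C(1)) simp_all
  then have q: "0 \<le> q" "q < 1" by (auto simp: q_def)
  have K0: "K \<noteq> 0" and C0: "C \<noteq> 0" using K(1) C(1) by auto
  have contr: "norm (g y) \<le> sqrt q * norm y" if y: "y \<in> I" for y
  proof (rule power2_le_imp_le)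
    define A where "A = ip (S y) (S y)"
    define B where "B = ip (T (S y)) (T (S y))"
    have gg: "ip (g y) (g y) = ip y y - (1/K\<^sup>2) *\<^sub>R A - (1/K\<^sup>2) *\<^sub>R A + (1/K\<^sup>2)\<^sup>2 *\<^sub>R B"
    proof -
      have "ip y (T (S y)) = A" "ip (T (S y)) y = A" by (simp_all add: A_def ad' ad)
      then show ?thesis
        by (simp add: g_def ip_diff_left ip_diff_right ip_scaleR_left ip_scaleR_right B_def
            power2_eq_square scaleR_diff_right)
    qed
    have "1 / (K\<^sup>2 * C\<^sup>2) * C\<^sup>2 = 1/K\<^sup>2" "(1/K\<^sup>2)\<^sup>2 * K\<^sup>2 = 1/K\<^sup>2"
      using K0 C0 by (simp_all add: power2_eq_square)
    then have "q *\<^sub>R ip y y - ip (g y) (g y) =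
        (1/(K\<^sup>2 * C\<^sup>2)) *\<^sub>R (C\<^sup>2 *\<^sub>R A - ip y y) + (1/K\<^sup>2)\<^sup>2 *\<^sub>R (K\<^sup>2 *\<^sub>R A - B)"
      by (simp only: gg q_def scaleR_diff_right scaleR_diff_left scaleR_scaleR scaleR_one)
        (simp add: algebra_simps)
    moreover have "positive \<dots>"
      using lower[OF y] upper[of y] by (auto intro!: positive_add positive_scaleR simp: A_def B_def)
    ultimately have "norm (ip (g y) (g y)) \<le> norm (q *\<^sub>R ip y y)"
      using positive_norm_mono[OF positive_ip] by metis
    then show "(norm (g y))\<^sup>2 \<le> (sqrt q * norm y)\<^sup>2"
      using q by (simp add: power_mult_distrib norm_power2_ell2)
  qed (use q in simp)
  have TSI: "T x \<in> I" for x by (simp add: I_def)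
  have scI: "r *\<^sub>R y \<in> I" if "y \<in> I" for r y using smod_act[OF I that, of "of_real r"] by (simp add: act_of_real)
  \<comment> \<open>A fixed point y satisfies T (S y) = T (S z). This puts z - y into the kernel of
    S, which is the orthogonal complement of I.\<close>
  define w where "w = T (S z)"
  have "\<exists>!y\<in>I. g y + (1/K\<^sup>2) *\<^sub>R w = y"
  proof (rule Banach_fix[where c="sqrt q"])
    show "complete I" using smod_closed[OF I] by (simp add: complete_eq_closed)
    show "I \<noteq> {}" using smod_zero[OF I] by blast
    show "(\<lambda>y. g y + (1/K\<^sup>2) *\<^sub>R w) ` I \<subseteq> I"
      by (auto simp: g_def w_def intro!: smod_add[OF I] smod_diff[OF I] scI TSI)
    fix x y assume "x \<in> I" "y \<in> I"
    moreover have "g x - g y = g (x - y)"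
      by (simp add: g_def alin_diff[OF S] alin_diff[OF T] algebra_simps)
    ultimately show "dist (g x + (1/K\<^sup>2) *\<^sub>R w) (g y + (1/K\<^sup>2) *\<^sub>R w) \<le> sqrt q * dist x y"
      using contr[OF smod_diff[OF I]] by (simp add: dist_norm)
  qed (use q in \<open>simp_all add: real_less_lsqrt\<close>)
  then obtain y where y: "y \<in> I" "g y + (1/K\<^sup>2) *\<^sub>R w = y" by blast
  then have "(1/K\<^sup>2) *\<^sub>R (T (S z) - T (S y)) = 0" by (simp add: g_def w_def algebra_simps)
  then have "T (S (z - y)) = 0" using K(1) by (auto simp: alin_diff[OF S] alin_diff[OF T])
  then have "ip (S (z - y)) (S (z - y)) = 0" using ad'[of "z - y" "S (z - y)"] by simp
  then have "S (z - y) = 0" by simp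
  then have "ip (z - y) (T x) = 0" for x by (simp add: ad')
  then show ?thesis using y(1) by (auto simp: I_def)
qed

section \<open>The C*-algebra of adjointable operators\<close>

text \<open>The adjointable operators become an instance of the class assumed of the coefficients,
  so that roots, inverses and order estimates apply to operators unchanged.\<close>

typedef (overloaded) 'a aop =
  "{T :: 'a::unital_cstar_algebra ell2 \<Rightarrow>\<^sub>L 'a ell2. \<exists>S. adj (blinfun_apply T) (blinfun_apply S)}"
  morphisms aop_blinfun Aop
proof -
  have "adj (blinfun_apply 0) (blinfun_apply (0 :: 'a ell2 \<Rightarrow>\<^sub>L 'a ell2))"
    by (simp add: adj_def alin_def blinfun.bounded_linear_right)
  then show ?thesis by blast
qed

setup_lifting type_definition_aop

definition app :: "'a::unital_cstar_algebra aop \<Rightarrow> 'a ell2 \<Rightarrow> 'a ell2" where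
  "app X = blinfun_apply (aop_blinfun X)"

lemma app_exists:
  assumes "adj T S"
  obtains X where "app X = T"
proof -
  have T: "blinfun_apply (Blinfun T) = T" and S: "blinfun_apply (Blinfun S) = S"
    using assms by (simp_all add: adj_def alin_def bounded_linear_Blinfun_apply)
  then have "Blinfun T \<in> {T. \<exists>S. adj (blinfun_apply T) (blinfun_apply S)}"
    using assms by (auto intro!: exI[of _ "Blinfun S"])
  then show ?thesis using that[of "Aop (Blinfun T)"] by (simp add: app_def Aop_inverse T)
qed

lemma alin_app: "alin (app X)"
  using aop_blinfun[of X] by (auto simp: adj_def app_def)

lemma aop_eqI: "(\<And>x. app X x = app Y x) \<Longrightarrow> X = Y"
  by (simp add: app_def aop_blinfun_inject[symmetric] blinfun_eqI)

instantiation aop :: (unital_cstar_algebra) real_normed_algebra_1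
begin

lift_definition zero_aop :: "'a aop" is 0
  by (rule exI[of _ 0]) (simp add: adj_def alin_def blinfun.bounded_linear_right)

lift_definition one_aop :: "'a aop" is id_blinfun
  by (rule exI[of _ id_blinfun]) (simp add: adj_def alin_def blinfun.bounded_linear_right)

lift_definition plus_aop :: "'a aop \<Rightarrow> 'a aop \<Rightarrow> 'a aop" is "(+)"
proof -
  fix T T' :: "'a ell2 \<Rightarrow>\<^sub>L 'a ell2"
  assume "\<exists>S. adj (blinfun_apply T) (blinfun_apply S)" "\<exists>S. adj (blinfun_apply T') (blinfun_apply S)"
  then obtain S S' where "adj (blinfun_apply T) (blinfun_apply S)" "adj (blinfun_apply T') (blinfun_apply S')"
    by blast
  then have "adj (blinfun_apply (T + T')) (blinfun_apply (S + S'))"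
    by (simp add: adj_def alin_def blinfun.bilinear_simps ip_add_left ip_add_right act_add_left
        blinfun.bounded_linear_right)
  then show "\<exists>S. adj (blinfun_apply (T + T')) (blinfun_apply S)" by blast
qed

lift_definition scaleR_aop :: "real \<Rightarrow> 'a aop \<Rightarrow> 'a aop" is "scaleR"
proof -
  fix r and T :: "'a ell2 \<Rightarrow>\<^sub>L 'a ell2"
  assume "\<exists>S. adj (blinfun_apply T) (blinfun_apply S)"
  then obtain S where "adj (blinfun_apply T) (blinfun_apply S)" by blast
  then have "adj (blinfun_apply (r *\<^sub>R T)) (blinfun_apply (r *\<^sub>R S))"
    by (simp add: adj_def alin_def blinfun.bilinear_simps ip_scaleR_left ip_scaleR_right
        act_scaleR_left blinfun.bounded_linear_right)
  then show "\<exists>S. adj (blinfun_apply (r *\<^sub>R T)) (blinfun_apply S)" by blast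
qed

lift_definition times_aop :: "'a aop \<Rightarrow> 'a aop \<Rightarrow> 'a aop" is "(o\<^sub>L)"
proof -
  fix T T' :: "'a ell2 \<Rightarrow>\<^sub>L 'a ell2"
  assume "\<exists>S. adj (blinfun_apply T) (blinfun_apply S)" "\<exists>S. adj (blinfun_apply T') (blinfun_apply S)"
  then obtain S S' where "adj (blinfun_apply T) (blinfun_apply S)" "adj (blinfun_apply T') (blinfun_apply S')"
    by blast
  then have "adj (blinfun_apply (T o\<^sub>L T')) (blinfun_apply (S' o\<^sub>L S))"
    by (simp add: adj_def alin_def blinfun.bounded_linear_right)
  then show "\<exists>S. adj (blinfun_apply (T o\<^sub>L T')) (blinfun_apply S)" by blast
qed

definition uminus_aop :: "'a aop \<Rightarrow> 'a aop" where "uminus_aop X = (-1) *\<^sub>R X"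
definition minus_aop :: "'a aop \<Rightarrow> 'a aop \<Rightarrow> 'a aop" where "minus_aop X Y = X + (-1) *\<^sub>R Y"
definition norm_aop :: "'a aop \<Rightarrow> real" where "norm_aop X = norm (aop_blinfun X)"
definition dist_aop :: "'a aop \<Rightarrow> 'a aop \<Rightarrow> real" where "dist_aop X Y = norm (X - Y)"
definition sgn_aop :: "'a aop \<Rightarrow> 'a aop" where "sgn_aop X = scaleR (inverse (norm X)) X"
definition [code del]: "(uniformity :: ('a aop \<times> 'a aop) filter) =
  (INF e\<in>{0 <..}. principal {(x, y). dist x y < e})"
definition open_aop :: "'a aop set \<Rightarrow> bool" where
  [code del]: "open_aop S = (\<forall>x\<in>S. \<forall>\<^sub>F (x', y) in uniformity. x' = x \<longrightarrow> y \<in> S)"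

lemma app_plus: "app (X + Y) x = app X x + app (Y :: 'a aop) x"
  and app_zero: "app (0 :: 'a aop) x = 0"
  and app_one: "app (1 :: 'a aop) x = x"
  and app_scaleR: "app (r *\<^sub>R X) x = r *\<^sub>R app (X :: 'a aop) x"
  and app_times: "app (X * Y) x = app X (app (Y :: 'a aop) x)"
  and app_uminus: "app (- X) x = - app (X :: 'a aop) x"
  and app_minus: "app (X - Y) x = app X x - app (Y :: 'a aop) x"
  by (simp_all add: app_def plus_aop.rep_eq zero_aop.rep_eq one_aop.rep_eq scaleR_aop.rep_eq
      times_aop.rep_eq uminus_aop_def minus_aop_def blinfun.bilinear_simps)

lemma norm_app_le: "norm (app X x) \<le> norm (X :: 'a aop) * norm x"
  by (simp add: app_def norm_aop_def norm_blinfun)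

lemma norm_aop_le:
  assumes "0 \<le> b" "\<And>x. norm (app X x) \<le> b * norm x"
  shows "norm (X :: 'a aop) \<le> b"
  unfolding norm_aop_def by (rule norm_blinfun_bound[OF assms[unfolded app_def]])

lemma norm_aop_mult_le: "norm (X * Y) \<le> norm X * norm (Y :: 'a aop)"
  by (simp add: norm_aop_def times_aop.rep_eq norm_blinfun_compose)

instance
proof
  fix X Y Z :: "'a aop" and r s :: real
  show "X * Y * Z = X * (Y * Z)" "1 * X = X" "X * 1 = X" "(X + Y) * Z = X * Z + Y * Z"
    "X * (Y + Z) = X * Y + X * Z" "X + Y + Z = X + (Y + Z)" "X + Y = Y + X" "0 + X = X"
    "- X + X = 0" "X - Y = X + - Y" "r *\<^sub>R (X + Y) = r *\<^sub>R X + r *\<^sub>R Y"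
    "(r + s) *\<^sub>R X = r *\<^sub>R X + s *\<^sub>R X" "r *\<^sub>R s *\<^sub>R X = (r * s) *\<^sub>R X" "1 *\<^sub>R X = X"
    "r *\<^sub>R X * Y = r *\<^sub>R (X * Y)" "X * r *\<^sub>R Y = r *\<^sub>R (X * Y)"
    using alin_app[of X]
    by (auto intro!: aop_eqI simp: app_plus app_zero app_one app_scaleR app_times app_uminus
        app_minus algebra_simps alin_add alin_def linear_simps)
  show "dist X Y = norm (X - Y)" by (rule dist_aop_def)
  show "sgn X = inverse (norm X) *\<^sub>R X" by (rule sgn_aop_def)
  show "(uniformity :: ('a aop \<times> 'a aop) filter) =
      (INF e\<in>{0 <..}. principal {(x, y). dist x y < e})" by (rule uniformity_aop_def)
  show "open U = (\<forall>x\<in>U. \<forall>\<^sub>F (x', y) in uniformity. x' = x \<longrightarrow> y \<in> U)" for U :: "'a aop set"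
    by (rule open_aop_def)
  show "(norm X = 0) = (X = 0)"
    by (simp add: norm_aop_def zero_aop.rep_eq aop_blinfun_inject[symmetric])
  show "norm (X + Y) \<le> norm X + norm Y"
    by (simp add: norm_aop_def plus_aop.rep_eq norm_triangle_ineq)
  show "norm (r *\<^sub>R X) = \<bar>r\<bar> * norm X" by (simp add: norm_aop_def scaleR_aop.rep_eq)
  show "norm (X * Y) \<le> norm X * norm Y" by (rule norm_aop_mult_le)
  \<comment> \<open>A nonzero vector is required, since the class demands 0 distinct from 1 and
    \<open>norm 1 = 1\<close>.\<close>
  define e :: "'a ell2" where "e = Ell2 (\<lambda>n. if n = 0 then 1 else 0)"
  have "summable (\<lambda>n. star (if n = 0 then 1 else 0) * (if n = 0 then 1 else (0 :: 'a)))"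
    by (rule summable_finite[of "{0::nat}"]) auto
  then have "coord e 0 = 1" by (simp add: e_def Ell2_inverse)
  then have e: "e \<noteq> 0" by (auto simp: coord_simps)
  show "(0 :: 'a aop) \<noteq> 1"
  proof
    assume "(0 :: 'a aop) = 1"
    then have "app 0 e = app 1 e" by (rule arg_cong)
    then show False using e by (simp add: app_zero app_one)
  qed
  have "norm (1 :: 'a aop) \<le> 1" by (rule norm_aop_le) (simp_all add: app_one)
  moreover have "1 \<le> norm (1 :: 'a aop)"
    using norm_app_le[of 1 e] e by (simp add: app_one)
  ultimately show "norm (1 :: 'a aop) = 1" by simp
qed

end

instantiation aop :: (unital_cstar_algebra) unital_cstar_algebra
begin

definition star_aop :: "'a aop \<Rightarrow> 'a aop" where
  "star_aop X = Aop (SOME S. adj (app X) (blinfun_apply S))"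

definition cscale_aop :: "complex \<Rightarrow> 'a aop \<Rightarrow> 'a aop" where
  "cscale_aop l X = Aop (Blinfun (\<lambda>x. app X x \<odot> cscale l 1))"

lemma adj_app_star: "adj (app X) (app (star (X :: 'a aop)))"
proof -
  let ?S = "SOME S. adj (app X) (blinfun_apply S)"
  have "\<exists>S. adj (app X) (blinfun_apply S)" using aop_blinfun[of X] by (simp add: app_def)
  then have S: "adj (app X) (blinfun_apply ?S)" by (rule someI_ex)
  have inv: "app (Aop U) = blinfun_apply U" if "\<exists>S. adj (blinfun_apply U) (blinfun_apply S)" for U :: "'a ell2 \<Rightarrow>\<^sub>L 'a ell2"
    using that by (simp add: app_def Aop_inverse)
  have "\<exists>S. adj (blinfun_apply ?S) (blinfun_apply S)"
    using adj_sym[OF S] by (auto simp: app_def)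
  then have "app (star X) = blinfun_apply ?S"
    unfolding star_aop_def by (rule inv)
  then show ?thesis using S by simp
qed

lemma ip_app: "ip (app X x) y = ip x (app (star (X :: 'a aop)) y)"
  and ip_app_right: "ip x (app X y) = ip (app (star (X :: 'a aop)) x) y"
  using adj_app_star[of X] adj_sym[OF adj_app_star[of X]] by (simp_all add: adj_def)

lemma star_eqI:
  assumes "\<And>x y. ip (app X x) y = ip x (app (Y :: 'a aop) y)"
  shows "star X = Y"
  by (rule aop_eqI, rule ell2_eq_if_ip_eq) (metis assms ip_app)

lemma cscale_one_central: "a * cscale l 1 = cscale l (1 :: 'a) * a"
  by (simp add: cscale_mult_left cscale_mult_right)

text \<open>The scalar acts through the right action of \<open>cscale l 1\<close>; this element is
  central, which keeps the result a module map.\<close>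

lemma app_cscale: "app (cscale l X) x = app (X :: 'a aop) x \<odot> cscale l 1"
proof -
  have "adj (\<lambda>x. app X x \<odot> cscale l 1) (\<lambda>y. app (star X) y \<odot> cscale (cnj l) 1)"
  proof (rule adj_if_ip_eq)
    show "alin (\<lambda>x. app X x \<odot> cscale l 1)"
      using alin_app[of X]
      by (simp add: alin_def act_act cscale_one_central
          bounded_linear_compose[OF bounded_bilinear.bounded_linear_left[OF bounded_bilinear_act]])
    show "ip (app X x \<odot> cscale l 1) y = ip x (app (star X) y \<odot> cscale (cnj l) 1)" for x y
      by (simp add: ip_act_left ip_act_right star_cscale ip_app cscale_one_central)
  qed
  then obtain Y where Y: "app Y = (\<lambda>x. app X x \<odot> cscale l 1)" using app_exists by blast
  then have "aop_blinfun Y = Blinfun (\<lambda>x. app X x \<odot> cscale l 1)"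
    by (metis app_def blinfun_apply_inverse)
  then have "cscale l X = Y" unfolding cscale_aop_def by (metis aop_blinfun_inverse)
  then show ?thesis by (simp add: Y)
qed

lemma norm_act_cscale_one: "norm (x \<odot> cscale l 1) = cmod l * norm (x :: 'a ell2)"
proof -
  have "ip (x \<odot> cscale l 1) (x \<odot> cscale l 1) = cscale (l * cnj l) (ip x x)"
    by (simp add: ip_act_left ip_act_right star_cscale cscale_mult_left cscale_mult_right
        cscale_cscale mult.commute)
  then show ?thesis
    by (simp add: norm_ell2_def norm_cscale norm_mult real_sqrt_mult power2_eq_square[symmetric])
qed

lemma norm_aop_star_le: "(norm X)\<^sup>2 \<le> norm (star X * (X :: 'a aop))"
proof -
  have "norm (app X x) \<le> sqrt (norm (star X * X)) * norm x" for x
  proof (rule power2_le_imp_le)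
    have "(norm (app X x))\<^sup>2 = norm (ip x (app (star X * X) x))"
      by (simp add: norm_power2_ell2 ip_app app_times)
    also have "\<dots> \<le> norm x * (norm (star X * X) * norm x)"
      by (rule order_trans[OF norm_ip_le]) (intro mult_left_mono norm_app_le norm_ge_zero)
    also have "\<dots> = (sqrt (norm (star X * X)) * norm x)\<^sup>2"
      by (simp add: power_mult_distrib norm_aop_def power2_eq_square)
    finally show "(norm (app X x))\<^sup>2 \<le> (sqrt (norm (star X * X)) * norm x)\<^sup>2" .
  qed (simp add: norm_aop_def)
  then have "norm X \<le> sqrt (norm (star X * X))"
    by (intro norm_aop_le) (simp_all add: norm_aop_def)
  then have "(norm X)\<^sup>2 \<le> (sqrt (norm (star X * X)))\<^sup>2"
    by (intro power_mono) (simp_all add: norm_aop_def)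
  then show ?thesis by (simp add: norm_aop_def)
qed

lemma star_star_aop: "star (star X) = (X :: 'a aop)"
  by (rule star_eqI) (simp add: ip_app_right)

lemma norm_star_aop: "norm (star X) = norm (X :: 'a aop)"
proof -
  have le: "norm X \<le> norm (star X)" for X :: "'a aop"
  proof (cases "norm X = 0")
    case False
    then have "0 < norm X" by (simp add: norm_aop_def)
    moreover have "norm X * norm X \<le> norm (star X) * norm X"
      using norm_aop_star_le[of X] norm_aop_mult_le[of "star X" X] by (simp add: power2_eq_square)
    ultimately show ?thesis by simp
  qed (simp add: norm_aop_def)
  show ?thesis using le[of X] le[of "star X"] by (simp add: star_star_aop)
qed

lemma blinfun_minus_aop: "aop_blinfun (X - Y) = aop_blinfun X - aop_blinfun (Y :: 'a aop)"
  unfolding minus_aop_def plus_aop.rep_eq scaleR_aop.rep_eq by simp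

lemma star_minus_aop: "star (X - Y) = star X - star (Y :: 'a aop)"
  by (rule star_eqI) (simp add: app_minus ip_diff_left ip_diff_right ip_app)

text \<open>The adjoints form a Cauchy sequence as well because \<open>star\<close> is isometric,
  and their limit is an adjoint of the limit operator.\<close>

lemma Cauchy_aop_convergent:
  fixes X :: "nat \<Rightarrow> 'a aop"
  assumes X: "Cauchy X"
  shows "convergent X"
proof -
  have 1: "Cauchy (\<lambda>n. aop_blinfun (X n))"
    using X by (simp add: Cauchy_iff norm_aop_def blinfun_minus_aop)
  have "Cauchy (\<lambda>n. aop_blinfun (star (X n)))"
    using X by (simp add: Cauchy_iff norm_star_aop[unfolded norm_aop_def] norm_aop_def
        flip: blinfun_minus_aop star_minus_aop)
  then obtain T S where T: "(\<lambda>n. aop_blinfun (X n)) \<longlonglongrightarrow> T"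
    and S: "(\<lambda>n. aop_blinfun (star (X n))) \<longlonglongrightarrow> S"
    using 1 by (metis Cauchy_convergent convergent_def)
  have Tx: "(\<lambda>n. app (X n) x) \<longlonglongrightarrow> blinfun_apply T x" for x
    unfolding app_def by (intro tendsto_intros T)
  have Sx: "(\<lambda>n. app (star (X n)) x) \<longlonglongrightarrow> blinfun_apply S x" for x
    unfolding app_def by (intro tendsto_intros S)
  have "blinfun_apply T (x \<odot> a) = blinfun_apply T x \<odot> a" for x a
  proof (rule LIMSEQ_unique[OF Tx])
    show "(\<lambda>n. app (X n) (x \<odot> a)) \<longlonglongrightarrow> blinfun_apply T x \<odot> a"
      by (simp add: alin_act[OF alin_app]) (intro tendsto_intros Tx)
  qed
  then have "alin (blinfun_apply T)" by (simp add: alin_def blinfun.bounded_linear_right)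
  then have "adj (blinfun_apply T) (blinfun_apply S)"
  proof (rule adj_if_ip_eq)
    fix x y
    have "(\<lambda>n. ip (app (X n) x) y) \<longlonglongrightarrow> ip (blinfun_apply T x) y"
      by (intro tendsto_intros Tx)
    moreover have "(\<lambda>n. ip (app (X n) x) y) \<longlonglongrightarrow> ip x (blinfun_apply S y)"
      unfolding ip_app by (intro tendsto_intros Sx)
    ultimately show "ip (blinfun_apply T x) y = ip x (blinfun_apply S y)"
      by (rule LIMSEQ_unique)
  qed
  then obtain Y where "app Y = blinfun_apply T" using app_exists by blast
  then have Y: "aop_blinfun Y = T" by (simp add: app_def blinfun_apply_inject)
  have "X \<longlonglongrightarrow> Y"
    using T unfolding lim_sequentially dist_norm by (simp add: norm_aop_def blinfun_minus_aop Y)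
  then show ?thesis by (rule convergentI)
qed

instance
proof
  fix X Y Z :: "'a aop" and r s :: real and l m :: complex
  show "cscale l (X + Y) = cscale l X + cscale l Y" "cscale (l + m) X = cscale l X + cscale m X"
    "cscale l (cscale m X) = cscale (l * m) X" "cscale l X * Y = cscale l (X * Y)"
    "X * cscale l Y = cscale l (X * Y)"
    using alin_app[of X]
    by (auto intro!: aop_eqI simp: app_plus app_times app_cscale act_add_left act_add_right act_act
        cscale_add_left cscale_mult_left cscale_mult_right cscale_cscale mult.commute alin_def)
  show "cscale (complex_of_real r) X = r *\<^sub>R X"
    by (rule aop_eqI) (simp add: app_cscale app_scaleR cscale_of_real act_scaleR_right)
  show "norm (cscale l X) = cmod l * norm X"
  proof (rule antisym)
    show "norm (cscale l X) \<le> cmod l * norm X"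
      by (rule norm_aop_le)
        (simp_all add: app_cscale norm_act_cscale_one norm_aop_def mult.assoc mult_left_mono
          norm_app_le[unfolded norm_aop_def])
    show "cmod l * norm X \<le> norm (cscale l X)"
    proof (cases "l = 0")
      case False
      have "norm X \<le> norm (cscale l X) / cmod l"
      proof (rule norm_aop_le)
        show "norm (app X x) \<le> norm (cscale l X) / cmod l * norm x" for x
          using norm_app_le[of "cscale l X" x] False
          by (simp add: app_cscale norm_act_cscale_one field_simps)
      qed (simp add: norm_aop_def)
      then show ?thesis using False by (simp add: field_simps)
    qed (simp add: norm_aop_def)
  qed
  show "star (X + Y) = star X + star Y"
    by (rule star_eqI) (simp add: app_plus ip_add_left ip_add_right ip_app)
  show "star (cscale l X) = cscale (cnj l) (star X)"
    by (rule star_eqI)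
      (simp add: app_cscale ip_act_left ip_act_right ip_app star_cscale cscale_one_central)
  show "star (star X) = X" by (rule star_star_aop)
  show "star (X * Y) = star Y * star X"
    by (rule star_eqI) (simp add: app_times ip_app)
  show "norm (star X * X) = (norm X)\<^sup>2"
    using norm_aop_star_le[of X] norm_aop_mult_le[of "star X" X]
    by (simp add: norm_star_aop power2_eq_square)
qed (rule Cauchy_aop_convergent)

end

section \<open>Isomorphic orthogonal summands are adjointably isomorphic\<close>

lemma square_summable_if_geometric:
  fixes y :: "nat \<Rightarrow> 'a::unital_cstar_algebra"
  assumes "\<And>n. norm (y n) \<le> B * (1/2)^n"
  shows "summable (\<lambda>n. star (y n) * y n)" "norm (\<Sum>n. star (y n) * y n) \<le> (2 * B)\<^sup>2"
proof -
  have bd: "norm (star (y n) * y n) \<le> B\<^sup>2 * (1/4)^n" for n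
  proof -
    have "(norm (y n))\<^sup>2 \<le> (B * (1/2)^n)\<^sup>2" by (intro power_mono assms norm_ge_zero)
    also have "\<dots> = B\<^sup>2 * (1/4)^n"
      by (simp add: power_mult_distrib power2_eq_square flip: power_mult_distrib)
    finally show ?thesis by (simp add: cstar_identity)
  qed
  have geo: "summable (\<lambda>n. B\<^sup>2 * (1/4::real)^n)" by (intro summable_mult summable_geometric) simp
  have sn: "summable (\<lambda>n. norm (star (y n) * y n))"
    by (rule summable_comparison_test[OF _ geo]) (use bd in auto)
  then show "summable (\<lambda>n. star (y n) * y n)" by (rule summable_norm_cancel)
  have "norm (\<Sum>n. star (y n) * y n) \<le> (\<Sum>n. B\<^sup>2 * (1/4::real)^n)"
    by (rule order_trans[OF summable_norm[OF sn] suminf_le[OF bd sn geo]])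
  also have "\<dots> = B\<^sup>2 * (4/3)"
    by (subst suminf_mult) (simp_all add: suminf_geometric summable_geometric)
  also have "\<dots> \<le> (2 * B)\<^sup>2" by (simp add: power_mult_distrib)
  finally show "norm (\<Sum>n. star (y n) * y n) \<le> (2 * B)\<^sup>2" .
qed

lemma closure_rangeI:
  assumes "(\<lambda>n::nat. g (z n)) \<longlonglongrightarrow> (x :: 'b::metric_space)"
  shows "x \<in> closure (range g)"
  unfolding closure_sequential by (rule exI[of _ "\<lambda>n. g (z n)"]) (simp add: assms)

lemma closure_rangeE:
  assumes "(x :: 'b::metric_space) \<in> closure (range g)"
  obtains z where "(\<lambda>n::nat. g (z n)) \<longlonglongrightarrow> x"
proof -
  obtain w where w: "\<forall>n. w n \<in> range g" "w \<longlonglongrightarrow> x"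
    using assms by (auto simp: closure_sequential)
  from w(1) have "\<forall>n. \<exists>z. w n = g z" by (auto simp: image_iff)
  then obtain z where "\<And>n. w n = g (z n)" by metis
  then show ?thesis using that[of z] w(2) by presburger
qed

section \<open>Basis vectors, truncations and damped operators\<close>

definition basis_vec :: "nat \<Rightarrow> 'a::unital_cstar_algebra ell2" where
  "basis_vec n = Ell2 (\<lambda>m. if m = n then 1 else 0)"

lemma coord_basis_vec: "coord (basis_vec n) m = (if m = n then 1 else 0)"
proof -
  have "summable (\<lambda>m. star (if m = n then 1 else 0) * (if m = n then 1 else (0 :: 'a)))"
    by (rule summable_finite[of "{n}"]) auto
  then show ?thesis by (simp add: basis_vec_def Ell2_inverse)
qed

lemma ip_basis_vec: "ip (basis_vec n) x = coord x n"
proof -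
  have "(\<lambda>m. star (coord (basis_vec n) m) * coord x m) sums (\<Sum>m\<in>{n}. star (coord (basis_vec n) m) * coord x m)"
    by (rule sums_finite) (auto simp: coord_basis_vec)
  then show ?thesis using ip_sums[of "basis_vec n" x] sums_unique2
    by (fastforce simp: coord_basis_vec)
qed

lemma norm_basis_vec: "norm (basis_vec n :: 'a::unital_cstar_algebra ell2) = 1"
  by (simp add: norm_ell2_def ip_basis_vec coord_basis_vec)

lemma coord_sum: "coord (sum f A) n = (\<Sum>i\<in>A. coord (f i) n)"
  by (induction A rule: infinite_finite_induct) (simp_all add: coord_simps)

lemma truncation_tendsto: "(\<lambda>N. \<Sum>n<N. basis_vec n \<odot> coord x n) \<longlonglongrightarrow> x"
  unfolding lim_sequentially dist_norm
proof (intro allI impI)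
  fix e :: real assume e: "0 < e"
  obtain M where M: "\<forall>F. finite F \<longrightarrow> F \<inter> {..<M} = {} \<longrightarrow> seminorm_on F (coord x) < e/2"
    using square_summable_tail[OF summable_coord half_gt_zero[OF e]] by metis
  have "norm ((\<Sum>n<N. basis_vec n \<odot> coord x n) - x) < e" if N: "N \<ge> M" for N
  proof -
    have c: "coord ((\<Sum>n<N. basis_vec n \<odot> coord x n) - x) m = (if m < N then 0 else - coord x m)" for m
      by (simp add: coord_simps coord_sum coord_basis_vec if_distrib[of "\<lambda>a. a * _"] cong: if_cong)
    have "norm ((\<Sum>n<N. basis_vec n \<odot> coord x n) - x) \<le> e/2"
    proof (rule LIMSEQ_le_const2[OF seminorm_on_tendsto_norm], intro exI allI impI)
      fix K
      have "(\<Sum>m<K. star (if m < N then 0 else - coord x m) * (if m < N then 0 else - coord x m)) =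
          (\<Sum>m\<in>{N..<K}. star (coord x m) * coord x m)"
        by (rule sum.mono_neutral_cong_right) (auto simp: star_minus)
      then have "seminorm_on {..<K} (coord ((\<Sum>n<N. basis_vec n \<odot> coord x n) - x)) =
          seminorm_on {N..<K} (coord x)"
        by (simp add: seminorm_on_def c)
      also have "\<dots> < e/2" by (rule M[rule_format]) (use N in auto)
      finally show "seminorm_on {..<K} (coord ((\<Sum>n<N. basis_vec n \<odot> coord x n) - x)) \<le> e/2" by simp
    qed
    then show ?thesis using e by simp
  qed
  then show "\<exists>M. \<forall>N\<ge>M. norm ((\<Sum>n<N. basis_vec n \<odot> coord x n) - x) < e" by blast
qed

text \<open>
  A module map \<open>t\<close> need not have an adjoint, but \<open>t D\<close> has, for the diagonal operator
  \<open>D = diag (2\<^sup>-\<^sup>n)\<close>, namely \<open>damped t\<close>; \<open>D\<close> itself is \<open>damped\<close> of the identity.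
\<close>

definition damped :: "('a::unital_cstar_algebra ell2 \<Rightarrow> 'a ell2) \<Rightarrow> 'a ell2 \<Rightarrow> 'a ell2" where
  "damped t y = Ell2 (\<lambda>n. (1/2)^n *\<^sub>R ip (t (basis_vec n)) y)"

abbreviation damping :: "'a::unital_cstar_algebra ell2 \<Rightarrow> 'a ell2" where
  "damping \<equiv> damped (\<lambda>x. x)"

lemma coord_damped:
  assumes "alin t"
  shows "coord (damped t y) n = (1/2)^n *\<^sub>R ip (t (basis_vec n)) y"
proof -
  obtain K where K: "0 < K" "\<And>x. norm (t x) \<le> norm x * K" using alin_bound[OF assms] by blast
  have "norm ((1/2)^n *\<^sub>R ip (t (basis_vec n)) y) \<le> (K * norm y) * (1/2)^n" for n
  proof -
    have "norm (ip (t (basis_vec n)) y) \<le> K * norm y"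
      by (rule order_trans[OF norm_ip_le], rule mult_right_mono)
        (use K(2)[of "basis_vec n"] in \<open>simp_all add: norm_basis_vec\<close>)
    then show ?thesis by simp
  qed
  from square_summable_if_geometric(1)[OF this] show ?thesis
    unfolding damped_def by (subst Ell2_inverse) simp_all
qed

lemma coord_damping: "coord (damping y) n = (1/2)^n *\<^sub>R coord y n"
  by (simp add: coord_damped[OF alin_id] ip_basis_vec)

lemma alin_damping: "alin damping"
  unfolding alin_def
proof (intro conjI allI)
  show "bounded_linear (damping :: 'a::unital_cstar_algebra ell2 \<Rightarrow> _)"
  proof (rule bounded_linear_intro[where K=2])
    fix x :: "'a ell2"
    have "norm (coord (damping x) n) \<le> norm x * (1/2)^n" for n
      using norm_coord_le[of x n] by (simp add: coord_damping mult.commute mult_right_mono)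
    from square_summable_if_geometric(2)[OF this]
    have "(norm (damping x))\<^sup>2 \<le> (2 * norm x)\<^sup>2" by (simp add: norm_power2_ell2 ip.rep_eq)
    then show "norm (damping x) \<le> norm x * 2"
      using power2_le_imp_le[of "norm (damping x)" "2 * norm x"] by (simp add: mult.commute)
  qed (auto intro!: ell2_eqI simp: coord_damping coord_simps algebra_simps)
  show "damping (x \<odot> a) = damping x \<odot> a" for x :: "'a ell2" and a
    by (rule ell2_eqI) (simp add: coord_damping coord_simps)
qed

text \<open>On finite truncations of \<open>damping x\<close> linearity of t lets the weights move
  to the other argument; continuity of t gives the limit.\<close>

lemma ip_damped:
  assumes t: "alin t"
  shows "ip (t (damping x)) y = ip x (damped t y)"
proof -
  have "(\<lambda>N. ip (t (\<Sum>n<N. basis_vec n \<odot> coord (damping x) n)) y) \<longlonglongrightarrow> ip (t (damping x)) y"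
    by (intro tendsto_intros alin_tendsto[OF t] truncation_tendsto)
  moreover have "ip (t (\<Sum>n<N. basis_vec n \<odot> coord (damping x) n)) y =
      (\<Sum>n<N. star (coord x n) * coord (damped t y) n)" for N
    by (induction N)
      (simp_all add: alin_zero[OF t] alin_add[OF t] alin_act[OF t] ip_add_left ip_act_left
        coord_damping coord_damped[OF t] star_scaleR)
  ultimately have "(\<lambda>n. star (coord x n) * coord (damped t y) n) sums ip (t (damping x)) y"
    by (simp add: sums_def)
  then show ?thesis using ip_sums sums_unique2 by blast
qed

lemma adj_damped:
  assumes "alin t"
  shows "adj (\<lambda>x. t (damping x)) (damped t)"
  by (rule adj_if_ip_eq[OF alin_compose[OF assms alin_damping] ip_damped[OF assms]])

lemma damping_dense: "x \<in> closure (range damping)"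
proof -
  have "(\<Sum>n<N. basis_vec n \<odot> coord x n) = damping (\<Sum>n<N. 2^n *\<^sub>R (basis_vec n \<odot> coord x n))" for N
    by (rule ell2_eqI)
      (auto simp: coord_damping coord_sum coord_simps coord_basis_vec scaleR_sum_right
        power_one_over intro!: sum.cong)
  then show ?thesis using truncation_tendsto[of x]
    by (intro closure_rangeI[where z="\<lambda>N. \<Sum>n<N. 2^n *\<^sub>R (basis_vec n \<odot> coord x n)"]) simp
qed

text \<open>With h = \<open>star c * c\<close> and r the inverse of h + e, the error of
  approximating \<open>star b\<close> by h r \<open>star b\<close> is e r \<open>star b\<close>. Its
  norm is that of b (e r), at most |C| times that of c (e r), which is of order sqrt e because e r
  has norm at most 1 and h r norm at most 2.\<close>

lemma star_mult_range_closure: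
  fixes b c :: "'a::unital_cstar_algebra aop"
  assumes C: "\<And>x. norm (app b x) \<le> C * norm (app c x)"
  shows "app (star b) x \<in> closure (range (app (star c * c)))"
  unfolding closure_approachable
proof (intro allI impI)
  fix \<epsilon> :: real assume \<epsilon>: "0 < \<epsilon>"
  define h where "h = star c * c"
  \<comment> \<open>M strictly dominates |C| \<open>norm x\<close>, and e is chosen so that the
    final bound 2 sqrt e M equals the tolerance.\<close>
  define M where "M = (\<bar>C\<bar> + 1) * (norm x + 1)"
  have M: "0 < M" by (simp add: M_def add_nonneg_pos)
  define e where "e = (\<epsilon> / (2 * M))\<^sup>2"
  have e: "0 < e" using \<epsilon> M by (simp add: e_def)
  have se: "sqrt e = \<epsilon> / (2 * M)" using \<epsilon> M by (simp add: e_def real_sqrt_abs)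
  have ph: "positive h" by (simp add: h_def positive_star_mult)
  obtain r where r: "positive r" "r * (h + of_real e) = 1" "(h + of_real e) * r = 1"
      "norm (e *\<^sub>R r) \<le> 1"
    using positive_inverse[OF ph e] by metis
  have sr: "star r = r" by (rule positive_selfadjoint[OF r(1)])
  have hr: "h * r = 1 - e *\<^sub>R r" using r(3) by (simp add: algebra_simps of_real_def)
  have "norm (h * r) \<le> 2"
    unfolding hr using norm_triangle_ineq4[of 1 "e *\<^sub>R r"] r(4) by simp
  have eq: "star (c * (e *\<^sub>R r)) * (c * (e *\<^sub>R r)) = e *\<^sub>R ((e *\<^sub>R r) * (h * r))"
    by (simp add: star_mult star_scaleR sr h_def mult.assoc)
  have "(norm (c * (e *\<^sub>R r)))\<^sup>2 = e * norm ((e *\<^sub>R r) * (h * r))"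
    unfolding cstar_identity[symmetric] eq norm_scaleR using e by simp
  also have "\<dots> \<le> e * (1 * 2)"
    by (intro mult_left_mono order_trans[OF norm_mult_ineq] mult_mono r(4) \<open>norm (h * r) \<le> 2\<close>)
      (use e in simp_all)
  also have "\<dots> \<le> (2 * sqrt e)\<^sup>2" using e by (simp add: power_mult_distrib)
  finally have nc: "norm (c * (e *\<^sub>R r)) \<le> 2 * sqrt e" 
    by (rule power2_le_imp_le) (use e in simp)
  have "norm (b * (e *\<^sub>R r)) \<le> \<bar>C\<bar> * (2 * sqrt e)"
  proof (rule norm_aop_le)
    fix z
    have "norm (app (b * (e *\<^sub>R r)) z) \<le> C * norm (app (c * (e *\<^sub>R r)) z)"
      using C[of "app (e *\<^sub>R r) z"] by (simp only: app_times)
    also have "\<dots> \<le> \<bar>C\<bar> * (2 * sqrt e * norm z)"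
      by (intro mult_mono order_trans[OF norm_app_le] mult_right_mono nc) auto
    finally show "norm (app (b * (e *\<^sub>R r)) z) \<le> \<bar>C\<bar> * (2 * sqrt e) * norm z" by (simp add: mult.assoc)
  qed (use e in simp)
  then have "norm (star (b * (e *\<^sub>R r))) \<le> \<bar>C\<bar> * (2 * sqrt e)" by simp
  then have nb: "norm (e *\<^sub>R (r * star b)) \<le> \<bar>C\<bar> * (2 * sqrt e)" by (simp add: star_mult star_scaleR sr)
  have "star b - h * (r * star b) = e *\<^sub>R (r * star b)"
    by (simp add: hr algebra_simps flip: mult.assoc)
  then have "norm (app (star b) x - app h (app (r * star b) x)) = norm (app (e *\<^sub>R (r * star b)) x)"
    by (metis app_minus app_times)
  also have "\<dots> \<le> \<bar>C\<bar> * (2 * sqrt e) * norm x"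
    by (rule order_trans[OF norm_app_le mult_right_mono[OF nb]]) simp
  also have "\<dots> = 2 * sqrt e * (\<bar>C\<bar> * norm x)" by simp
  also have "\<dots> < 2 * sqrt e * M"
  proof (rule mult_strict_left_mono)
    show "\<bar>C\<bar> * norm x < M"
      using abs_ge_zero[of C] norm_ge_zero[of x] unfolding M_def distrib_left distrib_right by linarith
  qed (use e in simp)
  also have "\<dots> = \<epsilon>" using M by (simp add: se)
  finally have "dist (app h (app (r * star b) x)) (app (star b) x) < \<epsilon>"
    by (simp add: dist_norm norm_minus_commute)
  then show "\<exists>y\<in>range (app (star c * c)). dist y (app (star b) x) < \<epsilon>" by (auto simp: h_def)
qed

text \<open>
  The graph relation of a partial isometry \<open>s z \<mapsto> a z\<close>, closed up, where \<open>s\<^sup>2 = star a * a\<close>: the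
  unitary factor in the polar decomposition of \<open>a\<close>.
\<close>

definition polar_rel :: "'a::unital_cstar_algebra aop \<Rightarrow> 'a aop \<Rightarrow> 'a ell2 \<Rightarrow> 'a ell2 \<Rightarrow> bool" where
  "polar_rel s a x y \<longleftrightarrow> (\<exists>z. (\<lambda>n. app s (z n)) \<longlonglongrightarrow> x \<and> (\<lambda>n. app a (z n)) \<longlonglongrightarrow> y)"

context
  fixes s a :: "'a::unital_cstar_algebra aop"
  assumes s: "star s = s" and sq: "s * s = star a * a"
begin

lemma ip_polar: "ip (app s x) (app s y) = ip (app a x) (app a y)"
  by (metis ip_app s sq app_times star_star)

lemma norm_polar: "norm (app s x) = norm (app a x)"
  by (simp add: norm_ell2_def ip_polar)

text \<open>Preservation of inner products makes the relation isometric, hence single-valued in both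
  directions.\<close>

lemma polar_rel_ip: "polar_rel s a x y \<Longrightarrow> polar_rel s a x' y' \<Longrightarrow> ip x x' = ip y y'"
  unfolding polar_rel_def
proof clarify
  fix z z'
  assume z: "(\<lambda>n. app s (z n)) \<longlonglongrightarrow> x" "(\<lambda>n. app a (z n)) \<longlonglongrightarrow> y"
    "(\<lambda>n. app s (z' n)) \<longlonglongrightarrow> x'" "(\<lambda>n. app a (z' n)) \<longlonglongrightarrow> y'"
  have "(\<lambda>n. ip (app s (z n)) (app s (z' n))) \<longlonglongrightarrow> ip x x'" by (intro tendsto_intros z)
  moreover have "(\<lambda>n. ip (app a (z n)) (app a (z' n))) \<longlonglongrightarrow> ip y y'" by (intro tendsto_intros z)
  ultimately show "ip x x' = ip y y'" by (simp add: ip_polar LIMSEQ_unique)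
qed

lemma polar_rel_add: "polar_rel s a x y \<Longrightarrow> polar_rel s a x' y' \<Longrightarrow> polar_rel s a (x + x') (y + y')"
  unfolding polar_rel_def
proof clarify
  fix z z'
  assume z: "(\<lambda>n. app s (z n)) \<longlonglongrightarrow> x" "(\<lambda>n. app a (z n)) \<longlonglongrightarrow> y"
    "(\<lambda>n. app s (z' n)) \<longlonglongrightarrow> x'" "(\<lambda>n. app a (z' n)) \<longlonglongrightarrow> y'"
  show "\<exists>z. (\<lambda>n. app s (z n)) \<longlonglongrightarrow> x + x' \<and> (\<lambda>n. app a (z n)) \<longlonglongrightarrow> y + y'"
    by (rule exI[of _ "\<lambda>n. z n + z' n"]) (simp add: alin_add[OF alin_app] tendsto_add z)
qed

lemma polar_rel_act: "polar_rel s a x y \<Longrightarrow> polar_rel s a (x \<odot> b) (y \<odot> b)"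
  unfolding polar_rel_def
proof clarify
  fix z assume z: "(\<lambda>n. app s (z n)) \<longlonglongrightarrow> x" "(\<lambda>n. app a (z n)) \<longlonglongrightarrow> y"
  show "\<exists>z. (\<lambda>n. app s (z n)) \<longlonglongrightarrow> x \<odot> b \<and> (\<lambda>n. app a (z n)) \<longlonglongrightarrow> y \<odot> b"
    by (rule exI[of _ "\<lambda>n. z n \<odot> b"])
      (simp add: alin_act[OF alin_app] tendsto_act[OF _ tendsto_const] z)
qed

lemma polar_rel_unique_right:
  assumes "polar_rel s a x y" "polar_rel s a x y'"
  shows "y = y'"
proof -
  have "ip (y - y') (y - y') = ip x x - ip x x - (ip x x - ip x x)"
    by (simp only: ip_diff_left ip_diff_right polar_rel_ip[OF assms(1,1)] polar_rel_ip[OF assms(2,2)]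
        polar_rel_ip[OF assms(1,2)] polar_rel_ip[OF assms(2,1)])
      (metis assms diff_self polar_rel_ip)
  then show ?thesis by simp
qed

lemma polar_rel_unique_left:
  assumes "polar_rel s a x y" "polar_rel s a x' y"
  shows "x = x'"
proof -
  have "ip (x - x') (x - x') = 0"
    by (simp add: ip_diff_left ip_diff_right polar_rel_ip[OF assms(1,1)] polar_rel_ip[OF assms(2,2)]
        polar_rel_ip[OF assms(1,2)] polar_rel_ip[OF assms(2,1)])
  then show ?thesis by simp
qed

lemma polar_rel_right_exists:
  assumes "x \<in> closure (range (app s))"
  obtains y where "polar_rel s a x y"
proof -
  obtain z where z: "(\<lambda>n. app s (z n)) \<longlonglongrightarrow> x" using closure_rangeE[OF assms] .
  have "Cauchy (\<lambda>n. app a (z n))"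
    using LIMSEQ_imp_Cauchy[OF z]
    by (simp add: Cauchy_iff norm_polar flip: alin_diff[OF alin_app])
  then obtain y where "(\<lambda>n. app a (z n)) \<longlonglongrightarrow> y" using Cauchy_convergent convergent_def by blast
  then show ?thesis using z that by (auto simp: polar_rel_def)
qed

lemma polar_rel_left_exists:
  assumes "(\<lambda>n. app a (z n)) \<longlonglongrightarrow> y"
  obtains x where "polar_rel s a x y"
proof -
  have "Cauchy (\<lambda>n. app s (z n))"
    using LIMSEQ_imp_Cauchy[OF assms]
    by (simp add: Cauchy_iff norm_polar flip: alin_diff[OF alin_app])
  then obtain x where "(\<lambda>n. app s (z n)) \<longlonglongrightarrow> x" using Cauchy_convergent convergent_def by blast
  then show ?thesis using assms that by (auto simp: polar_rel_def)
qed

end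

section \<open>Replacing a bounded isomorphism by an adjointable one\<close>

lemma closure_range_compose:
  assumes f: "alin f" and x: "x \<in> closure (range g)"
  shows "f x \<in> closure (range (\<lambda>z. f (g z)))"
proof -
  obtain z where "(\<lambda>n. g (z n)) \<longlonglongrightarrow> x" using closure_rangeE[OF x] .
  from alin_tendsto[OF f this] show ?thesis by (rule closure_rangeI)
qed

theorem adjointable_iso:
  fixes p q T T' :: "'a::unital_cstar_algebra ell2 \<Rightarrow> 'a ell2"
  assumes p: "adj p p" "\<And>x. p (p x) = p x" and q: "adj q q" "\<And>x. q (q x) = q x"
    and T: "alin T" "\<And>x. q (T (p x)) = T (p x)" "\<And>x. T' (T (p x)) = p x"
    and T': "alin T'" "\<And>y. p (T' (q y)) = T' (q y)" "\<And>y. T (T' (q y)) = q y"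
  obtains V W where "adj V W" "\<And>x. W (V x) = p x" "\<And>y. V (W y) = q y"
    "\<And>x. q (V x) = V x" "\<And>x. V (p x) = V x" "\<And>y. p (W y) = W y" "\<And>y. W (q y) = W y"
proof -
  have ap: "alin p" and aq: "alin q" using p q by (auto simp: adj_def)
  obtain P where P: "app P = p" using app_exists[OF p(1)] by blast
  obtain D :: "'a aop" where D: "app D = damping" using app_exists[OF adj_damped[OF alin_id]] by blast
  have at: "alin (\<lambda>x. T (p x))" by (rule alin_compose[OF T(1) ap])
  obtain A where A: "app A = (\<lambda>x. T (p (damping x)))" using app_exists[OF adj_damped[OF at]] by blast
  have sP: "star P = P" by (rule star_eqI) (use p(1) in \<open>simp add: P adj_def\<close>)
  have sD: "star D = D" by (rule star_eqI) (simp add: D ip_damped[OF alin_id])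
  \<comment> \<open>A = T P D is adjointable by damping. The further factor \<open>star b\<close>
    turns a into T k with k = P D^2 P, which is selfadjoint, absorbs p on both sides and has range
    dense in that of p.\<close>
  define b where "b = P * D"
  have sb: "star b = D * P" by (simp add: b_def star_mult sP sD)
  define k where "k = b * star b"
  have sk: "star k = k" by (simp add: k_def star_mult star_star)
  define a where "a = A * star b"
  have ak: "app a x = T (app k x)" for x
    by (simp add: a_def k_def b_def star_mult sP sD app_times A P D)
  have pk: "p (app k x) = app k x" for x by (simp add: k_def b_def app_times P p(2))
  have kp: "app k (p x) = app k x" for x by (simp add: k_def sb app_times P p(2))
  have qa: "q (app a x) = app a x" for x unfolding ak using T(2)[of "app k x"] by (simp add: pk)
  have Tk: "T' (app a x) = app k x" for x unfolding ak using T(3)[of "app k x"] by (simp add: pk)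
  obtain s where "star s = s" "s * s = star a * a"
    using positive_sqrt[OF positive_star_mult[of a]] by metis
  note s = this
  note norm_s = norm_polar[OF s]
  \<comment> \<open>s vanishes on the kernel of p because a does; selfadjointness then places its
    range in that of p.\<close>
  have "app s (x - p x) = 0" for x
  proof -
    have "norm (app s (x - p x)) = norm (T (app k (x - p x)))" by (simp add: norm_s ak)
    also have "app k (x - p x) = 0" by (simp add: alin_diff[OF alin_app] kp)
    finally show ?thesis by (simp add: alin_zero[OF T(1)])
  qed
  then have "app (s * P) x = app s x" for x
    by (simp add: app_times P alin_diff[OF alin_app])
  then have "s * P = s" by (rule aop_eqI)
  then have "star (s * P) = star s" by simp
  then have "P * s = s" by (simp add: star_mult s sP)
  then have ps: "p (app s x) = app s x" for x by (metis app_times P)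
  obtain K where K: "0 < K" "\<And>x. norm (T' x) \<le> norm x * K" using alin_bound[OF T'(1)] by blast
  \<comment> \<open>T' recovers k from a, so k is dominated by a, and the density lemma puts the
    range of k into the closure of the range of \<open>star a * a\<close>, which is
    \<open>s * s\<close>.\<close>
  have "norm (app k x) \<le> K * norm (app a x)" for x
    using K(2)[of "app a x"] by (simp add: Tk mult.commute)
  from star_mult_range_closure[of k, OF this]
  have "app k x \<in> closure (range (app (s * s)))" for x by (simp add: sk s)
  moreover have "closure (range (app (s * s))) \<subseteq> closure (range (app s))"
    by (rule closure_mono) (auto simp: app_times)
  ultimately have "range (app k) \<subseteq> closure (range (app s))" by blast
  then have ks: "closure (range (app k)) \<subseteq> closure (range (app s))" by (simp add: closure_minimal)
  \<comment> \<open>The same lemma with both operators equal to \<open>star b\<close>: the range of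
    b lies in the closure of that of \<open>b * star b\<close>, which is k.\<close>
  have "app (star (star b)) x \<in> closure (range (app (star (star b) * star b)))" for x
    by (rule star_mult_range_closure[where C=1]) simp
  then have "range (app b) \<subseteq> closure (range (app k))" by (auto simp: star_star k_def)
  then have bk: "closure (range (app b)) \<subseteq> closure (range (app k))" by (simp add: closure_minimal)
  have "p x \<in> closure (range (app b))" for x
    using closure_range_compose[OF ap damping_dense[of x]] by (simp add: b_def app_times[abs_def] P D)
  then have pk_dense: "p x \<in> closure (range (app k))" and ps_dense: "p x \<in> closure (range (app s))" for x
    using bk ks by blast+
  let ?R = "polar_rel s a"
  have ex_right: "\<exists>y. ?R (p x) y" for x using polar_rel_right_exists[OF s ps_dense] by metis
  have ex_left: "\<exists>x. ?R x (q y)" for y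
  proof -
    have "T' (q y) \<in> closure (range (app k))" using pk_dense[of "T' (q y)"] by (simp add: T'(2))
    then obtain z where z: "(\<lambda>n. app k (z n)) \<longlonglongrightarrow> T' (q y)" by (rule closure_rangeE)
    then have "(\<lambda>n. app a (z n)) \<longlonglongrightarrow> q y"
      using alin_tendsto[OF T(1) z] by (simp add: ak T'(3))
    then show ?thesis using polar_rel_left_exists[OF s] by metis
  qed
  have Rp: "p x = x" and Rq: "q y = y" if R: "?R x y" for x y
  proof -
    obtain z where z: "(\<lambda>n. app s (z n)) \<longlonglongrightarrow> x" "(\<lambda>n. app a (z n)) \<longlonglongrightarrow> y"
      using R by (auto simp: polar_rel_def)
    show "p x = x" using alin_tendsto[OF ap z(1)] z(1) LIMSEQ_unique by (auto simp: ps)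
    show "q y = y" using alin_tendsto[OF aq z(2)] z(2) LIMSEQ_unique by (auto simp: qa)
  qed
  define V where "V x = (THE y. ?R (p x) y)" for x
  define W where "W y = (THE x. ?R x (q y))" for y
  have V: "?R (p x) (V x)" for x
    unfolding V_def using ex_right[of x] polar_rel_unique_right[OF s] by (auto intro!: theI2[of "?R (p x)"])
  have W: "?R (W y) (q y)" for y
    unfolding W_def using ex_left[of y] polar_rel_unique_left[OF s]
    by (auto intro!: theI2[of "\<lambda>x. ?R x (q y)"])
  have VI: "V x = y" if "?R (p x) y" for x y using polar_rel_unique_right[OF s V that] .
  have WI: "W y = x" if "?R x (q y)" for x y using polar_rel_unique_left[OF s W that] .
  obtain L where L: "0 < L" "\<And>x. norm (p x) \<le> norm x * L" using alin_bound[OF ap] by blast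
  have Vadd: "V (x + y) = V x + V y" for x y
    by (rule VI) (simp add: alin_add[OF ap] polar_rel_add[OF s V V])
  have Vact: "V (x \<odot> c) = V x \<odot> c" for x c
    by (rule VI) (simp add: alin_act[OF ap] polar_rel_act[OF s V])
  have "norm (V x) = norm (p x)" for x
    using polar_rel_ip[OF s V V, of x x] by (simp add: norm_ell2_def)
  then have aV: "alin V" unfolding alin_def
    by (intro conjI bounded_linear_intro[where K=L])
      (use Vadd Vact L(2) act_of_real in \<open>auto simp flip: act_of_real\<close>)
  have adV: "ip (V x) y = ip x (W y)" for x y
  proof -
    have "ip (V x) y = ip (q (V x)) y" using Rq[OF V] by simp
    also have "\<dots> = ip (V x) (q y)" using q(1) by (simp add: adj_def)
    also have "\<dots> = ip (p x) (W y)" using polar_rel_ip[OF s V W] by simp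
    also have "\<dots> = ip x (p (W y))" using p(1) by (simp add: adj_def)
    finally show ?thesis using Rp[OF W] by simp
  qed
  show ?thesis
  proof (rule that)
    show "adj V W" by (rule adj_if_ip_eq[OF aV adV])
    show "W (V x) = p x" for x by (rule WI) (use V[of x] Rq[OF V] in simp)
    show "V (W y) = q y" for y by (rule VI) (use W[of y] Rp[OF W] in simp)
    show "q (V x) = V x" for x by (rule Rq[OF V])
    show "V (p x) = V x" for x by (rule VI) (use V in \<open>simp add: p(2)\<close>)
    show "p (W y) = W y" for y by (rule Rp[OF W])
    show "W (q y) = W y" for y by (rule WI) (use W in \<open>simp add: q(2)\<close>)
  qed
qed

section \<open>Direct sums and finitely generated submodules\<close>

definition dsum :: "'a::unital_cstar_algebra ell2 set \<Rightarrow> 'a ell2 set \<Rightarrow> 'a ell2 set \<Rightarrow> bool" where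
  "dsum M N L \<longleftrightarrow> smod M \<and> smod N \<and> smod L \<and> M \<inter> N = {0} \<and> L = {x + y |x y. x \<in> M \<and> y \<in> N}"

definition fg :: "'a::unital_cstar_algebra ell2 set \<Rightarrow> bool" where
  "fg N \<longleftrightarrow> (\<exists>S. finite S \<and> S \<subseteq> N \<and> (\<forall>x\<in>N. \<exists>c. x = (\<Sum>s\<in>S. s \<odot> c s)))"

lemma smod_sum: "smod N \<Longrightarrow> (\<And>i. i \<in> I \<Longrightarrow> f i \<in> N) \<Longrightarrow> sum f I \<in> N"
  by (rule subspace_sum[OF smod_subspace])

lemma alin_sum: "alin g \<Longrightarrow> g (sum f I) = (\<Sum>i\<in>I. g (f i))"
  by (induction I rule: infinite_finite_induct) (simp_all add: alin_zero alin_add)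

lemma act_sum_right: "x \<odot> sum f I = (\<Sum>i\<in>I. x \<odot> f i)"
  by (induction I rule: infinite_finite_induct) (simp_all add: act_add_right)

lemma fg_image:
  assumes g: "alin g" and N: "fg N"
  shows "fg (g ` N)"
proof -
  obtain S where S: "finite S" "S \<subseteq> N" "\<forall>x\<in>N. \<exists>c. x = (\<Sum>s\<in>S. s \<odot> c s)"
    using N by (auto simp: fg_def)
  have "\<exists>c. g x = (\<Sum>t\<in>g ` S. t \<odot> c t)" if x: "x \<in> N" for x
  proof -
    obtain c where c: "x = (\<Sum>s\<in>S. s \<odot> c s)" using bspec[OF S(3) x] by (rule exE)
    have "g x = (\<Sum>s\<in>S. g s \<odot> c s)" by (simp add: c alin_sum[OF g] alin_act[OF g])
    \<comment> \<open>Distinct generators may have the same image, so the coefficients are collected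
      over the fibres of g.\<close>
    also have "\<dots> = (\<Sum>t\<in>g ` S. \<Sum>s\<in>{s \<in> S. g s = t}. g s \<odot> c s)"
      by (rule sum.image_gen[OF S(1)])
    also have "\<dots> = (\<Sum>t\<in>g ` S. t \<odot> (\<Sum>s\<in>{s \<in> S. g s = t}. c s))"
      by (simp add: act_sum_right)
    finally show ?thesis by (rule exI[where x="\<lambda>t. \<Sum>s\<in>{s \<in> S. g s = t}. c s"])
  qed
  then have "\<forall>y\<in>g ` N. \<exists>c. y = (\<Sum>t\<in>g ` S. t \<odot> c t)" by simp
  then show ?thesis unfolding fg_def using S(1,2) by (intro exI[of _ "g ` S"] conjI) auto
qed

lemma fg_sum:
  assumes M: "fg M" "0 \<in> M" and N: "fg N" "0 \<in> N"
  shows "fg {x + y |x y. x \<in> M \<and> y \<in> N}"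
proof -
  obtain S where S: "finite S" "S \<subseteq> M" "\<forall>x\<in>M. \<exists>c. x = (\<Sum>s\<in>S. s \<odot> c s)"
    using M by (auto simp: fg_def)
  obtain R where R: "finite R" "R \<subseteq> N" "\<forall>x\<in>N. \<exists>c. x = (\<Sum>s\<in>R. s \<odot> c s)"
    using N by (auto simp: fg_def)
  have "\<exists>c. x + y = (\<Sum>s\<in>S \<union> R. s \<odot> c s)" if x: "x \<in> M" and y: "y \<in> N" for x y
  proof -
    obtain c where c: "x = (\<Sum>s\<in>S. s \<odot> c s)" using bspec[OF S(3) x] by (rule exE)
    obtain d where d: "y = (\<Sum>s\<in>R. s \<odot> d s)" using bspec[OF R(3) y] by (rule exE)
    have "x = (\<Sum>s\<in>S \<union> R. s \<odot> (if s \<in> S then c s else 0))"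
      unfolding c by (rule sum.mono_neutral_cong_left) (use S R in auto)
    moreover have "y = (\<Sum>s\<in>S \<union> R. s \<odot> (if s \<in> R then d s else 0))"
      unfolding d by (rule sum.mono_neutral_cong_left) (use S R in auto)
    ultimately have "x + y = (\<Sum>s\<in>S \<union> R. s \<odot> ((if s \<in> S then c s else 0) + (if s \<in> R then d s else 0)))"
      by (simp only: act_add_right sum.distrib)
    then show ?thesis
      by (rule exI[where x="\<lambda>s. (if s \<in> S then c s else 0) + (if s \<in> R then d s else 0)"])
  qed
  then have "\<forall>z\<in>{x + y |x y. x \<in> M \<and> y \<in> N}. \<exists>c. z = (\<Sum>s\<in>S \<union> R. s \<odot> c s)"
    by auto
  moreover have "S \<union> R \<subseteq> {x + y |x y. x \<in> M \<and> y \<in> N}"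
  proof -
    have "s \<in> {x + y |x y. x \<in> M \<and> y \<in> N}" if "s \<in> S" for s
      using that S(2) N(2) by (intro CollectI exI[of _ s] exI[of _ 0]) auto
    moreover have "s \<in> {x + y |x y. x \<in> M \<and> y \<in> N}" if "s \<in> R" for s
      using that R(2) M(2) by (intro CollectI exI[of _ 0] exI[of _ s]) auto
    ultimately show ?thesis by blast
  qed
  ultimately show ?thesis unfolding fg_def using S(1) R(1) by (intro exI[of _ "S \<union> R"] conjI) simp_all
qed

text \<open>Addition maps the product of M and N bijectively onto the whole space; the open mapping
  theorem bounds its inverse and hence the oblique projection p.\<close>

lemma dsum_projection:
  assumes "dsum M N UNIV"
  obtains p where "alin p" "\<And>x. p x \<in> M" "\<And>x. x - p x \<in> N" "\<And>x. x \<in> M \<Longrightarrow> p x = x"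
    "\<And>x. x \<in> N \<Longrightarrow> p x = 0"
proof -
  have M: "smod M" and N: "smod N" and MN: "M \<inter> N = {0}"
    and U: "UNIV = {x + y |x y. x \<in> M \<and> y \<in> N}"
    using assms unfolding dsum_def by auto
  have "x \<in> {x + y |x y. x \<in> M \<and> y \<in> N}" for x unfolding U[symmetric] by simp
  then have UN: "\<exists>m n. x = m + n \<and> m \<in> M \<and> n \<in> N" for x by blast
  have uniq: "m = m'" if "m \<in> M" "m' \<in> M" "m + n = m' + n'" "n \<in> N" "n' \<in> N" for m m' n n'
  proof -
    have "m - m' = n' - n" using that(3) by (simp add: algebra_simps)
    moreover have "m - m' \<in> M" "n' - n \<in> N" using smod_diff M N that by blast+
    ultimately have "m - m' \<in> M \<inter> N" by simp
    then show ?thesis using MN by simp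
  qed
  obtain p where p: "\<And>x. p x \<in> M" "\<And>x. x - p x \<in> N"
    using UN by (metis add_diff_cancel_left')
  have peq: "p x = m" if "m \<in> M" "x - m \<in> N" for x m
    by (rule uniq[of _ _ "x - p x" "x - m"]) (use p that in auto)
  have addp: "p (x + y) = p x + p y" for x y
  proof (rule peq)
    have "x + y - (p x + p y) = (x - p x) + (y - p y)" by simp
    then show "x + y - (p x + p y) \<in> N" using smod_add[OF N p(2) p(2)] by metis
  qed (intro smod_add[OF M] p)
  have actp: "p (x \<odot> a) = p x \<odot> a" for x a
  proof (rule peq)
    have "x \<odot> a - p x \<odot> a = (x - p x) \<odot> a" by (simp add: act_diff_left)
    then show "x \<odot> a - p x \<odot> a \<in> N" using smod_act[OF N p(2)] by metis
  qed (intro smod_act[OF M] p)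
  let ?f = "\<lambda>z. fst z + snd z :: 'a ell2"
  obtain C where C: "0 < C" "\<And>y. y \<in> UNIV \<Longrightarrow> \<exists>z\<in>M \<times> N. ?f z = y \<and> norm z \<le> C * norm y"
  proof (rule open_mapping_subspaces[of ?f "M \<times> N" UNIV])
    show "bounded_linear ?f" by (intro bounded_linear_add bounded_linear_fst bounded_linear_snd)
    show "subspace (M \<times> N)" using smod_subspace[OF M] smod_subspace[OF N]
      by (auto simp: subspace_def zero_prod_def)
    show "closed (M \<times> N)" by (intro closed_Times smod_closed M N)
    show "?f ` (M \<times> N) = UNIV" using UN by (auto simp: image_iff) metis
  qed auto
  have "norm (p x) \<le> norm x * C" for x
  proof -
    obtain z where z: "z \<in> M \<times> N" "?f z = x" "norm z \<le> C * norm x" using C(2) by blast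
    have "p x = fst z" by (rule peq) (use z in auto)
    then show ?thesis using z(3) norm_fst_le[of "fst z" "snd z"] by (simp add: mult.commute)
  qed
  then have "bounded_linear p"
    by (intro bounded_linear_intro[where K=C]) (simp_all add: addp actp flip: act_of_real)
  then have "alin p" by (simp add: alin_def actp)
  then show ?thesis
    by (rule that) (use p peq smod_zero[OF M] smod_zero[OF N] in auto)
qed

lemma bij_bounded_below:
  assumes g: "alin g" and M: "smod M" and N: "smod N" and bij: "bij_betw g M N"
  obtains C where "0 < C" "\<And>x. x \<in> M \<Longrightarrow> norm x \<le> C * norm (g x)"
proof -
  obtain C where C: "0 < C" "\<And>y. y \<in> N \<Longrightarrow> \<exists>x\<in>M. g x = y \<and> norm x \<le> C * norm y"
    using open_mapping_subspaces[OF alin_bounded_linear[OF g] smod_subspace[OF M] smod_closed[OF M]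
        smod_subspace[OF N] smod_closed[OF N]] bij by (auto simp: bij_betw_def)
  have "norm x \<le> C * norm (g x)" if "x \<in> M" for x
    using C(2)[of "g x"] bij that by (auto simp: bij_betw_def inj_on_def)
  then show ?thesis using that C(1) by blast
qed

text \<open>The inverse on N is extended to the whole space through the projection q; its bound
  comes from g being bounded below on M.\<close>

lemma bij_inverse:
  assumes g: "alin g" and M: "smod M" and N: "smod N" and bij: "bij_betw g M N"
    and q: "alin q" "\<And>y. q y \<in> N" "\<And>y. y \<in> N \<Longrightarrow> q y = y"
  obtains h where "alin h" "\<And>y. h y \<in> M" "\<And>y. g (h y) = q y" "\<And>x. x \<in> M \<Longrightarrow> h (g x) = x"
    "\<And>y. h (q y) = h y"
proof -
  obtain C where C: "0 < C" "\<And>x. x \<in> M \<Longrightarrow> norm x \<le> C * norm (g x)"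
    using bij_bounded_below[OF g M N bij] by metis
  define h where "h y = the_inv_into M g (q y)" for y
  have inj: "inj_on g M" and im: "g ` M = N" using bij by (auto simp: bij_betw_def)
  have hM: "h y \<in> M" for y unfolding h_def
    by (rule the_inv_into_into[OF inj]) (use q im in auto)
  have gh: "g (h y) = q y" for y unfolding h_def
    by (rule f_the_inv_into_f[OF inj]) (use q im in auto)
  have hI: "h y = x" if "x \<in> M" "g x = q y" for x y
    using that hM[of y] gh[of y] inj by (auto simp: inj_on_def)
  obtain K where K: "0 < K" "\<And>x. norm (q x) \<le> norm x * K" using alin_bound[OF q(1)] by blast
  have "norm (h y) \<le> norm y * (C * K)" for y
  proof -
    have "norm (h y) \<le> C * norm (q y)" using C(2)[OF hM, of y] by (simp add: gh)
    also have "\<dots> \<le> C * (norm y * K)" using C(1) K(2) by (intro mult_left_mono) auto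
    finally show ?thesis by (simp add: mult_ac)
  qed
  moreover have "h (x + y) = h x + h y" for x y
    by (rule hI) (auto intro: smod_add[OF M] hM simp: alin_add[OF g] alin_add[OF q(1)] gh)
  moreover have hact: "h (x \<odot> a) = h x \<odot> a" for x a
    by (rule hI) (auto intro: smod_act[OF M] hM simp: alin_act[OF g] alin_act[OF q(1)] gh)
  ultimately have "bounded_linear h"
    by (intro bounded_linear_intro[where K="C * K"]) (simp_all flip: act_of_real)
  then have "alin h" by (simp add: alin_def hact)
  moreover have "h (g x) = x" if "x \<in> M" for x
    by (rule hI[OF that]) (use q(3) im that in auto)
  moreover have "h (q y) = h y" for y by (simp add: h_def q)
  ultimately show ?thesis using that hM gh by blast
qed

section \<open>Splitting a sequence into two\<close>

definition subseq :: "(nat \<Rightarrow> nat) \<Rightarrow> 'a::unital_cstar_algebra ell2 \<Rightarrow> 'a ell2" where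
  "subseq \<kappa> x = Ell2 (\<lambda>n. coord x (\<kappa> n))"

definition spread :: "(nat \<Rightarrow> nat) \<Rightarrow> 'a::unital_cstar_algebra ell2 \<Rightarrow> 'a ell2" where
  "spread \<kappa> x = Ell2 (\<lambda>m. if m \<in> range \<kappa> then coord x (inv \<kappa> m) else 0)"

lemma has_sum_spread:
  fixes f :: "nat \<Rightarrow> 'b::{banach}"
  assumes "inj \<kappa>" "\<And>m. m \<notin> range \<kappa> \<Longrightarrow> f m = 0"
  shows "(f has_sum s) UNIV \<longleftrightarrow> ((\<lambda>n. f (\<kappa> n)) has_sum s) UNIV"
proof -
  have "(f has_sum s) UNIV \<longleftrightarrow> (f has_sum s) (range \<kappa>)"
    by (rule has_sum_cong_neutral) (use assms(2) in auto)
  then show ?thesis using has_sum_reindex[OF assms(1), of f s] by (simp add: o_def)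
qed

context
  fixes \<kappa> :: "nat \<Rightarrow> nat"
  assumes \<kappa>: "inj \<kappa>"
begin

lemma coord_subseq: "coord (subseq \<kappa> x) n = coord x (\<kappa> n)"
proof -
  have "(\<lambda>m. star (coord x m) * coord x m) summable_on range \<kappa>"
    by (rule summable_on_subset_banach[OF has_sum_imp_summable[OF
            inner_has_sum[OF summable_coord summable_coord]]]) simp
  then have "(\<lambda>n. star (coord x (\<kappa> n)) * coord x (\<kappa> n)) summable_on UNIV"
    using summable_on_reindex[OF \<kappa>, of "\<lambda>m. star (coord x m) * coord x m"] by (simp add: o_def)
  then have "summable (\<lambda>n. star (coord x (\<kappa> n)) * coord x (\<kappa> n))" by (rule summable_on_imp_summable)
  then show ?thesis by (simp add: subseq_def Ell2_inverse)
qed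

lemma coord_spread: "coord (spread \<kappa> x) m = (if m \<in> range \<kappa> then coord x (inv \<kappa> m) else 0)"
proof -
  let ?f = "\<lambda>m. if m \<in> range \<kappa> then coord x (inv \<kappa> m) else 0"
  have "((\<lambda>n. star (coord x n) * coord x n) has_sum (\<Sum>n. star (coord x n) * coord x n)) UNIV"
    by (rule inner_has_sum[OF summable_coord summable_coord])
  then have "((\<lambda>n. star (?f (\<kappa> n)) * ?f (\<kappa> n)) has_sum (\<Sum>n. star (coord x n) * coord x n)) UNIV"
    by (simp add: \<kappa>)
  then have "((\<lambda>m. star (?f m) * ?f m) has_sum (\<Sum>n. star (coord x n) * coord x n)) UNIV"
    using has_sum_spread[OF \<kappa>, of "\<lambda>m. star (?f m) * ?f m"] by auto
  then have "summable (\<lambda>m. star (?f m) * ?f m)"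
    using has_sum_imp_sums sums_summable by blast
  then show ?thesis unfolding spread_def by (subst Ell2_inverse) simp_all
qed

lemma ip_spread: "ip (spread \<kappa> x) y = ip x (subseq \<kappa> y)"
proof -
  have "((\<lambda>m. star (coord (spread \<kappa> x) m) * coord y m) has_sum ip (spread \<kappa> x) y) UNIV"
    unfolding ip.rep_eq by (rule inner_has_sum[OF summable_coord summable_coord])
  then have "((\<lambda>n. star (coord (spread \<kappa> x) (\<kappa> n)) * coord y (\<kappa> n)) has_sum ip (spread \<kappa> x) y) UNIV"
    by (subst (asm) has_sum_spread[OF \<kappa>]) (auto simp: coord_spread)
  then have "(\<lambda>n. star (coord x n) * coord (subseq \<kappa> y) n) sums ip (spread \<kappa> x) y"
    using has_sum_imp_sums by (simp add: coord_spread coord_subseq \<kappa>)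
  then show ?thesis using ip_sums sums_unique2 by blast
qed

lemma subseq_spread: "subseq \<kappa> (spread \<kappa> x) = x"
  by (rule ell2_eqI) (simp add: coord_subseq coord_spread \<kappa>)

lemma adj_spread: "adj (spread \<kappa>) (subseq \<kappa>)"
proof (rule adj_if_ip_eq[OF _ ip_spread])
  have "norm (spread \<kappa> x) = norm x" for x :: "'a ell2"
    by (simp add: norm_ell2_def ip_spread subseq_spread)
  then have "bounded_linear (spread \<kappa> :: 'a ell2 \<Rightarrow> _)"
    by (intro bounded_linear_intro[where K=1])
      (auto intro!: ell2_eqI simp: coord_spread coord_simps)
  moreover have "spread \<kappa> (x \<odot> a) = spread \<kappa> x \<odot> a" for x :: "'a ell2" and a
    by (rule ell2_eqI) (simp add: coord_spread coord_simps)
  ultimately show "alin (spread \<kappa> :: 'a ell2 \<Rightarrow> _)" by (simp add: alin_def)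
qed

end

abbreviation "evens \<equiv> subseq (\<lambda>n. 2 * n)"
abbreviation "odds \<equiv> subseq (\<lambda>n. Suc (2 * n))"
abbreviation "to_evens \<equiv> spread (\<lambda>n. 2 * n)"
abbreviation "to_odds \<equiv> spread (\<lambda>n. Suc (2 * n))"

lemma inj_double: "inj (\<lambda>n::nat. 2 * n)" "inj (\<lambda>n::nat. Suc (2 * n))"
  by (auto simp: inj_on_def)

lemmas alin_split =
  adj_spread[OF inj_double(1), unfolded adj_def, THEN conjunct1]
  adj_spread[OF inj_double(2), unfolded adj_def, THEN conjunct1]
  adj_spread[OF inj_double(1), unfolded adj_def, THEN conjunct2, THEN conjunct1]
  adj_spread[OF inj_double(2), unfolded adj_def, THEN conjunct2, THEN conjunct1]

lemmas split_zero [simp] = alin_split[THEN alin_zero]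

lemmas alin_split_compose = alin_split[THEN alin_compose]

lemmas split_linear = alin_split[THEN alin_add] alin_split[THEN alin_act]

lemma split_simps [simp]:
  "evens (to_evens x) = x" "odds (to_odds x) = x" "odds (to_evens x) = 0" "evens (to_odds x) = 0"
  "to_evens (evens x) + to_odds (odds x) = x"
proof -
  show "evens (to_evens x) = x" "odds (to_odds x) = x" by (rule subseq_spread, rule inj_double)+
  have n1: "Suc (2 * k) \<notin> range (\<lambda>n::nat. 2 * n)" for k
  proof
    assume "Suc (2 * k) \<in> range (\<lambda>n::nat. 2 * n)"
    then obtain j where "Suc (2 * k) = 2 * j" by blast
    then show False by presburger
  qed
  have n2: "2 * k \<notin> range (\<lambda>n::nat. Suc (2 * n))" for k
  proof
    assume "2 * k \<in> range (\<lambda>n::nat. Suc (2 * n))"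
    then obtain j where "2 * k = Suc (2 * j)" by blast
    then show False by presburger
  qed
  show "odds (to_evens x) = 0"
    by (rule ell2_eqI)
      (simp add: coord_subseq[OF inj_double(2)] coord_spread[OF inj_double(1)] coord_simps n1)
  show "evens (to_odds x) = 0"
    by (rule ell2_eqI)
      (simp add: coord_subseq[OF inj_double(1)] coord_spread[OF inj_double(2)] coord_simps n2)
  show "to_evens (evens x) + to_odds (odds x) = x"
  proof (rule ell2_eqI)
    fix m
    have i1: "inv (\<lambda>n::nat. 2 * n) (2 * k) = k" for k by (rule inv_f_f[OF inj_double(1)])
    have i2: "inv (\<lambda>n::nat. Suc (2 * n)) (Suc (2 * k)) = k" for k
      using inv_f_f[OF inj_double(2), of k] by simp
    consider k where "m = 2 * k" | k where "m = Suc (2 * k)"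
      by (metis evenE oddE add.commute plus_1_eq_Suc)
    then show "coord (to_evens (evens x) + to_odds (odds x)) m = coord x m"
      by cases
        (simp_all add: coord_subseq[OF inj_double(1)] coord_spread[OF inj_double(1)]
          coord_subseq[OF inj_double(2)] coord_spread[OF inj_double(2)]
          coord_simps i1 i2 n1 n2)
  qed
qed

lemma ip_split: "ip x y = ip (evens x) (evens y) + ip (odds x) (odds y)"
proof -
  have "ip x y = ip (to_evens (evens x) + to_odds (odds x)) y" by simp
  also have "\<dots> = ip (evens x) (evens y) + ip (odds x) (odds y)"
    unfolding ip_add_left by (simp only: ip_spread[OF inj_double(1)] ip_spread[OF inj_double(2)])
  finally show ?thesis .
qed

section \<open>Transfer to the modules of the statement\<close>

text \<open>The records carry no axioms, and their operators matter only on the carrier. Identifying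
  the carrier with \<open>ell2\<close> by \<psi> lets each notion of the statement be translated
  once and instantiated for the single and for the double module.\<close>

locale ell2_model =
  fixes K :: "('a::unital_cstar_algebra, 'h::ab_group_add) hmodule"
    and \<psi> :: "'a ell2 \<Rightarrow> 'h" and \<phi> :: "'h \<Rightarrow> 'a ell2"
  assumes carrier: "mcarrier K = range \<psi>"
    and left_inverse: "\<phi> (\<psi> y) = y"
    and add: "\<psi> (x + y) = \<psi> x + \<psi> y"
    and act: "\<psi> (x \<odot> a) = mact K (\<psi> x) a"
    and ip: "mip K (\<psi> x) (\<psi> y) = ip x y"
begin

lemma zero: "\<psi> 0 = 0"
  using add[of 0 0] by simp

lemma diff: "\<psi> (x - y) = \<psi> x - \<psi> y"
  using add[of "x - y" y] by (simp add: algebra_simps)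

lemma sum: "\<psi> (sum f I) = (\<Sum>i\<in>I. \<psi> (f i))"
  by (induction I rule: infinite_finite_induct) (simp_all add: zero add)

lemma inj: "inj \<psi>"
  by (metis injI left_inverse)

lemma mnorm: "mnorm K (\<psi> x) = norm x"
  by (simp add: mnorm_def ip norm_ell2_def)

lemma mnorm_submod: "mnorm (submod K M) x = mnorm K x"
  by (simp add: mnorm_def)

lemma image_eqE:
  assumes "M \<subseteq> mcarrier K"
  obtains M' where "M = \<psi> ` M'"
  using assms carrier that[of "\<phi> ` M"] by (force simp: image_image left_inverse)

lemma closed_submodule_iff: "closed_submodule K (\<psi> ` M) \<longleftrightarrow> smod M"
proof -
  have cl: "(\<forall>X x. (\<forall>n::nat. X n \<in> \<psi> ` M) \<longrightarrow> x \<in> mcarrier K \<longrightarrow>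
       (\<lambda>n. mnorm K (X n - x)) \<longlonglongrightarrow> 0 \<longrightarrow> x \<in> \<psi> ` M) \<longleftrightarrow> closed M" (is "?L \<longleftrightarrow> _")
  proof
    assume L: ?L
    show "closed M" unfolding closed_sequential_limits
    proof (intro allI impI)
      fix X l assume X: "(\<forall>n. X n \<in> M) \<and> X \<longlonglongrightarrow> l"
      then have "(\<lambda>n. mnorm K (\<psi> (X n) - \<psi> l)) \<longlonglongrightarrow> 0"
        by (simp add: mnorm tendsto_norm_zero LIM_zero flip: diff)
      then have "\<psi> l \<in> \<psi> ` M"
        using L[rule_format, of "\<lambda>n. \<psi> (X n)" "\<psi> l"] X carrier by auto
      then show "l \<in> M" by (metis imageE left_inverse)
    qed
  next
    assume M: "closed M"
    show ?L
    proof (intro allI impI)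
      fix X :: "nat \<Rightarrow> 'h" and x
      assume X: "\<forall>n. X n \<in> \<psi> ` M" and x: "x \<in> mcarrier K" and lim: "(\<lambda>n. mnorm K (X n - x)) \<longlonglongrightarrow> 0"
      obtain l where l: "x = \<psi> l" using x carrier by blast
      have Xn: "\<psi> (\<phi> (X n)) = X n" "\<phi> (X n) \<in> M" for n using X by (metis imageE left_inverse)+
      have "(\<lambda>n. norm (\<phi> (X n) - l)) \<longlonglongrightarrow> 0"
        using lim by (simp add: l Xn(1) diff flip: mnorm)
      then have "(\<lambda>n. \<phi> (X n) - l) \<longlonglongrightarrow> 0" by (rule tendsto_norm_zero_cancel)
      then have "(\<lambda>n. \<phi> (X n)) \<longlonglongrightarrow> l" by (rule LIM_zero_cancel)
      then have "l \<in> M" by (rule closed_sequentially[OF M Xn(2)])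
      then show "x \<in> \<psi> ` M" by (simp add: l)
    qed
  qed
  have z: "0 \<in> \<psi> ` M \<longleftrightarrow> 0 \<in> M" by (metis imageE imageI left_inverse zero)
  have a: "(\<forall>x\<in>\<psi> ` M. \<forall>y\<in>\<psi> ` M. x + y \<in> \<psi> ` M) \<longleftrightarrow> (\<forall>x\<in>M. \<forall>y\<in>M. x + y \<in> M)"
    by (auto simp flip: add) (metis imageE left_inverse)
  have s: "(\<forall>x\<in>\<psi> ` M. \<forall>b. mact K x b \<in> \<psi> ` M) \<longleftrightarrow> (\<forall>x\<in>M. \<forall>b. x \<odot> b \<in> M)"
    by (auto simp flip: act) (metis imageE left_inverse)
  have c: "\<psi> ` M \<subseteq> mcarrier K" by (auto simp: carrier)
  show ?thesis unfolding closed_submodule_def smod_def cl z a s using c by auto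
qed

lemma direct_sum_iff: "direct_sum K (\<psi> ` M) (\<psi> ` N) (\<psi> ` L) \<longleftrightarrow> dsum M N L"
proof -
  have 1: "\<psi> ` M \<inter> \<psi> ` N = {0} \<longleftrightarrow> M \<inter> N = {0}"
  proof -
    have "\<psi> ` M \<inter> \<psi> ` N = \<psi> ` (M \<inter> N)" by (rule image_Int[OF inj, symmetric])
    moreover have "{0} = \<psi> ` {0}" by (simp add: zero)
    ultimately show ?thesis by (metis inj inj_image_eq_iff)
  qed
  have "{x + y |x y. x \<in> \<psi> ` M \<and> y \<in> \<psi> ` N} = \<psi> ` {x + y |x y. x \<in> M \<and> y \<in> N}"
    by (auto simp: add) (metis (mono_tags, lifting) add imageI mem_Collect_eq, blast)
  then have 2: "\<psi> ` L = {x + y |x y. x \<in> \<psi> ` M \<and> y \<in> \<psi> ` N} \<longleftrightarrow>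
      L = {x + y |x y. x \<in> M \<and> y \<in> N}"
    by (simp add: inj_image_eq_iff[OF inj])
  show ?thesis unfolding direct_sum_def dsum_def closed_submodule_iff 1 2 ..
qed

text \<open>\<open>fg\<close> only asks that the generators reach all of N; the reverse inclusion
  comes from N being a submodule.\<close>

lemma finitely_generated_iff:
  assumes N: "smod N"
  shows "finitely_generated (submod K (\<psi> ` N)) \<longleftrightarrow> fg N"
proof
  assume "finitely_generated (submod K (\<psi> ` N))"
  then obtain S where S: "finite S" "S \<subseteq> \<psi> ` N"
    "\<psi> ` N = {y. \<exists>c. y = (\<Sum>s\<in>S. mact K s (c s))}"
    by (auto simp: finitely_generated_def)
  obtain R where R: "R \<subseteq> N" "S = \<psi> ` R" using S(2) by (meson subset_imageE)
  have E: "\<exists>c. x = (\<Sum>r\<in>R. r \<odot> c r)" if "x \<in> N" for x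
  proof -
    have "\<psi> x \<in> {y. \<exists>c. y = (\<Sum>s\<in>S. mact K s (c s))}"
      using imageI[OF that, of \<psi>] by (simp only: S(3))
    then obtain c where "\<psi> x = (\<Sum>s\<in>\<psi> ` R. mact K s (c s))" unfolding R(2) by auto
    also have "\<dots> = \<psi> (\<Sum>r\<in>R. r \<odot> c (\<psi> r))"
      by (simp add: sum act sum.reindex[OF inj_on_subset[OF inj]])
    finally show ?thesis by (metis left_inverse)
  qed
  have "finite R" using finite_imageD[of \<psi> R] S(1) R(2) inj_on_subset[OF inj] by simp
  then show "fg N" unfolding fg_def using R(1) E by (intro exI[of _ R] conjI ballI)
next
  assume "fg N"
  then obtain R where R: "finite R" "R \<subseteq> N" "\<forall>x\<in>N. \<exists>c. x = (\<Sum>r\<in>R. r \<odot> c r)"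
    by (auto simp: fg_def)
  have re: "(\<Sum>s\<in>\<psi> ` R. mact K s (c s)) = \<psi> (\<Sum>r\<in>R. r \<odot> c (\<psi> r))" for c
    by (simp add: sum act sum.reindex[OF inj_on_subset[OF inj]])
  have eqn: "\<psi> ` N = {y. \<exists>c. y = (\<Sum>s\<in>\<psi> ` R. mact K s (c s))}"
  proof (intro equalityI subsetI)
    fix y assume "y \<in> \<psi> ` N"
    then obtain x where x: "x \<in> N" "y = \<psi> x" by blast
    obtain c where "x = (\<Sum>r\<in>R. r \<odot> c r)" using bspec[OF R(3) x(1)] by (rule exE)
    then have "y = (\<Sum>s\<in>\<psi> ` R. mact K s (c (\<phi> s)))" by (simp add: re x left_inverse)
    then show "y \<in> {y. \<exists>c. y = (\<Sum>s\<in>\<psi> ` R. mact K s (c s))}"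
      by (intro CollectI exI[of _ "\<lambda>s. c (\<phi> s)"])
  next
    fix y assume "y \<in> {y. \<exists>c. y = (\<Sum>s\<in>\<psi> ` R. mact K s (c s))}"
    then obtain c where y: "y = (\<Sum>s\<in>\<psi> ` R. mact K s (c s))" by (auto simp only: mem_Collect_eq)
    show "y \<in> \<psi> ` N" unfolding y re
      using R(2) by (intro imageI smod_sum[OF N] smod_act[OF N]) blast
  qed
  show "finitely_generated (submod K (\<psi> ` N))"
    unfolding finitely_generated_def
  proof (intro exI conjI)
    show "finite (\<psi> ` R)" using R(1) by simp
    show "\<psi> ` R \<subseteq> mcarrier (submod K (\<psi> ` N))" using R(2) by auto
    show "mcarrier (submod K (\<psi> ` N)) =
        {y. \<exists>c. y = (\<Sum>s\<in>\<psi> ` R. mact (submod K (\<psi> ` N)) s (c s))}"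
      using eqn by simp
  qed
qed

lemma adjointable_elim:
  assumes f: "f \<in> adjointable_ops K K"
  obtains g S where "adj g S" "\<And>y. f (\<psi> y) = \<psi> (g y)"
proof -
  have bm: "bounded_module_map K K f" using f by (simp add: adjointable_ops_def)
  define g where "g y = \<phi> (f (\<psi> y))" for y
  have fK: "f (\<psi> y) \<in> range \<psi>" for y using bm carrier by (auto simp: bounded_module_map_def)
  have fg: "f (\<psi> y) = \<psi> (g y)" for y using fK[of y] by (auto simp: g_def left_inverse)
  obtain B where B: "\<And>y. mnorm K (f (\<psi> y)) \<le> B * mnorm K (\<psi> y)"
    using bm carrier by (auto simp: bounded_module_map_def)
  have gadd: "g (x + y) = g x + g y" for x y
  proof -
    have "\<psi> (g (x + y)) = \<psi> (g x + g y)"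
      using bm carrier by (simp add: bounded_module_map_def add flip: fg)
    then show ?thesis by (metis left_inverse)
  qed
  have gact: "g (x \<odot> b) = g x \<odot> b" for x b
  proof -
    have "\<psi> (g (x \<odot> b)) = \<psi> (g x \<odot> b)"
      using bm carrier by (simp add: bounded_module_map_def act flip: fg)
    then show ?thesis by (metis left_inverse)
  qed
  have "norm (g y) \<le> norm y * B" for y using B[of y] by (simp add: fg mnorm mult.commute)
  then have "bounded_linear g"
    by (intro bounded_linear_intro[where K=B]) (simp_all add: gadd gact flip: act_of_real)
  then have ag: "alin g" by (simp add: alin_def gact)
  obtain R where R: "\<forall>y\<in>mcarrier K. R y \<in> mcarrier K \<and>
        (\<forall>x\<in>mcarrier K. mip K (f x) y = mip K x (R y))"
    using f by (auto simp: adjointable_ops_def)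
  have "adj g (\<lambda>y. \<phi> (R (\<psi> y)))"
  proof (rule adj_if_ip_eq[OF ag])
    fix x y
    obtain z where z: "R (\<psi> y) = \<psi> z" using R carrier by blast
    have "mip K (f (\<psi> x)) (\<psi> y) = mip K (\<psi> x) (R (\<psi> y))" using R carrier by blast
    then show "ip (g x) y = ip x (\<phi> (R (\<psi> y)))" by (simp add: fg z ip left_inverse)
  qed
  then show ?thesis using that fg by blast
qed

lemma adjointable_intro:
  assumes g: "adj g S" and f: "\<And>y. f (\<psi> y) = \<psi> (g y)"
  shows "f \<in> adjointable_ops K K"
proof -
  have ag: "alin g" using g by (simp add: adj_def)
  obtain C where C: "0 < C" "\<And>x. norm (g x) \<le> norm x * C" using alin_bound[OF ag] by blast
  have "bounded_module_map K K f" unfolding bounded_module_map_def carrier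
    using C(2) by (auto simp: f mnorm alin_add[OF ag] alin_act[OF ag] mult.commute
        simp flip: add act intro!: exI[of _ C])
  then show ?thesis unfolding adjointable_ops_def carrier
    using g by (auto simp: adj_def f ip left_inverse intro!: exI[of _ "\<lambda>y. \<psi> (S (\<phi> y))"])
qed

lemma module_iso_intro:
  assumes g: "alin g" and M: "smod M" and N: "smod N" and bij: "bij_betw g M N"
    and f: "\<And>y. y \<in> M \<Longrightarrow> f (\<psi> y) = \<psi> (g y)"
  shows "module_iso (submod K (\<psi> ` M)) (submod K (\<psi> ` N)) f"
proof -
  obtain B where B: "0 < B" "\<And>x. norm (g x) \<le> norm x * B" using alin_bound[OF g] by blast
  obtain C where C: "0 < C" "\<And>x. x \<in> M \<Longrightarrow> norm x \<le> C * norm (g x)"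
    using bij_bounded_below[OF g M N bij] by metis
  have gN: "g x \<in> N" if "x \<in> M" for x using bij that by (auto simp: bij_betw_def)
  have b1: "bounded_module_map (submod K (\<psi> ` M)) (submod K (\<psi> ` N)) f"
    unfolding bounded_module_map_def
    using B(2) by (auto simp: f mnorm_submod mnorm alin_add[OF g] alin_act[OF g] mult.commute gN
        smod_add[OF M] smod_act[OF M] simp flip: add act intro!: exI[of _ B])
  have bf: "bij_betw f (\<psi> ` M) (\<psi> ` N)"
  proof -
    have "inj_on f (\<psi> ` M)" using bij inj by (auto simp: inj_on_def f bij_betw_def)
    moreover have "f ` \<psi> ` M = \<psi> ` N" using bij by (force simp: f bij_betw_def image_iff)
    ultimately show ?thesis by (simp add: bij_betw_def)
  qed
  let ?h = "inv_into (\<psi> ` M) f"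
  have hf: "?h (\<psi> (g x)) = \<psi> x" if "x \<in> M" for x
    using inv_into_f_f[of f "\<psi> ` M" "\<psi> x"] bf that by (simp add: f bij_betw_def)
  have NM: "\<exists>x\<in>M. y = g x" if "y \<in> N" for y using bij that by (auto simp: bij_betw_def)
  have b2: "bounded_module_map (submod K (\<psi> ` N)) (submod K (\<psi> ` M)) ?h"
    unfolding bounded_module_map_def
  proof (intro conjI ballI allI exI[of _ C])
    fix x assume "x \<in> mcarrier (submod K (\<psi> ` N))"
    then obtain a where a: "a \<in> M" "x = \<psi> (g a)" using NM by auto
    then show "?h x \<in> mcarrier (submod K (\<psi> ` M))" by (simp add: hf)
    show "mnorm (submod K (\<psi> ` M)) (?h x) \<le> C * mnorm (submod K (\<psi> ` N)) x"
      using a C(2) by (simp add: hf mnorm_submod mnorm)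
    show "?h (mact (submod K (\<psi> ` N)) x c) = mact (submod K (\<psi> ` M)) (?h x) c" for c
      using a hf[OF smod_act[OF M a(1), of c]] by (simp add: hf alin_act[OF g] act)
    fix y assume "y \<in> mcarrier (submod K (\<psi> ` N))"
    then obtain b where b: "b \<in> M" "y = \<psi> (g b)" using NM by auto
    show "?h (x + y) = ?h x + ?h y"
      using a b hf[OF smod_add[OF M a(1) b(1)]] by (simp add: hf alin_add[OF g] add)
  qed
  show ?thesis unfolding module_iso_def using b1 bf b2 by simp
qed

lemma isomorphic_intro:
  assumes "alin g" "smod M" "smod N" "bij_betw g M N"
  shows "isomorphic (submod K (\<psi> ` M)) (submod K (\<psi> ` N))"
  unfolding isomorphic_def
  by (rule exI[of _ "\<lambda>x. \<psi> (g (\<phi> x))"], rule module_iso_intro[OF assms]) (simp add: left_inverse)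

lemma diag_iso_decomp_intro:
  assumes "alin g" "dsum M1 N1 UNIV" "dsum M2 N2 UNIV" "g ` N1 \<subseteq> N2" "bij_betw g M1 M2"
    and f: "\<And>y. f (\<psi> y) = \<psi> (g y)"
  shows "diag_iso_decomp K f (\<psi> ` M1) (\<psi> ` N1) (\<psi> ` M2) (\<psi> ` N2)"
proof -
  have "f ` \<psi> ` M1 \<subseteq> \<psi> ` M2" "f ` \<psi> ` N1 \<subseteq> \<psi> ` N2"
    using assms(4,5) by (auto simp: f bij_betw_def)
  then show ?thesis
    unfolding diag_iso_decomp_def carrier
    using assms module_iso_intro[of g M1 M2 f]
    by (auto simp: direct_sum_iff dsum_def)
qed

lemma direct_sum_subset: "direct_sum K M N L \<Longrightarrow> M \<subseteq> mcarrier K \<and> N \<subseteq> mcarrier K"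
  by (simp add: direct_sum_def closed_submodule_def)

lemma diag_iso_decomp_elim:
  assumes d: "diag_iso_decomp K f A1 B1 A2 B2" and f: "\<And>y. f (\<psi> y) = \<psi> (g y)"
  obtains M1 N1 M2 N2 where "A1 = \<psi> ` M1" "B1 = \<psi> ` N1" "A2 = \<psi> ` M2" "B2 = \<psi> ` N2"
    "dsum M1 N1 UNIV" "dsum M2 N2 UNIV" "g ` M1 \<subseteq> M2" "g ` N1 \<subseteq> N2" "bij_betw g M1 M2"
proof -
  have sub: "A1 \<subseteq> mcarrier K" "B1 \<subseteq> mcarrier K" "A2 \<subseteq> mcarrier K" "B2 \<subseteq> mcarrier K"
    using d unfolding diag_iso_decomp_def by (blast dest: direct_sum_subset)+
  obtain M1 where "A1 = \<psi> ` M1" using image_eqE[OF sub(1)] .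
  moreover obtain N1 where "B1 = \<psi> ` N1" using image_eqE[OF sub(2)] .
  moreover obtain M2 where "A2 = \<psi> ` M2" using image_eqE[OF sub(3)] .
  moreover obtain N2 where "B2 = \<psi> ` N2" using image_eqE[OF sub(4)] .
  ultimately have eq: "A1 = \<psi> ` M1" "B1 = \<psi> ` N1" "A2 = \<psi> ` M2" "B2 = \<psi> ` N2" by simp_all
  have ds: "dsum M1 N1 UNIV" "dsum M2 N2 UNIV"
    using d unfolding diag_iso_decomp_def carrier eq by (simp_all add: direct_sum_iff)
  have "f ` \<psi> ` M1 \<subseteq> \<psi> ` M2" "f ` \<psi> ` N1 \<subseteq> \<psi> ` N2" and bij: "bij_betw f (\<psi> ` M1) (\<psi> ` M2)"
    using d unfolding diag_iso_decomp_def eq module_iso_def by simp_all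
  then have "\<psi> ` g ` M1 \<subseteq> \<psi> ` M2" "\<psi> ` g ` N1 \<subseteq> \<psi> ` N2" by (auto simp: f image_image)
  then have im: "g ` M1 \<subseteq> M2" "g ` N1 \<subseteq> N2" by (simp_all only: inj_image_subset_iff[OF inj])
  have "inj_on g M1"
  proof (rule inj_onI)
    fix x y assume xy: "x \<in> M1" "y \<in> M1" "g x = g y"
    then have "\<psi> x = \<psi> y"
      using inj_onD[OF bij_betw_imp_inj_on[OF bij], of "\<psi> x" "\<psi> y"] by (simp add: f)
    then show "x = y" by (metis left_inverse)
  qed
  moreover have "\<psi> ` g ` M1 = \<psi> ` M2" using bij by (simp add: bij_betw_def image_image f)
  then have "g ` M1 = M2" by (simp only: inj_image_eq_iff[OF inj])
  ultimately have "bij_betw g M1 M2" by (simp add: bij_betw_def)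
  then show ?thesis by (rule that[OF eq ds im])
qed

lemma orth_compl_image:
  "orth_compl (submod K (\<psi> ` M)) (\<psi> ` N) = \<psi> ` {x \<in> M. \<forall>y\<in>N. ip x y = 0}"
  "orth_compl K (\<psi> ` N) = \<psi> ` {x. \<forall>y\<in>N. ip x y = 0}"
  by (auto simp: orth_compl_def carrier ip)

end

interpretation std: ell2_model std_module coord Ell2
proof
  show "mcarrier std_module = range coord"
    using type_definition.Rep_range[OF type_definition_ell2] by (auto simp: std_module_def)
qed (auto simp: std_module_def coord_inverse coord_simps ip.rep_eq)

interpretation double: ell2_model "hsum std_module std_module"
  "\<lambda>z. (coord (evens z), coord (odds z))" "\<lambda>w. to_evens (Ell2 (fst w)) + to_odds (Ell2 (snd w))"
proof
  show "mcarrier (hsum std_module std_module) = range (\<lambda>z. (coord (evens z), coord (odds z)))"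
  proof (intro equalityI subsetI)
    fix w assume "w \<in> mcarrier (hsum std_module std_module)"
    then obtain x y where w: "w = (coord x, coord y)" by (auto simp: hsum_def std.carrier)
    then show "w \<in> range (\<lambda>z. (coord (evens z), coord (odds z)))"
      by (intro image_eqI[of _ _ "to_evens x + to_odds y"])
        (simp_all add: split_linear)
  qed (auto simp: hsum_def std.carrier)
qed (simp_all add: coord_inverse hsum_def std.act std.add std.ip split_linear ip_split[symmetric])

section \<open>The operator matrix\<close>

text \<open>The matrix with rows (f, c) and (0, d), conjugated by the interleaving.\<close>

definition op_matrix :: "('a::unital_cstar_algebra ell2 \<Rightarrow> 'a ell2) \<Rightarrow> ('a ell2 \<Rightarrow> 'a ell2) \<Rightarrow>
    ('a ell2 \<Rightarrow> 'a ell2) \<Rightarrow> 'a ell2 \<Rightarrow> 'a ell2" where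
  "op_matrix f c d z = to_evens (f (evens z) + c (odds z)) + to_odds (d (odds z))"

lemma op_matrix_simps [simp]:
  "evens (op_matrix f c d z) = f (evens z) + c (odds z)"
  "odds (op_matrix f c d z) = d (odds z)"
  by (simp_all add: op_matrix_def split_linear)

lemma alin_op_matrix:
  assumes "alin f" "alin c" "alin d"
  shows "alin (op_matrix f c d)"
  unfolding op_matrix_def by (intro alin_plus alin_split_compose assms[THEN alin_compose] alin_id)

lemma eq_if_split_eq: "evens x = evens y \<Longrightarrow> odds x = odds y \<Longrightarrow> x = y"
  by (metis split_simps(5))

context ell2_model
begin

text \<open>Centrality of \<alpha> makes right multiplication by \<alpha> a module map, whose
  adjoint is right multiplication by the again central \<open>star \<alpha>\<close>.\<close>

lemma shift_op_elim:
  assumes F: "F \<in> adjointable_ops K K" and \<alpha>: "\<alpha> \<in> alg_center"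
  obtains g S where "adj g S" "\<And>y. F (\<psi> y) = \<psi> (g y + y \<odot> \<alpha>)" "\<And>y. shift_op K F \<alpha> (\<psi> y) = \<psi> (g y)"
proof -
  obtain G S where G: "adj G S" "\<And>y. F (\<psi> y) = \<psi> (G y)" using adjointable_elim[OF F] by metis
  have \<alpha>: "\<alpha> * x = x * \<alpha>" for x using \<alpha> by (simp add: alg_center_def)
  have sa: "star \<alpha> * x = x * star \<alpha>" for x
    using arg_cong[OF \<alpha>[of "star x"], of star] by (simp add: star_mult star_star)
  have al: "alin (\<lambda>y. y \<odot> \<alpha>)"
    by (simp add: alin_def bounded_bilinear.bounded_linear_left[OF bounded_bilinear_act] act_act \<alpha>)
  have aG: "alin G" using G(1) by (simp add: adj_def)
  have "adj (\<lambda>y. G y - y \<odot> \<alpha>) (\<lambda>y. S y - y \<odot> star \<alpha>)"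
    by (rule adj_if_ip_eq[OF alin_minus[OF aG al]])
      (use G(1) in \<open>simp add: adj_def ip_diff_left ip_diff_right ip_act_left ip_act_right sa\<close>)
  then show ?thesis
    by (rule that) (simp_all add: G(2) shift_op_def diff act)
qed

end

lemma shift_upper_triangular:
  assumes "\<And>y. F (coord y) = coord (f y + y \<odot> \<alpha>)" "\<And>y. D (coord y) = coord (d y + y \<odot> \<alpha>)"
    and "\<And>y. C (coord y) = coord (c y)"
  shows "shift_op (hsum std_module std_module) (upper_triangular F C D) \<alpha>
      (coord (evens z), coord (odds z)) =
    (coord (evens (op_matrix f c d z)), coord (odds (op_matrix f c d z)))"
proof -
  have "f (evens z) + evens z \<odot> \<alpha> + c (odds z) - evens z \<odot> \<alpha> = f (evens z) + c (odds z)" by simp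
  then show ?thesis
    by (simp add: shift_op_def upper_triangular_def assms hsum_def
        std.act[symmetric] std.add[symmetric] std.diff[symmetric])
qed

section \<open>A Fredholm completion forces the complements to be stably isomorphic\<close>

lemma dsum_commute: "dsum M N L \<Longrightarrow> dsum N M L"
  unfolding dsum_def by (auto simp: Int_commute) (metis add.commute)+

lemma smod_singleton_zero: "smod {0}"
  by (simp add: smod_def)

lemma fg_singleton_zero: "fg {0}"
  unfolding fg_def by (rule exI[of _ "{}"]) simp

lemma smod_vimage:
  assumes "alin e" "smod A"
  shows "smod {y. e y \<in> A}"
proof -
  have "closed (e -` A)"
    by (rule continuous_closed_vimage[OF smod_closed[OF assms(2)]])
      (rule linear_continuous_at[OF alin_bounded_linear[OF assms(1)]])
  then show ?thesis using assms(2)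
    by (simp add: smod_def alin_zero[OF assms(1)] alin_add[OF assms(1)] alin_act[OF assms(1)] vimage_def)
qed

lemma smod_Int: "smod A \<Longrightarrow> smod B \<Longrightarrow> smod (A \<inter> B)"
  by (simp add: smod_def closed_Int)

text \<open>An external direct sum realized inside \<open>ell2\<close> itself: it can be nested, and
  it is again a submodule of the standard module, as the witnesses in \<open>W_tilde\<close> have to
  be.\<close>

definition pair_mod :: "'a::unital_cstar_algebra ell2 set \<Rightarrow> 'a ell2 set \<Rightarrow> 'a ell2 set" where
  "pair_mod A B = {z. evens z \<in> A} \<inter> {z. odds z \<in> B}"

lemma mem_pair_mod: "z \<in> pair_mod A B \<longleftrightarrow> evens z \<in> A \<and> odds z \<in> B"
  by (simp add: pair_mod_def)

lemma smod_pair_mod: "smod A \<Longrightarrow> smod B \<Longrightarrow> smod (pair_mod A B)"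
  unfolding pair_mod_def by (intro smod_Int smod_vimage alin_split)

lemma pair_mod_eq: "pair_mod A B = {x + y |x y. x \<in> to_evens ` A \<and> y \<in> to_odds ` B}"
proof (intro equalityI subsetI)
  fix z assume "z \<in> pair_mod A B"
  then show "z \<in> {x + y |x y. x \<in> to_evens ` A \<and> y \<in> to_odds ` B}"
    by (intro CollectI exI[of _ "to_evens (evens z)"] exI[of _ "to_odds (odds z)"])
      (auto simp: mem_pair_mod)
qed (auto simp: mem_pair_mod split_linear)

lemma fg_pair_mod:
  assumes "smod A" "smod B" "fg A" "fg B"
  shows "fg (pair_mod A B)"
proof -
  have "0 \<in> to_evens ` A" "0 \<in> to_odds ` B"
    using imageI[OF smod_zero[OF assms(1)], of to_evens] imageI[OF smod_zero[OF assms(2)], of to_odds]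
    by simp_all
  then show ?thesis unfolding pair_mod_eq
    by (intro fg_sum fg_image alin_split assms)
qed

lemma dsum_pair_mod:
  assumes A: "dsum A A' A''" and B: "dsum B B' B''"
  shows "dsum (pair_mod A B) (pair_mod A' B') (pair_mod A'' B'')"
  unfolding dsum_def
proof (intro conjI)
  show "smod (pair_mod A B)" "smod (pair_mod A' B')" "smod (pair_mod A'' B'')"
    using A B by (auto simp: dsum_def intro: smod_pair_mod)
  show "pair_mod A B \<inter> pair_mod A' B' = {0}"
  proof (intro equalityI subsetI)
    fix z assume "z \<in> pair_mod A B \<inter> pair_mod A' B'"
    then have "evens z \<in> A \<inter> A'" "odds z \<in> B \<inter> B'" by (auto simp: mem_pair_mod)
    then have "evens z = 0" "odds z = 0" using A B unfolding dsum_def by blast+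
    then have "z = 0" using eq_if_split_eq[of z 0] by simp
    then show "z \<in> {0}" by simp
  next
    fix z :: "'a ell2" assume "z \<in> {0}"
    then show "z \<in> pair_mod A B \<inter> pair_mod A' B'" using A B
      by (auto simp: dsum_def mem_pair_mod smod_zero)
  qed
  have A'': "A'' = {x + y |x y. x \<in> A \<and> y \<in> A'}" and B'': "B'' = {x + y |x y. x \<in> B \<and> y \<in> B'}"
    using A B by (auto simp: dsum_def)
  show "pair_mod A'' B'' = {x + y |x y. x \<in> pair_mod A B \<and> y \<in> pair_mod A' B'}"
  proof (intro equalityI subsetI)
    fix z assume "z \<in> pair_mod A'' B''"
    then obtain a a' b b' where z: "evens z = a + a'" "odds z = b + b'" "a \<in> A" "a' \<in> A'" "b \<in> B" "b' \<in> B'"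
      unfolding mem_pair_mod A'' B'' by blast
    have "z = (to_evens a + to_odds b) + (to_evens a' + to_odds b')"
      by (rule eq_if_split_eq) (simp_all add: split_linear z)
    moreover have "to_evens a + to_odds b \<in> pair_mod A B" "to_evens a' + to_odds b' \<in> pair_mod A' B'"
      using z by (simp_all add: mem_pair_mod split_linear)
    ultimately show "z \<in> {x + y |x y. x \<in> pair_mod A B \<and> y \<in> pair_mod A' B'}" by blast
  next
    fix z assume "z \<in> {x + y |x y. x \<in> pair_mod A B \<and> y \<in> pair_mod A' B'}"
    then obtain x y where xy: "z = x + y" "x \<in> pair_mod A B" "y \<in> pair_mod A' B'" by blast
    then show "z \<in> pair_mod A'' B''" unfolding mem_pair_mod A'' B'' by (auto simp: split_linear)
  qed
qed

lemma dsum_zero_right: "smod A \<Longrightarrow> dsum A {0} A"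
  using smod_zero by (auto simp: dsum_def smod_singleton_zero)

lemma dsum_UNIV_intro:
  assumes "smod M" "smod N" "\<And>x. x \<in> M \<Longrightarrow> x \<in> N \<Longrightarrow> x = 0" "\<And>x. \<exists>m\<in>M. x - m \<in> N"
  shows "dsum M N UNIV"
  unfolding dsum_def
proof (intro conjI smod_UNIV assms(1,2))
  show "M \<inter> N = {0}" using assms smod_zero by blast
  have "x \<in> {x + y |x y. x \<in> M \<and> y \<in> N}" for x
  proof -
    obtain m where "m \<in> M" "x - m \<in> N" using assms(4) by blast
    then show ?thesis by (intro CollectI exI[of _ m] exI[of _ "x - m"]) simp
  qed
  then show "UNIV = {x + y |x y. x \<in> M \<and> y \<in> N}" by blast
qed

lemma dsum_Int_zero: "dsum M N L \<Longrightarrow> x \<in> M \<Longrightarrow> x \<in> N \<Longrightarrow> x = 0"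
  unfolding dsum_def by blast

lemma bij_image_eq: "bij_betw g M N \<Longrightarrow> x \<in> M \<Longrightarrow> g x \<in> N"
  by (auto simp: bij_betw_def)

lemma bij_zero:
  assumes "alin g" "bij_betw g M N" "smod M" "x \<in> M" "g x = 0"
  shows "x = 0"
  using assms smod_zero[OF assms(3)] alin_zero[OF assms(1)]
  by (auto simp: bij_betw_def inj_on_def)

text \<open>
  Bordering \<open>m\<close> with the complements gives the bijection
  \<open>(x, n, n') \<mapsto> (m x + (n, n'), pn' (odds x), pn (evens x))\<close> on \<open>\<ell>\<^sup>2(A) \<oplus> N2 \<oplus> N2'\<close>; its corner
  \<open>Z1 \<rightarrow> Z2\<close> is the bijective part of \<open>m\<close>, so the Schur complement
  \<open>N2 \<oplus> R1 \<oplus> N2' \<rightarrow> N1' \<oplus> R2 \<oplus> N1\<close> of this corner is bijective.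
\<close>

lemma schur_complement_bij:
  fixes f c d :: "'a::unital_cstar_algebra ell2 \<Rightarrow> 'a ell2"
  assumes f: "alin f" and c: "alin c" and d: "alin d"
    and F: "dsum M1 N1 UNIV" "dsum M2 N2 UNIV" "bij_betw f M1 M2"
    and D: "dsum M1' N1' UNIV" "dsum M2' N2' UNIV" "bij_betw d M1' M2'"
    and Z: "dsum Z1 R1 UNIV" "dsum Z2 R2 UNIV" "op_matrix f c d ` R1 \<subseteq> R2" "bij_betw (op_matrix f c d) Z1 Z2"
  shows "\<exists>g. alin g \<and> bij_betw g (pair_mod N2 (pair_mod R1 N2')) (pair_mod N1' (pair_mod R2 N1))"
proof -
  let ?m = "op_matrix f c d"
  have m: "alin ?m" by (rule alin_op_matrix[OF f c d])
  have sm: "smod M1" "smod N1" "smod M2" "smod N2" "smod M1'" "smod N1'" "smod M2'" "smod N2'"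
      "smod Z1" "smod R1" "smod Z2" "smod R2"
    using F D Z by (auto simp: dsum_def)
  obtain q where q: "alin q" "\<And>x. q x \<in> Z2" "\<And>x. x - q x \<in> R2" "\<And>x. x \<in> Z2 \<Longrightarrow> q x = x" "\<And>x. x \<in> R2 \<Longrightarrow> q x = 0"
    using dsum_projection[OF Z(2)] by metis
  obtain pz where pz: "\<And>x. pz x \<in> Z1" "\<And>x. x - pz x \<in> R1"
    using dsum_projection[OF Z(1)] by metis
  obtain pn where pn: "alin pn" "\<And>x. pn x \<in> N1" "\<And>x. x - pn x \<in> M1" "\<And>x. x \<in> N1 \<Longrightarrow> pn x = x" "\<And>x. x \<in> M1 \<Longrightarrow> pn x = 0"
    using dsum_projection[OF dsum_commute[OF F(1)]] by metis
  obtain pn' where pn': "alin pn'" "\<And>x. pn' x \<in> N1'" "\<And>x. x - pn' x \<in> M1'" "\<And>x. x \<in> N1' \<Longrightarrow> pn' x = x" "\<And>x. x \<in> M1' \<Longrightarrow> pn' x = 0"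
    using dsum_projection[OF dsum_commute[OF D(1)]] by metis
  obtain h where h: "alin h" "\<And>y. h y \<in> Z1" "\<And>y. ?m (h y) = q y" "\<And>x. x \<in> Z1 \<Longrightarrow> h (?m x) = x"
    using bij_inverse[OF m sm(9) sm(11) Z(4) q(1,2,4)] by metis
  \<comment> \<open>A point y encodes (n, r, n'), and v y is (n, n'). The Z1 component -h (v y) of x
    y is chosen so that w y = m (x y) + v y has no Z2 component; g collects w y and the N1' and N1
    components of x y.\<close>
  define v where "v y = to_evens (evens y) + to_odds (odds (odds y))" for y :: "'a ell2"
  define x where "x y = evens (odds y) - h (v y)" for y
  define w where "w y = ?m (x y) + v y" for y
  define g where "g y = to_evens (pn' (odds (x y))) + to_odds (to_evens (w y) + to_odds (pn (evens (x y))))" for y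
  have av: "alin v" unfolding v_def
    by (intro alin_plus alin_split_compose alin_id)
  have ax: "alin x" unfolding x_def
    by (intro alin_minus alin_split_compose alin_compose[OF h(1)] alin_id av)
  have aw: "alin w" unfolding w_def by (intro alin_plus alin_compose[OF m] ax av)
  have ag: "alin g" unfolding g_def
    by (intro alin_plus alin_split_compose alin_compose[OF pn(1)] alin_compose[OF pn'(1)] ax aw)
  have gs: "evens (g y) = pn' (odds (x y))" "evens (odds (g y)) = w y" "odds (odds (g y)) = pn (evens (x y))" for y
    by (simp_all add: g_def split_linear)
  have wR: "w y \<in> R2" if y: "evens (odds y) \<in> R1" for y
  proof -
    have "q (?m (evens (odds y))) = 0" using q(5) Z(3) y by blast
    then have "q (w y) = 0"
      by (simp add: w_def x_def alin_add[OF q(1)] alin_diff[OF q(1)] alin_diff[OF m] h(3) q(4)[OF q(2)])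
    then show ?thesis using q(3)[of "w y"] by simp
  qed
  have ws: "evens (w y) = f (evens (x y)) + c (odds (x y)) + evens y"
    "odds (w y) = d (odds (x y)) + odds (odds y)" for y
    by (simp_all add: w_def v_def split_linear)
  \<comment> \<open>Vanishing projections put the two components of x y into M1 and M1'. Back
    substitution then starts from the second row, where c does not occur.\<close>
  have ker: "y = 0" if y: "y \<in> pair_mod N2 (pair_mod R1 N2')" and g0: "g y = 0" for y
  proof -
    have 0: "pn' (odds (x y)) = 0" "w y = 0" "pn (evens (x y)) = 0"
      using gs[of y] by (simp_all add: g0)
    have x2: "odds (x y) \<in> M1'" and x1: "evens (x y) \<in> M1"
      using pn'(3)[of "odds (x y)"] pn(3)[of "evens (x y)"] by (simp_all add: 0)
    have w0: "f (evens (x y)) + c (odds (x y)) + evens y = 0" "d (odds (x y)) + odds (odds y) = 0"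
      using ws[of y] by (simp_all add: 0)
    have "d (odds (x y)) = 0 - odds (odds y)" using w0(2) by (simp add: eq_neg_iff_add_eq_0)
    moreover have "0 - odds (odds y) \<in> N2'"
      using y smod_diff[OF sm(8) smod_zero[OF sm(8)]] by (simp add: mem_pair_mod)
    ultimately have d0: "d (odds (x y)) = 0"
      using dsum_Int_zero[OF D(2) bij_image_eq[OF D(3) x2]] by simp
    then have o0: "odds (x y) = 0" by (rule bij_zero[OF d D(3) sm(5) x2])
    have "f (evens (x y)) = 0 - evens y" using w0(1) by (simp add: o0 alin_zero[OF c] eq_neg_iff_add_eq_0)
    moreover have "0 - evens y \<in> N2"
      using y smod_diff[OF sm(4) smod_zero[OF sm(4)]] by (simp add: mem_pair_mod)
    ultimately have f0: "f (evens (x y)) = 0"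
      using dsum_Int_zero[OF F(2) bij_image_eq[OF F(3) x1]] by simp
    then have e0: "evens (x y) = 0" by (rule bij_zero[OF f F(3) sm(1) x1])
    have yy: "odds (odds y) = 0" "evens y = 0"
      using w0 by (simp_all add: d0 f0 o0 alin_zero[OF c] alin_zero[OF d])
    have "x y = 0" by (rule eq_if_split_eq) (simp_all add: e0 o0)
    moreover have "v y = 0" by (simp add: v_def yy)
    ultimately have "evens (odds y) = 0" by (simp add: x_def alin_zero[OF h(1)])
    then have "odds y = 0" using eq_if_split_eq[of "odds y" 0] by (simp add: yy)
    then show "y = 0" using eq_if_split_eq[of y 0] by (simp add: yy)
  qed
  have sp: "smod (pair_mod N2 (pair_mod R1 N2'))" by (intro smod_pair_mod sm)
  have "inj_on g (pair_mod N2 (pair_mod R1 N2'))"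
  proof (rule inj_onI)
    fix y y' assume "y \<in> pair_mod N2 (pair_mod R1 N2')" "y' \<in> pair_mod N2 (pair_mod R1 N2')" "g y = g y'"
    then have "y - y' = 0" using ker[OF smod_diff[OF sp]] by (simp add: alin_diff[OF ag])
    then show "y = y'" by simp
  qed
  moreover have "g ` pair_mod N2 (pair_mod R1 N2') = pair_mod N1' (pair_mod R2 N1)"
  proof (intro equalityI subsetI)
    fix t assume "t \<in> g ` pair_mod N2 (pair_mod R1 N2')"
    then show "t \<in> pair_mod N1' (pair_mod R2 N1)"
      using pn(2) pn'(2) wR by (auto simp: mem_pair_mod gs)
  next
    fix t assume t: "t \<in> pair_mod N1' (pair_mod R2 N1)"
    define s where "s = evens (odds t)"
    have tm: "evens t \<in> N1'" "s \<in> R2" "odds (odds t) \<in> N1" using t by (auto simp: mem_pair_mod s_def)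
    \<comment> \<open>The rows are solved from the bottom: the prescribed N1' and N1 components are
      completed by a' in M1' and a in M1, and what is left over falls into N2' and N2.\<close>
    obtain u' where u': "u' \<in> M2'" "odds s - d (evens t) - u' \<in> N2'"
      using dsum_projection[OF D(2)] by metis
    obtain a' where a': "a' \<in> M1'" "d a' = u'" using D(3) u'(1) by (auto simp: bij_betw_def)
    define x2 where "x2 = evens t + a'"
    define n' where "n' = odds s - d x2"
    have n': "n' \<in> N2'" using u'(2) by (simp add: n'_def x2_def alin_add[OF d] a' algebra_simps)
    obtain u where u: "u \<in> M2" "evens s - c x2 - f (odds (odds t)) - u \<in> N2"
      using dsum_projection[OF F(2)] by metis
    obtain a where a: "a \<in> M1" "f a = u" using F(3) u(1) by (auto simp: bij_betw_def)
    define x1 where "x1 = odds (odds t) + a"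
    define n where "n = evens s - c x2 - f x1"
    have n: "n \<in> N2" using u(2) by (simp add: n_def x1_def alin_add[OF f] a algebra_simps)
    define xx where "xx = to_evens x1 + to_odds x2"
    define y where "y = to_evens n + to_odds (to_evens (xx - pz xx) + to_odds n')"
    have yc: "evens y = n" "evens (odds y) = xx - pz xx" "odds (odds y) = n'"
      by (simp_all add: y_def split_linear)
    have ms: "?m xx + v y = s"
      by (rule eq_if_split_eq) (simp_all add: v_def split_linear yc xx_def n_def n'_def)
    \<comment> \<open>Applying q to \<open>ms\<close> forces the Z1 component of xx to be -h (v y),
      so that xx is the point x y used by g.\<close>
    have "?m (pz xx) \<in> Z2" by (rule bij_image_eq[OF Z(4) pz(1)])
    moreover have "q (?m (xx - pz xx)) = 0" using Z(3) pz(2) q(5) by blast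
    ultimately have "q (?m xx) = ?m (pz xx)" by (simp add: alin_diff[OF m] alin_diff[OF q(1)] q(4))
    moreover have "q (?m xx) + q (v y) = 0" using arg_cong[OF ms, of q] q(5)[OF tm(2)] by (simp add: alin_add[OF q(1)])
    ultimately have "?m (pz xx + h (v y)) = 0" by (simp add: alin_add[OF m] h(3))
    then have "pz xx + h (v y) = 0"
      by (rule bij_zero[OF m Z(4) sm(9) smod_add[OF sm(9) pz(1) h(2)]])
    moreover have "x y = xx - (pz xx + h (v y))" unfolding x_def yc(2) by simp
    ultimately have xy: "x y = xx" by simp
    have "odds xx = x2" "evens xx = x1" by (simp_all add: xx_def split_linear)
    then have "g y = to_evens (evens t) + to_odds (to_evens s + to_odds (odds (odds t)))"
      using pn'(4)[OF tm(1)] pn'(5)[OF a'(1)] pn(4)[OF tm(3)] pn(5)[OF a(1)] ms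
      by (simp add: g_def xy x2_def x1_def w_def alin_add[OF pn(1)] alin_add[OF pn'(1)])
    also have "\<dots> = t" by (simp add: s_def)
    finally have "g y = t" .
    moreover have "y \<in> pair_mod N2 (pair_mod R1 N2')" using n n' pz(2) by (simp add: mem_pair_mod yc)
    ultimately show "t \<in> g ` pair_mod N2 (pair_mod R1 N2')" by blast
  qed
  ultimately show ?thesis using ag by (auto simp: bij_betw_def)
qed

lemma bij_to_evens: "smod N \<Longrightarrow> bij_betw to_evens N (pair_mod N {0})"
  unfolding bij_betw_def
proof
  show "inj_on to_evens N" by (metis inj_onI split_simps(1))
  show "to_evens ` N = pair_mod N {0}"
    by (auto simp: pair_mod_eq)
qed

theorem W_tilde_subset_ess_spectrum:
  fixes F D C :: "(nat \<Rightarrow> 'a::unital_cstar_algebra) \<Rightarrow> nat \<Rightarrow> 'a"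
  assumes F: "F \<in> adjointable_ops std_module std_module"
    and D: "D \<in> adjointable_ops std_module std_module"
    and C: "C \<in> adjointable_ops std_module std_module"
  shows "W_tilde F D \<subseteq> ess_spectrum (hsum std_module std_module) (upper_triangular F C D)"
proof
  fix \<alpha> assume W: "\<alpha> \<in> W_tilde F D"
  then have \<alpha>: "\<alpha> \<in> alg_center" by (simp add: W_tilde_def)
  obtain A1 B1 A2 B2 A1' B1' A2' B2' where
    dF: "diag_iso_decomp std_module (shift_op std_module F \<alpha>) A1 B1 A2 B2" and
    dD: "diag_iso_decomp std_module (shift_op std_module D \<alpha>) A1' B1' A2' B2'" and
    fg1: "finitely_generated (submod std_module B1)" and
    fg2: "finitely_generated (submod std_module B2')" and
    no: "\<not> (\<exists>P2 Q2 P1' Q1' L2 L1'.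
          direct_sum std_module P2 Q2 L2 \<and> direct_sum std_module P1' Q1' L1' \<and>
          isomorphic (submod std_module B2) (submod std_module P2) \<and>
          isomorphic (submod std_module B1') (submod std_module P1') \<and>
          finitely_generated (submod std_module Q2) \<and> finitely_generated (submod std_module Q1') \<and>
          isomorphic (submod std_module L2) (submod std_module L1'))"
    using W unfolding W_tilde_def by blast
  obtain f f' where f: "adj f f'" "\<And>y. F (coord y) = coord (f y + y \<odot> \<alpha>)"
      "\<And>y. shift_op std_module F \<alpha> (coord y) = coord (f y)"
    using std.shift_op_elim[OF F \<alpha>] by metis
  obtain d d' where d: "adj d d'" "\<And>y. D (coord y) = coord (d y + y \<odot> \<alpha>)"
      "\<And>y. shift_op std_module D \<alpha> (coord y) = coord (d y)"
    using std.shift_op_elim[OF D \<alpha>] by metis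
  obtain c c' where c: "adj c c'" "\<And>y. C (coord y) = coord (c y)"
    using std.adjointable_elim[OF C] by metis
  have al: "alin f" "alin c" "alin d" using f(1) c(1) d(1) by (auto simp: adj_def)
  obtain M1 N1 M2 N2 where N: "A1 = coord ` M1" "B1 = coord ` N1" "A2 = coord ` M2" "B2 = coord ` N2"
    and dsF: "dsum M1 N1 UNIV" "dsum M2 N2 UNIV" and "f ` M1 \<subseteq> M2" "f ` N1 \<subseteq> N2"
    and bf: "bij_betw f M1 M2"
    by (rule std.diag_iso_decomp_elim[OF dF f(3)])
  obtain M1' N1' M2' N2' where N': "A1' = coord ` M1'" "B1' = coord ` N1'" "A2' = coord ` M2'" "B2' = coord ` N2'"
    and dsD: "dsum M1' N1' UNIV" "dsum M2' N2' UNIV" and "d ` M1' \<subseteq> M2'" "d ` N1' \<subseteq> N2'"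
    and bd: "bij_betw d M1' M2'"
    by (rule std.diag_iso_decomp_elim[OF dD d(3)])
  have sm: "smod N1" "smod N2" "smod N1'" "smod N2'" using dsF dsD by (auto simp: dsum_def)
  have fgN: "fg N1" "fg N2'"
    using fg1 fg2 by (simp_all add: N N' std.finitely_generated_iff sm)
  have sh: "shift_op (hsum std_module std_module) (upper_triangular F C D) \<alpha>
      (coord (evens z), coord (odds z)) =
    (coord (evens (op_matrix f c d z)), coord (odds (op_matrix f c d z)))" for z
    by (rule shift_upper_triangular) (rule f(2) d(2) c(2))+
  have "\<not> fredholm (hsum std_module std_module)
      (shift_op (hsum std_module std_module) (upper_triangular F C D) \<alpha>)"
  proof
    assume "fredholm (hsum std_module std_module)
      (shift_op (hsum std_module std_module) (upper_triangular F C D) \<alpha>)"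
    then obtain Y1 S1 Y2 S2 where
      dM: "diag_iso_decomp (hsum std_module std_module)
        (shift_op (hsum std_module std_module) (upper_triangular F C D) \<alpha>) Y1 S1 Y2 S2" and
      fgS: "finitely_generated (submod (hsum std_module std_module) S1)"
        "finitely_generated (submod (hsum std_module std_module) S2)"
      unfolding fredholm_def by blast
    obtain Z1 R1 Z2 R2 where
      "Y1 = (\<lambda>z. (coord (evens z), coord (odds z))) ` Z1" and
      S1: "S1 = (\<lambda>z. (coord (evens z), coord (odds z))) ` R1" and
      "Y2 = (\<lambda>z. (coord (evens z), coord (odds z))) ` Z2" and
      S2: "S2 = (\<lambda>z. (coord (evens z), coord (odds z))) ` R2" and
      Z12: "dsum Z1 R1 UNIV" "dsum Z2 R2 UNIV" and "op_matrix f c d ` Z1 \<subseteq> Z2" and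
      Z34: "op_matrix f c d ` R1 \<subseteq> R2" "bij_betw (op_matrix f c d) Z1 Z2"
      by (rule double.diag_iso_decomp_elim[OF dM sh])
    note S = S1 S2 and Z = Z12 Z34
    have smR: "smod R1" "smod R2" using Z by (auto simp: dsum_def)
    have fgR: "fg R1" "fg R2"
      using fgS by (simp_all add: S double.finitely_generated_iff smR)
    obtain g where g: "alin g" "bij_betw g (pair_mod N2 (pair_mod R1 N2')) (pair_mod N1' (pair_mod R2 N1))"
      using schur_complement_bij[OF al dsF bf dsD bd Z] by blast
    have ds: "dsum (pair_mod A {0}) (pair_mod {0} B) (pair_mod A B)" if "smod A" "smod B"
      for A B :: "'a ell2 set"
      by (intro dsum_pair_mod dsum_zero_right that dsum_commute[OF dsum_zero_right])
    show False
    proof (rule no[THEN notE], intro exI conjI)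
      \<comment> \<open>The added summands R1, N2' and R2, N1 are finitely generated by the Fredholm
        property and by the choice of \<alpha>; N2 and N1' stand alone in the first slots.\<close>
      show "direct_sum std_module (coord ` pair_mod N2 {0}) (coord ` pair_mod {0} (pair_mod R1 N2'))
          (coord ` pair_mod N2 (pair_mod R1 N2'))"
        unfolding std.direct_sum_iff by (intro ds sm smR smod_pair_mod)
      show "direct_sum std_module (coord ` pair_mod N1' {0}) (coord ` pair_mod {0} (pair_mod R2 N1))
          (coord ` pair_mod N1' (pair_mod R2 N1))"
        unfolding std.direct_sum_iff by (intro ds sm smR smod_pair_mod)
      show "isomorphic (submod std_module B2) (submod std_module (coord ` pair_mod N2 {0}))"
        unfolding N
        by (intro std.isomorphic_intro[OF alin_split(1)] sm smod_pair_mod smod_singleton_zero bij_to_evens)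
      show "isomorphic (submod std_module B1') (submod std_module (coord ` pair_mod N1' {0}))"
        unfolding N'
        by (intro std.isomorphic_intro[OF alin_split(1)] sm smod_pair_mod smod_singleton_zero bij_to_evens)
      show "finitely_generated (submod std_module (coord ` pair_mod {0} (pair_mod R1 N2')))"
        by (subst std.finitely_generated_iff)
          (intro fg_pair_mod smod_pair_mod sm smR smod_singleton_zero fg_singleton_zero fgN fgR)+
      show "finitely_generated (submod std_module (coord ` pair_mod {0} (pair_mod R2 N1)))"
        by (subst std.finitely_generated_iff)
          (intro fg_pair_mod smod_pair_mod sm smR smod_singleton_zero fg_singleton_zero fgN fgR)+
      show "isomorphic (submod std_module (coord ` pair_mod N2 (pair_mod R1 N2')))
          (submod std_module (coord ` pair_mod N1' (pair_mod R2 N1)))"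
        by (intro std.isomorphic_intro[OF g(1) _ _ g(2)] smod_pair_mod sm smR)
    qed
  qed
  then show "\<alpha> \<in> ess_spectrum (hsum std_module std_module) (upper_triangular F C D)"
    using \<alpha> by (simp add: ess_spectrum_def)
qed

section \<open>Constructing a Fredholm completion\<close>

lemma bij_if_kernel_zero:
  assumes "alin g" "smod M" "\<And>x. x \<in> M \<Longrightarrow> g x = 0 \<Longrightarrow> x = 0" "\<And>x. x \<in> M \<Longrightarrow> g x \<in> N"
    "\<And>y. y \<in> N \<Longrightarrow> \<exists>x\<in>M. g x = y"
  shows "bij_betw g M N"
  unfolding bij_betw_def
proof
  show "inj_on g M"
  proof (rule inj_onI)
    fix x y assume "x \<in> M" "y \<in> M" "g x = g y"
    then have "x - y = 0"
      using assms(3)[OF smod_diff[OF assms(2)]] by (simp add: alin_diff[OF assms(1)])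
    then show "x = y" by simp
  qed
  show "g ` M = N" using assms(4,5) by blast
qed

text \<open>Gaussian elimination with the invertible corner \<open>M1 \<rightarrow> M2\<close> makes \<open>m\<close> diagonal.\<close>

lemma corner_bij_decomposition:
  assumes m: "alin m" and 1: "dsum M1 N1 UNIV" and 2: "dsum M2 N2 UNIV"
    and q: "alin q" "\<And>x. q x \<in> M2" "\<And>x. x - q x \<in> N2" "\<And>x. x \<in> M2 \<Longrightarrow> q x = x" "\<And>x. x \<in> N2 \<Longrightarrow> q x = 0"
    and bij: "bij_betw (\<lambda>x. q (m x)) M1 M2" and N1: "fg N1"
  obtains B A where "dsum M1 B UNIV" "dsum A N2 UNIV" "m ` B \<subseteq> N2" "bij_betw m M1 A" "fg B"
proof -
  have sm: "smod M1" "smod N1" "smod M2" "smod N2" using 1 2 by (auto simp: dsum_def)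
  let ?g = "\<lambda>x. q (m x)"
  have g: "alin ?g" by (rule alin_compose[OF q(1) m])
  obtain h where h: "alin h" "\<And>y. h y \<in> M1" "\<And>y. q (m (h y)) = q y" "\<And>x. x \<in> M1 \<Longrightarrow> h (q (m x)) = x"
      "\<And>y. h (q y) = h y"
    using bij_inverse[OF g sm(1,3) bij q(1,2,4)] by metis
  have kerM1: "x = 0" if "x \<in> M1" "q (m x) = 0" for x
    using h(4)[OF that(1)] by (simp add: that(2) alin_zero[OF h(1)])
  have hm: "h (m x) = x" if "x \<in> M1" for x using h(4)[OF that] h(5)[of "m x"] by simp
  have N2: "y \<in> N2" if "q y = 0" for y using q(3)[of y] that by simp
  \<comment> \<open>B is the kernel of q m and A is the image of M1 under m. The equation m (h y) =
    y presents A as a preimage of {0}, hence as closed.\<close>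
  define B where "B = {x. q (m x) \<in> {0}}"
  define A where "A = {y. m (h y) - y \<in> {0}}"
  have B: "smod B" unfolding B_def by (rule smod_vimage[OF g smod_singleton_zero])
  have A: "smod A" unfolding A_def
    by (rule smod_vimage[OF _ smod_singleton_zero])
      (intro alin_minus alin_compose[OF m] alin_compose[OF h(1)] alin_id)
  \<comment> \<open>1 - h m is the projection onto B along M1, so it maps the complement N1 of M1
    onto B.\<close>
  let ?u = "\<lambda>x. x - h (m x)"
  have u: "alin ?u" by (intro alin_minus alin_id alin_compose[OF h(1)] m)
  have uB: "?u x \<in> B" for x
    by (simp add: B_def alin_diff[OF m] alin_diff[OF q(1)] h(3))
  have "B = ?u ` N1"
  proof (intro equalityI subsetI)
    fix x assume x: "x \<in> B"
    then have ux: "?u x = x" using h(5)[of "m x"] by (simp add: B_def alin_zero[OF h(1)])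
    obtain a where a: "a \<in> M1" "x - a \<in> N1" using dsum_projection[OF 1] by metis
    have "?u (x - a) = ?u x" using hm[OF a(1)] by (simp add: alin_diff[OF m] alin_diff[OF h(1)])
    then show "x \<in> ?u ` N1" using ux a(2) by force
  qed (use uB in blast)
  then have "fg B" using fg_image[OF u N1] by simp
  moreover have "dsum M1 B UNIV"
  proof (rule dsum_UNIV_intro[OF sm(1) B])
    show "x = 0" if "x \<in> M1" "x \<in> B" for x using kerM1 that by (simp add: B_def)
    show "\<exists>a\<in>M1. x - a \<in> B" for x using h(2) uB by blast
  qed
  moreover have mA: "m x \<in> A" if "x \<in> M1" for x using hm[OF that] by (simp add: A_def)
  have "dsum A N2 UNIV"
  proof (rule dsum_UNIV_intro[OF A sm(4)])
    fix y assume "y \<in> A" "y \<in> N2"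
    then have "m (h y) = y" "q y = 0" using q(5) by (auto simp: A_def)
    then have "h y = 0" using kerM1[OF h(2), of y] by simp
    then show "y = 0" using \<open>m (h y) = y\<close> by (simp add: alin_zero[OF m])
  next
    fix x
    have "q (x - m (h x)) = 0" by (simp add: alin_diff[OF q(1)] h(3))
    then show "\<exists>a\<in>A. x - a \<in> N2" using mA[OF h(2)] N2 by blast
  qed
  moreover have "m ` B \<subseteq> N2" using N2 by (auto simp: B_def)
  moreover have "bij_betw m M1 A"
  proof (rule bij_if_kernel_zero[OF m sm(1) _ mA])
    show "x = 0" if "x \<in> M1" "m x = 0" for x using kerM1[OF that(1)] that(2) alin_zero[OF q(1)] by simp
    show "\<exists>x\<in>M1. m x = y" if "y \<in> A" for y using that h(2) by (auto simp: A_def)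
  qed
  ultimately show ?thesis using that by blast
qed

text \<open>Taking adjoints in e \<epsilon> = \<epsilon> gives \<epsilon> e = \<epsilon>. Hence e -
  \<epsilon> is a projection, and the two summands are its kernel and its range.\<close>

lemma subprojection:
  assumes e: "adj e e" and \<epsilon>: "adj \<epsilon> \<epsilon>" "\<And>x. \<epsilon> (\<epsilon> x) = \<epsilon> x" "\<And>x. e (\<epsilon> x) = \<epsilon> x" and ee: "\<And>x. e (e x) = e x"
  shows "\<And>x. \<epsilon> (e x) = \<epsilon> x"
    and "dsum {x. e x = \<epsilon> x} {x. e x = x \<and> \<epsilon> x = 0} UNIV"
proof -
  show \<epsilon>e: "\<epsilon> (e x) = \<epsilon> x" for x
    by (rule ell2_eq_if_ip_eq) (use e \<epsilon> in \<open>metis adj_def adj_sym\<close>)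
  have al: "alin e" "alin \<epsilon>" using e \<epsilon> by (auto simp: adj_def)
  have 1: "{x. e x = \<epsilon> x} = {x. e x - \<epsilon> x \<in> {0}}" by auto
  have 2: "{x. e x = x \<and> \<epsilon> x = 0} = {x. e x - x \<in> {0}} \<inter> {x. \<epsilon> x \<in> {0}}" by auto
  show "dsum {x. e x = \<epsilon> x} {x. e x = x \<and> \<epsilon> x = 0} UNIV"
  proof (rule dsum_UNIV_intro)
    show "smod {x. e x = \<epsilon> x}"
      unfolding 1 by (intro smod_vimage smod_singleton_zero alin_minus al)
    show "smod {x. e x = x \<and> \<epsilon> x = 0}"
      unfolding 2 by (intro smod_Int smod_vimage smod_singleton_zero alin_minus al alin_id)
    show "\<exists>m\<in>{x. e x = \<epsilon> x}. x - m \<in> {x. e x = x \<and> \<epsilon> x = 0}" for x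
      by (rule bexI[of _ "x - (e x - \<epsilon> x)"])
        (simp_all add: alin_diff[OF al(1)] alin_diff[OF al(2)] ee \<epsilon> \<epsilon>e)
  qed auto
qed

text \<open>In the application e projects onto N1' and g onto N2 of the statement, and U, with
  inverse W, matches the subprojections \<epsilon> of e and \<gamma> of g. Condition a) is the case
  \<gamma> = g, condition b) the case \<epsilon> = e. Between M1 (+) V1 and W2 (+) M2 the corner is
  invertible: f fills the kernel of g, U the range of \<gamma>, and d, on the kernel of e, fills M2.
  What remains is finitely generated.\<close>

lemma fredholm_completion:
  assumes f: "alin f" "dsum M1 N1 UNIV" "bij_betw f M1 {y. g y = 0}" "fg N1"
    and d: "alin d" "dsum M2 N2 UNIV" "\<And>x. d (e x) \<in> N2" "bij_betw d {y. e y = 0} M2" "fg N2"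
    and e: "adj e e" "\<And>x. e (e x) = e x" and g: "adj g g" "\<And>x. g (g x) = g x"
    and \<epsilon>: "adj \<epsilon> \<epsilon>" "\<And>x. \<epsilon> (\<epsilon> x) = \<epsilon> x" "\<And>x. e (\<epsilon> x) = \<epsilon> x" "fg {x. e x = x \<and> \<epsilon> x = 0}"
    and \<gamma>: "adj \<gamma> \<gamma>" "\<And>x. \<gamma> (\<gamma> x) = \<gamma> x" "\<And>x. g (\<gamma> x) = \<gamma> x" "fg {x. g x = x \<and> \<gamma> x = 0}"
    and U: "alin U" "\<And>x. W (U x) = \<epsilon> x" "\<And>y. U (W y) = \<gamma> y" "\<And>x. \<gamma> (U x) = U x"
      "\<And>x. U (\<epsilon> x) = U x" "\<And>y. \<epsilon> (W y) = W y" and W: "alin W"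
  shows "\<exists>A B A' B'. dsum A B UNIV \<and> dsum A' B' UNIV \<and> op_matrix f U d ` B \<subseteq> B' \<and>
    bij_betw (op_matrix f U d) A A' \<and> fg B \<and> fg B'"
proof -
  let ?m = "op_matrix f U d"
  define V1 where "V1 = {x. e x = \<epsilon> x}"
  define E where "E = {x. e x = x \<and> \<epsilon> x = 0}"
  define W2 where "W2 = {x. g x = \<gamma> x}"
  define G where "G = {x. g x = x \<and> \<gamma> x = 0}"
  have \<epsilon>e: "\<epsilon> (e x) = \<epsilon> x" for x by (rule subprojection(1)[OF e(1) \<epsilon>(1-3) e(2)])
  have \<gamma>g: "\<gamma> (g x) = \<gamma> x" for x by (rule subprojection(1)[OF g(1) \<gamma>(1-3) g(2)])
  have dV: "dsum V1 E UNIV" unfolding V1_def E_def by (rule subprojection(2)[OF e(1) \<epsilon>(1-3) e(2)])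
  have dW: "dsum W2 G UNIV" unfolding W2_def G_def by (rule subprojection(2)[OF g(1) \<gamma>(1-3) g(2)])
  have al: "alin e" "alin g" "alin \<epsilon>" "alin \<gamma>" using e g \<epsilon> \<gamma> by (auto simp: adj_def)
  have m: "alin ?m" by (rule alin_op_matrix[OF f(1) U(1) d(1)])
  have sm: "smod M1" "smod N1" "smod V1" "smod E" "smod M2" "smod N2" "smod W2" "smod G"
    using f(2) d(2) dV dW by (auto simp: dsum_def)
  have UU: "pair_mod UNIV UNIV = UNIV" by (auto simp: mem_pair_mod)
  have dA: "dsum (pair_mod M1 V1) (pair_mod N1 E) UNIV"
    using dsum_pair_mod[OF f(2) dV] by (simp add: UU)
  have dA': "dsum (pair_mod W2 M2) (pair_mod G N2) UNIV"
    using dsum_pair_mod[OF dW d(2)] by (simp add: UU)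
  obtain q where q: "alin q" "\<And>x. q x \<in> pair_mod W2 M2" "\<And>x. x - q x \<in> pair_mod G N2"
      "\<And>x. x \<in> pair_mod W2 M2 \<Longrightarrow> q x = x" "\<And>x. x \<in> pair_mod G N2 \<Longrightarrow> q x = 0"
    using dsum_projection[OF dA'] by metis
  have qI: "q x = a" if "a \<in> pair_mod W2 M2" "x - a \<in> pair_mod G N2" for x a
    using q(5)[OF that(2)] q(4)[OF that(1)] by (simp add: alin_diff[OF q(1)])
  have gU: "g (U x) = U x" for x using \<gamma>(3)[of "U x"] by (simp add: U(4))
  have eW: "e (W y) = W y" for y using \<epsilon>(3)[of "W y"] by (simp add: U(6))
  have gf: "g (f x) = 0" if "x \<in> M1" for x using bij_image_eq[OF f(3) that] by simp
  have \<gamma>f: "\<gamma> (f x) = 0" if "x \<in> M1" for x using \<gamma>g[of "f x"] by (simp add: gf[OF that] alin_zero[OF al(4)])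
  \<comment> \<open>d e takes values in N2, which q discards, so the second row keeps only d on the
    kernel of e.\<close>
  have corner: "q (?m z) = to_evens (f (evens z) + U (odds z)) + to_odds (d (odds z - e (odds z)))"
    if z: "z \<in> pair_mod M1 V1" for z
  proof (rule qI)
    have x1: "evens z \<in> M1" using z by (simp add: mem_pair_mod)
    have "d (odds z - e (odds z)) \<in> M2"
      by (rule bij_image_eq[OF d(4)]) (simp add: alin_diff[OF al(1)] e(2))
    then show "to_evens (f (evens z) + U (odds z)) + to_odds (d (odds z - e (odds z))) \<in> pair_mod W2 M2"
      by (simp add: mem_pair_mod split_linear W2_def alin_add[OF al(2)] alin_add[OF al(4)] gf[OF x1]
          \<gamma>f[OF x1] gU U(4))
    show "?m z - (to_evens (f (evens z) + U (odds z)) + to_odds (d (odds z - e (odds z)))) \<in> pair_mod G N2"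
      by (simp add: mem_pair_mod alin_split[THEN alin_diff] split_linear alin_diff[OF d(1)] d(3)
          smod_zero[OF sm(8)])
  qed
  have "bij_betw (\<lambda>x. q (?m x)) (pair_mod M1 V1) (pair_mod W2 M2)"
  proof (rule bij_if_kernel_zero[OF alin_compose[OF q(1) m]])
    show "smod (pair_mod M1 V1)" by (intro smod_pair_mod sm)
    fix z assume z: "z \<in> pair_mod M1 V1" and 0: "q (?m z) = 0"
    have x1: "evens z \<in> M1" and x2: "e (odds z) = \<epsilon> (odds z)" using z by (auto simp: mem_pair_mod V1_def)
    have a: "f (evens z) + U (odds z) = 0" "d (odds z - e (odds z)) = 0"
      using arg_cong[OF 0, of evens] arg_cong[OF 0, of odds] by (simp_all add: corner[OF z] split_linear)
    \<comment> \<open>f maps M1 into the kernel of g, and g fixes the values of U, so applying g to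
      the first row isolates U.\<close>
    have U0: "U (odds z) = 0" using arg_cong[OF a(1), of g] by (simp add: alin_add[OF al(2)] gf[OF x1] gU alin_zero[OF al(2)])
    then have e1: "evens z = 0" using a(1) bij_zero[OF f(1,3) sm(1) x1] by simp
    have e0: "e (odds z) = 0" using U(2)[of "odds z"] by (simp add: U0 x2 alin_zero[OF W])
    have "smod {y. e y = 0}" using smod_vimage[OF al(1) smod_singleton_zero] by simp
    then have "odds z = 0" by (rule bij_zero[OF d(1,4)]) (use a(2) e0 in simp_all)
    then show "z = 0" using e1 eq_if_split_eq[of z 0] by simp
  next
    fix t assume t: "t \<in> pair_mod W2 M2"
    have t1: "g (evens t) = \<gamma> (evens t)" and t2: "odds t \<in> M2" using t by (auto simp: mem_pair_mod W2_def)
    obtain v where v: "e v = 0" "d v = odds t" using d(4) t2 by (auto simp: bij_betw_def)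
    have "evens t - g (evens t) \<in> {y. g y = 0}" by (simp add: alin_diff[OF al(2)] g(2))
    then obtain x1 where x1: "x1 \<in> M1" "f x1 = evens t - g (evens t)"
      using f(3) unfolding bij_betw_def by (metis imageE)
    define x2 where "x2 = v + W (evens t)"
    have \<epsilon>v: "\<epsilon> v = 0" using \<epsilon>e[of v] by (simp add: v alin_zero[OF al(3)])
    have Uv: "U v = 0" using U(5)[of v] by (simp add: \<epsilon>v alin_zero[OF U(1)])
    have ex: "e x2 = W (evens t)" by (simp add: x2_def alin_add[OF al(1)] v eW)
    have "\<epsilon> x2 = W (evens t)" by (simp add: x2_def alin_add[OF al(3)] \<epsilon>v U(6))
    then have z: "to_evens x1 + to_odds x2 \<in> pair_mod M1 V1"
      by (simp add: mem_pair_mod split_linear x1 V1_def ex)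
    have Ux: "U x2 = g (evens t)" by (simp add: x2_def alin_add[OF U(1)] Uv U(3) t1)
    have dx: "d (x2 - e x2) = odds t" unfolding ex by (simp add: x2_def v)
    have "q (?m (to_evens x1 + to_odds x2)) = t"
      unfolding corner[OF z] by (simp add: split_linear x1 Ux dx)
    then show "\<exists>x\<in>pair_mod M1 V1. q (?m x) = t" using z by blast
  qed (rule q(2))
  moreover have "fg (pair_mod N1 E)"
    by (rule fg_pair_mod[OF sm(2,4) f(4)]) (use \<epsilon>(4) in \<open>simp add: E_def\<close>)
  ultimately obtain B A where "dsum (pair_mod M1 V1) B UNIV" "dsum A (pair_mod G N2) UNIV"
      "?m ` B \<subseteq> pair_mod G N2" "bij_betw ?m (pair_mod M1 V1) A" "fg B"
    using corner_bij_decomposition[OF m dA dA' q] by blast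
  moreover have "fg (pair_mod G N2)"
    by (rule fg_pair_mod[OF sm(8,6) _ d(5)]) (use \<gamma>(4) in \<open>simp add: G_def\<close>)
  ultimately show ?thesis by blast
qed

section \<open>Orthogonal projections and cofinite embeddings\<close>

definition orth :: "'a::unital_cstar_algebra ell2 set \<Rightarrow> 'a ell2 set" where
  "orth N = {x. \<forall>y\<in>N. ip x y = 0}"

lemma mem_orth: "x \<in> orth N \<longleftrightarrow> (\<forall>y\<in>N. ip x y = 0)"
  by (simp add: orth_def)

lemma orthogonal_projection:
  assumes "dsum N (orth N) UNIV"
  obtains p where "adj p p" "\<And>x. p x \<in> N" "\<And>x. x \<in> N \<Longrightarrow> p x = x" "\<And>x. p (p x) = p x"
    "\<And>x. x \<in> orth N \<longleftrightarrow> p x = 0"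
proof -
  obtain p where p: "alin p" "\<And>x. p x \<in> N" "\<And>x. x - p x \<in> orth N" "\<And>x. x \<in> N \<Longrightarrow> p x = x"
      "\<And>x. x \<in> orth N \<Longrightarrow> p x = 0"
    by (rule dsum_projection[OF assms]) (rule that; assumption)
  have o: "ip (x - p x) (p y) = 0" for x y using p(3)[of x] p(2)[of y] by (simp add: mem_orth)
  have o': "ip (p x) (y - p y) = 0" for x y using arg_cong[OF o[of y x], of star] by (simp add: star_ip)
  have ad: "ip (p x) y = ip x (p y)" for x y
    using o[of x y] o'[of x y] by (simp add: ip_diff_left ip_diff_right)
  have "x \<in> orth N" if "p x = 0" for x using p(3)[of x] that by simp
  then show ?thesis using that[OF adj_if_ip_eq[OF p(1) ad] p(2,4)] p(2,4,5) by blast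
qed

text \<open>t may have a kernel, so a convergent sequence t (z n) does not control z n. It controls
  a (z n), on which t takes the same values.\<close>

lemma smod_range_if_bounded_below:
  assumes t: "alin t" and a: "alin a" and ta: "\<And>x. t (a x) = t x" and C: "\<And>x. norm (a x) \<le> C * norm (t x)"
  shows "smod (range t)"
proof (rule smod_range[OF t])
  show "closed (range t)" unfolding closure_subset_eq[symmetric]
  proof
    fix y assume "y \<in> closure (range t)"
    then obtain z where z: "(\<lambda>n. t (z n)) \<longlonglongrightarrow> y" by (rule closure_rangeE)
    have "Cauchy (\<lambda>n. a (z n))" unfolding Cauchy_iff
    proof (intro allI impI)
      fix e :: real assume e: "0 < e"
      have C1: "0 < \<bar>C\<bar> + 1" by simp
      obtain M where M: "\<forall>m\<ge>M. \<forall>n\<ge>M. norm (t (z m) - t (z n)) < e / (\<bar>C\<bar> + 1)"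
        using LIMSEQ_imp_Cauchy[OF z] e C1 unfolding Cauchy_iff by (meson divide_pos_pos)
      have "norm (a (z m) - a (z n)) < e" if "m \<ge> M" "n \<ge> M" for m n
      proof -
        have "norm (a (z m) - a (z n)) \<le> C * norm (t (z m) - t (z n))"
          using C[of "z m - z n"] by (simp add: alin_diff[OF a] alin_diff[OF t])
        also have "\<dots> \<le> (\<bar>C\<bar> + 1) * norm (t (z m) - t (z n))" by (rule mult_right_mono) auto
        also have "\<dots> < (\<bar>C\<bar> + 1) * (e / (\<bar>C\<bar> + 1))"
          by (rule mult_strict_left_mono) (use M that in auto)
        also have "\<dots> = e" using C1 by simp
        finally show ?thesis .
      qed
      then show "\<exists>M. \<forall>m\<ge>M. \<forall>n\<ge>M. norm (a (z m) - a (z n)) < e" by blast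
    qed
    then obtain x where "(\<lambda>n. a (z n)) \<longlonglongrightarrow> x" using Cauchy_convergent convergent_def by blast
    from alin_tendsto[OF t this] have "(\<lambda>n. t (z n)) \<longlonglongrightarrow> t x" by (simp add: ta)
    then have "y = t x" using z LIMSEQ_unique by blast
    then show "y \<in> range t" by blast
  qed
qed

text \<open>J is meaningful on N only; composing it with a, which maps into N, gives a map on the
  whole space.\<close>

lemma (in ell2_model) bounded_module_map_extend:
  assumes J: "bounded_module_map (submod K (\<psi> ` N)) (submod K A) J" and A: "A \<subseteq> mcarrier K"
    and a: "alin a" "\<And>x. a x \<in> N"
  obtains j where "alin j" "\<And>x. \<psi> (j x) = J (\<psi> (a x))" "\<And>x. \<psi> (j x) \<in> A"
proof -
  define j where "j x = \<phi> (J (\<psi> (a x)))" for x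
  have JA: "J (\<psi> (a x)) \<in> A" for x using J a(2) by (auto simp: bounded_module_map_def)
  have j: "\<psi> (j x) = J (\<psi> (a x))" for x
  proof -
    obtain y where "J (\<psi> (a x)) = \<psi> y" using JA[of x] A carrier by auto
    then show ?thesis by (simp add: j_def left_inverse)
  qed
  have "\<exists>B. \<forall>x\<in>N. mnorm K (J (\<psi> x)) \<le> B * mnorm K (\<psi> x)"
    using J by (simp add: bounded_module_map_def mnorm_submod)
  then obtain B where B: "\<And>x. x \<in> N \<Longrightarrow> mnorm K (J (\<psi> x)) \<le> B * mnorm K (\<psi> x)" by blast
  have Jadd: "J (\<psi> x + \<psi> y) = J (\<psi> x) + J (\<psi> y)" if "x \<in> N" "y \<in> N" for x y
    using J that by (simp add: bounded_module_map_def)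
  have Jact: "J (mact K (\<psi> x) b) = mact K (J (\<psi> x)) b" if "x \<in> N" for x b
    using J that by (simp add: bounded_module_map_def)
  have jadd: "j (x + y) = j x + j y" for x y
  proof -
    have "\<psi> (j (x + y)) = \<psi> (j x + j y)"
      by (simp add: j add alin_add[OF a(1)] Jadd[OF a(2) a(2)])
    then show ?thesis by (metis left_inverse)
  qed
  have jact: "j (x \<odot> b) = j x \<odot> b" for x b
  proof -
    have "\<psi> (j (x \<odot> b)) = \<psi> (j x \<odot> b)"
      by (simp add: j act alin_act[OF a(1)] Jact[OF a(2)])
    then show ?thesis by (metis left_inverse)
  qed
  obtain C where C: "0 < C" "\<And>x. norm (a x) \<le> norm x * C" using alin_bound[OF a(1)] by blast
  have "norm (j x) \<le> norm x * (C * \<bar>B\<bar>)" for x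
  proof -
    have "norm (j x) \<le> B * norm (a x)" using B[OF a(2), of x] by (simp add: mnorm flip: j)
    also have "\<dots> \<le> \<bar>B\<bar> * (norm x * C)" by (intro mult_mono C) auto
    finally show ?thesis by (simp add: mult_ac)
  qed
  then have "bounded_linear j"
    by (intro bounded_linear_intro[where K="C * \<bar>B\<bar>"]) (simp_all add: jadd jact flip: act_of_real)
  then have "alin j" by (simp add: alin_def jact)
  then show ?thesis using that j JA by simp
qed

lemma image_eq_range_if_absorbs:
  assumes "\<And>x. j (a x) = j x" "\<And>x. a x \<in> N"
  shows "j ` N = range j"
proof
  show "range j \<subseteq> j ` N"
  proof clarify
    fix x show "j x \<in> j ` N" using imageI[OF assms(2)[of x], of j] by (simp add: assms(1))
  qed
qed blast

text \<open>j and t extend J and the isomorphism T and have the same range. The lower bound of t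
  makes it closed, the adjoint of j makes it an orthogonal summand with projection i, and
  \<open>adjointable_iso\<close> is applied to t and its inverse h.\<close>

lemma embeds_cofinitely_elim:
  fixes N N' :: "'a::unital_cstar_algebra ell2 set"
  assumes emb: "embeds_cofinitely (coord ` N) (coord ` N')" and smN: "smod N" "smod N'"
    and a: "adj a a" "\<And>x. a x \<in> N" "\<And>x. x \<in> N \<Longrightarrow> a x = x"
    and b: "adj b b" "\<And>x. b x \<in> N'" "\<And>x. x \<in> N' \<Longrightarrow> b x = x"
  obtains i U W where "adj i i" "\<And>x. i (i x) = i x" "\<And>x. b (i x) = i x" "fg {x. b x = x \<and> i x = 0}"
    "adj U W" "\<And>x. W (U x) = a x" "\<And>y. U (W y) = i y" "\<And>x. i (U x) = U x" "\<And>x. U (a x) = U x"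
    "\<And>y. a (W y) = W y" "\<And>y. W (i y) = W y"
proof -
  have al: "alin a" "alin b" using a b by (auto simp: adj_def)
  obtain J where J: "J \<in> adjointable_ops (submod std_module (coord ` N)) (submod std_module (coord ` N'))"
    and iso: "isomorphic (submod std_module (coord ` N)) (submod std_module (J ` coord ` N))"
    and fgc: "finitely_generated (submod std_module (orth_compl (submod std_module (coord ` N')) (J ` coord ` N)))"
    using emb unfolding embeds_cofinitely_def by blast
  have sub: "coord ` M \<subseteq> mcarrier std_module" for M :: "'a ell2 set" by (auto simp: std.carrier)
  obtain j where j: "alin j" "\<And>x. coord (j x) = J (coord (a x))" "\<And>x. coord (j x) \<in> coord ` N'"
    using std.bounded_module_map_extend[of N "coord ` N'" J, OF _ sub al(1) a(2)] J
    unfolding adjointable_ops_def by blast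
  have jN': "j x \<in> N'" for x using j(3)[of x] by (simp add: inj_image_mem_iff[OF std.inj])
  obtain S where S: "\<forall>y\<in>coord ` N'. S y \<in> coord ` N \<and>
      (\<forall>x\<in>coord ` N. mip std_module (J x) y = mip std_module x (S y))"
    using J unfolding adjointable_ops_def by auto
  have JN: "J ` coord ` N = coord ` range j"
  proof -
    have "J ` coord ` N = coord ` j ` N" by (auto simp: image_image j(2) a(3))
    moreover have "coord (j (a x)) = coord (j x)" for x by (simp add: j(2) a(3)[OF a(2)])
    then have "j ` N = range j" by (intro image_eq_range_if_absorbs[of j a] a(2)) (simp add: coord_inject)
    ultimately show ?thesis by simp
  qed
  have adj_j: "adj j (\<lambda>y. Ell2 (S (coord (b y))))"
  proof (rule adj_if_ip_eq[OF j(1)])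
    fix x y
    obtain s where s: "s \<in> N" "S (coord (b y)) = coord s" using S b(2) by blast
    have "ip (j x) y = ip (b (j x)) y" by (simp add: b(3) jN')
    also have "\<dots> = ip (j x) (b y)" using b(1) by (simp add: adj_def)
    also have "\<dots> = mip std_module (J (coord (a x))) (coord (b y))" by (simp add: std.ip flip: j(2))
    also have "\<dots> = mip std_module (coord (a x)) (coord s)" using S a(2) b(2) s(2) by (metis imageI)
    also have "\<dots> = ip x (a s)" using a(1) by (simp add: std.ip adj_def)
    finally show "ip (j x) y = ip x (Ell2 (S (coord (b y))))" by (simp add: s a(3) coord_inverse)
  qed
  obtain T where T: "module_iso (submod std_module (coord ` N)) (submod std_module (coord ` range j)) T"
    using iso unfolding isomorphic_def JN by blast
  obtain t where t: "alin t" "\<And>x. coord (t x) = T (coord (a x))" "\<And>x. coord (t x) \<in> coord ` range j"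
    using std.bounded_module_map_extend[of N "coord ` range j" T, OF _ sub al(1) a(2)] T
    unfolding module_iso_def by blast
  have "coord (t (a x)) = coord (t x)" for x by (simp add: t(2) a(3)[OF a(2)])
  then have ta: "t (a x) = t x" for x by (simp add: coord_inject)
  have bijT: "bij_betw T (coord ` N) (coord ` range j)" using T by (simp add: module_iso_def)
  have "coord ` t ` N = coord ` range j"
    using bijT by (simp add: bij_betw_def image_image t(2) a(3) cong: image_cong)
  then have tN: "t ` N = range j" by (simp only: inj_image_eq_iff[OF std.inj])
  have "inj_on t N"
  proof (rule inj_onI)
    fix x y assume xy: "x \<in> N" "y \<in> N" "t x = t y"
    then have "T (coord x) = T (coord y)" using t(2)[of x] t(2)[of y] by (simp add: a(3))
    then have "coord x = coord y" using bijT xy by (meson bij_betw_imp_inj_on imageI inj_onD)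
    then show "x = y" by (simp add: coord_inject)
  qed
  then have bt: "bij_betw t N (range j)" by (simp add: bij_betw_def tN)
  have rt: "range t = range j" using image_eq_range_if_absorbs[of t a N, OF ta a(2)] tN by simp
  have "\<exists>C. \<forall>x\<in>coord ` range j. mnorm std_module (inv_into (coord ` N) T x) \<le> C * mnorm std_module x"
    using T unfolding module_iso_def bounded_module_map_def by (simp add: std.mnorm_submod)
  then obtain C where
    C: "\<forall>x\<in>coord ` range j. mnorm std_module (inv_into (coord ` N) T x) \<le> C * mnorm std_module x" ..
  have "norm (a x) \<le> C * norm (t x)" for x
  proof -
    have "inv_into (coord ` N) T (coord (t x)) = coord (a x)"
      unfolding t(2) by (rule inv_into_f_f[OF bij_betw_imp_inj_on[OF bijT]]) (use a(2) in blast)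
    then show ?thesis using bspec[OF C t(3)[of x]] by (simp add: std.mnorm)
  qed
  from smod_range_if_bounded_below[OF t(1) al(1) ta this] have I: "smod (range j)" by (simp add: rt)
  have so: "smod (orth (range j))"
  proof -
    have aS: "alin (\<lambda>y. Ell2 (S (coord (b y))))" using adj_j by (simp add: adj_def)
    \<comment> \<open>The orthogonal complement of a range is the kernel of the adjoint, hence
      closed.\<close>
    have eq: "orth (range j) = {y. Ell2 (S (coord (b y))) \<in> {0}}"
    proof -
      have "y \<in> orth (range j) \<longleftrightarrow> (\<forall>x. ip (Ell2 (S (coord (b y)))) x = 0)" for y
        using adj_sym[OF adj_j] by (auto simp: adj_def mem_orth)
      moreover have "(\<forall>x. ip z x = 0) \<longleftrightarrow> z = 0" for z :: "'a ell2"
        by (metis ip_self_zero_iff ip_zero_left)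
      ultimately show ?thesis by auto
    qed
    show ?thesis unfolding eq by (rule smod_vimage[OF aS smod_singleton_zero])
  qed
  have "dsum (range j) (orth (range j)) UNIV"
  proof (rule dsum_UNIV_intro[OF I so])
    show "x = 0" if "x \<in> range j" "x \<in> orth (range j)" for x
      using that ip_self_zero_iff unfolding mem_orth by blast
    show "\<exists>m\<in>range j. x - m \<in> orth (range j)" for x
      using closed_range_orthogonal_projection[OF adj_j smod_closed[OF I], of x] unfolding mem_orth .
  qed
  then obtain i where i: "adj i i" "\<And>x. i x \<in> range j" "\<And>x. x \<in> range j \<Longrightarrow> i x = x"
      "\<And>x. i (i x) = i x" "\<And>x. x \<in> orth (range j) \<longleftrightarrow> i x = 0"
    by (rule orthogonal_projection) (rule that; assumption)
  have ai: "alin i" using i(1) by (simp add: adj_def)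
  have bi: "b (i x) = i x" for x
  proof -
    have "i x \<in> N'" using subsetD[OF image_subsetI[of UNIV j N', OF jN'] i(2)] .
    then show ?thesis by (rule b(3))
  qed
  obtain h where h: "alin h" "\<And>y. h y \<in> N" "\<And>y. t (h y) = i y" "\<And>x. x \<in> N \<Longrightarrow> h (t x) = x"
    using bij_inverse[OF t(1) smN(1) I bt ai i(2,3)] by metis
  have "{x \<in> N'. \<forall>y\<in>range j. ip x y = 0} = {x. b x = x \<and> i x = 0}"
    using i(5)[unfolded mem_orth] b(2,3) by (auto, metis)
  moreover have "smod {x. b x = x \<and> i x = 0}"
  proof -
    have "{x. b x = x \<and> i x = 0} = {x. b x - x \<in> {0}} \<inter> {x. i x \<in> {0}}" by auto
    then show ?thesis by (simp only:) (intro smod_Int smod_vimage smod_singleton_zero alin_minus al ai alin_id)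
  qed
  ultimately have fgi: "fg {x. b x = x \<and> i x = 0}"
    using fgc by (simp add: JN std.orth_compl_image std.finitely_generated_iff)
  show ?thesis
  proof (rule adjointable_iso[of a i t h])
    show "a (a x) = a x" for x by (simp add: a)
    show "i (t (a x)) = t (a x)" for x using i(3) rt by blast
    show "h (t (a x)) = a x" for x by (rule h(4)[OF a(2)])
    show "a (h (i y)) = h (i y)" for y by (rule a(3)[OF h(2)])
    show "t (h (i y)) = i y" for y by (simp add: h(3) i(4))
    fix U W assume "adj U W" "\<And>x. W (U x) = a x" "\<And>y. U (W y) = i y"
    "\<And>x. i (U x) = U x" "\<And>x. U (a x) = U x" "\<And>y. a (W y) = W y" "\<And>y. W (i y) = W y"
    then show thesis using that[of i U W] i(1,4) bi fgi by blast
  qed (fact a i t h)+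
qed

lemma adj_op_matrix:
  assumes "adj f f'" "adj c c'" "adj d d'"
  shows "adj (op_matrix f c d) (\<lambda>z. to_evens (f' (evens z)) + to_odds (c' (evens z) + d' (odds z)))"
proof (rule adj_if_ip_eq[OF alin_op_matrix])
  show "ip (op_matrix f c d x) y = ip x (to_evens (f' (evens y)) + to_odds (c' (evens y) + d' (odds y)))" for x y
    unfolding ip_split[of "op_matrix f c d x"] ip_split[of x]
    using assms by (simp add: split_linear adj_def ip_add_left ip_add_right)
qed (use assms in \<open>simp_all add: adj_def\<close>)

lemma fredholm_upper_triangular:
  fixes F D C :: "(nat \<Rightarrow> 'a::unital_cstar_algebra) \<Rightarrow> nat \<Rightarrow> 'a"
  assumes f: "adj f f'" "\<And>y. F (coord y) = coord (f y + y \<odot> \<alpha>)"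
    and d: "adj d d'" "\<And>y. D (coord y) = coord (d y + y \<odot> \<alpha>)"
    and c: "adj c c'" "\<And>y. C (coord y) = coord (c y)"
    and ex: "\<exists>A B A' B'. dsum A B UNIV \<and> dsum A' B' UNIV \<and> op_matrix f c d ` B \<subseteq> B' \<and>
      bij_betw (op_matrix f c d) A A' \<and> fg B \<and> fg B'"
  shows "fredholm (hsum std_module std_module)
    (shift_op (hsum std_module std_module) (upper_triangular F C D) \<alpha>)"
proof -
  obtain A B A' B' where d: "dsum A B UNIV" "dsum A' B' UNIV" "op_matrix f c d ` B \<subseteq> B'"
      "bij_betw (op_matrix f c d) A A'" and fgB: "fg B" "fg B'"
    using ex by blast
  have sm: "smod B" "smod B'" using d by (auto simp: dsum_def)
  have sh: "shift_op (hsum std_module std_module) (upper_triangular F C D) \<alpha>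
      (coord (evens z), coord (odds z)) =
    (coord (evens (op_matrix f c d z)), coord (odds (op_matrix f c d z)))" for z
    by (rule shift_upper_triangular) (rule f(2) assms(4) c(2))+
  note am = adj_op_matrix[OF f(1) c(1) assms(3)]
  then have al: "alin (op_matrix f c d)" by (simp add: adj_def)
  show ?thesis
    unfolding fredholm_def
    using double.adjointable_intro[OF am sh] double.diag_iso_decomp_intro[OF al d sh]
      double.finitely_generated_iff[OF sm(1)] double.finitely_generated_iff[OF sm(2)] fgB by blast
qed

theorem Inter_ess_spectrum_subset_W:
  fixes F D :: "(nat \<Rightarrow> 'a::unital_cstar_algebra) \<Rightarrow> nat \<Rightarrow> 'a"
  assumes F: "F \<in> adjointable_ops std_module std_module"
    and D: "D \<in> adjointable_ops std_module std_module"
  shows "(\<Inter>C \<in> adjointable_ops std_module std_module.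
        ess_spectrum (hsum std_module std_module) (upper_triangular F C D)) \<subseteq> W_set F D"
proof
  fix \<alpha> assume all: "\<alpha> \<in> (\<Inter>C \<in> adjointable_ops std_module std_module.
        ess_spectrum (hsum std_module std_module) (upper_triangular F C D))"
  have C_ops: "(\<lambda>v. coord (c (Ell2 v))) \<in> adjointable_ops std_module std_module"
    if "adj c c'" for c c' :: "'a ell2 \<Rightarrow> 'a ell2"
    by (rule std.adjointable_intro[OF that]) (simp add: coord_inverse)
  have not_fredholm: "\<not> fredholm (hsum std_module std_module)
      (shift_op (hsum std_module std_module) (upper_triangular F (\<lambda>v. coord (c (Ell2 v))) D) \<alpha>)"
    and \<alpha>: "\<alpha> \<in> alg_center" if "adj c c'" for c c'
    using all C_ops[OF that] by (auto simp: ess_spectrum_def)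
  \<comment> \<open>Membership in the intersection yields centrality of \<alpha> only through some
    adjointable C; the zero operator provides one.\<close>
  have "adj (\<lambda>x. 0) (\<lambda>x. 0 :: 'a ell2)" by (simp add: adj_def alin_const_zero)
  from \<alpha>[OF this] have \<alpha>: "\<alpha> \<in> alg_center" .
  have False if
    dF: "diag_iso_decomp std_module (shift_op std_module F \<alpha>) A1 B1 (orth_compl std_module B2) B2" and
    dD: "diag_iso_decomp std_module (shift_op std_module D \<alpha>) (orth_compl std_module B1') B1' A2' B2'" and
    fg1: "finitely_generated (submod std_module B1)" and
    fg2: "finitely_generated (submod std_module B2')" and
    emb: "embeds_cofinitely B2 B1' \<or> embeds_cofinitely B1' B2"
    for A1 B1 B2 B1' A2' B2'
  proof -
    obtain f f' where f: "adj f f'" "\<And>y. F (coord y) = coord (f y + y \<odot> \<alpha>)"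
        "\<And>y. shift_op std_module F \<alpha> (coord y) = coord (f y)"
      using std.shift_op_elim[OF F \<alpha>] by metis
    obtain d d' where d: "adj d d'" "\<And>y. D (coord y) = coord (d y + y \<odot> \<alpha>)"
        "\<And>y. shift_op std_module D \<alpha> (coord y) = coord (d y)"
      using std.shift_op_elim[OF D \<alpha>] by metis
    have al: "alin f" "alin d" using f(1) d(1) by (auto simp: adj_def)
    obtain M1 N1 M2 N2 where N: "A1 = coord ` M1" "B1 = coord ` N1"
        "orth_compl std_module B2 = coord ` M2" "B2 = coord ` N2"
      and dsF: "dsum M1 N1 UNIV" "dsum M2 N2 UNIV" and fM: "f ` M1 \<subseteq> M2" "f ` N1 \<subseteq> N2"
      and bf: "bij_betw f M1 M2"
      by (rule std.diag_iso_decomp_elim[OF dF f(3)])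
    obtain M1' N1' M2' N2' where N': "orth_compl std_module B1' = coord ` M1'" "B1' = coord ` N1'"
        "A2' = coord ` M2'" "B2' = coord ` N2'"
      and dsD: "dsum M1' N1' UNIV" "dsum M2' N2' UNIV" and dM: "d ` M1' \<subseteq> M2'" "d ` N1' \<subseteq> N2'"
      and bd: "bij_betw d M1' M2'"
      by (rule std.diag_iso_decomp_elim[OF dD d(3)])
    have sm: "smod N1" "smod N2" "smod N1'" "smod N2'" using dsF dsD by (auto simp: dsum_def)
    have fgN: "fg N1" "fg N2'"
      using fg1 fg2 by (simp_all add: N N' std.finitely_generated_iff sm)
    have "coord ` M2 = coord ` orth N2" "coord ` M1' = coord ` orth N1'"
      using N(3) N'(1) by (simp_all add: N(4) N'(2) std.orth_compl_image orth_def)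
    then have M: "M2 = orth N2" "M1' = orth N1'" by (simp_all only: inj_image_eq_iff[OF std.inj])
    obtain g where g: "adj g g" "\<And>x. g x \<in> N2" "\<And>x. x \<in> N2 \<Longrightarrow> g x = x" "\<And>x. g (g x) = g x"
        "\<And>x. x \<in> orth N2 \<longleftrightarrow> g x = 0"
      using dsum_commute[OF dsF(2)] unfolding M
      by (rule orthogonal_projection) (rule that; assumption)
    obtain e where e: "adj e e" "\<And>x. e x \<in> N1'" "\<And>x. x \<in> N1' \<Longrightarrow> e x = x" "\<And>x. e (e x) = e x"
        "\<And>x. x \<in> orth N1' \<longleftrightarrow> e x = 0"
      using dsum_commute[OF dsD(1)] unfolding M
      by (rule orthogonal_projection) (rule that; assumption)
    have M': "M2 = {y. g y = 0}" "M1' = {y. e y = 0}" unfolding M using g(5) e(5) by blast+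
    have fd: "\<And>x. d (e x) \<in> N2'" using dM(2) e(2) by blast
    \<comment> \<open>For the projection that is matched completely, the leftover complement is the
      zero module.\<close>
    have zero: "fg {x. p x = x \<and> p x = 0}" if "adj p p" for p :: "'a ell2 \<Rightarrow> 'a ell2"
    proof -
      have "{x. p x = x \<and> p x = 0} = {0}" using that by (auto simp: adj_def alin_zero)
      then show ?thesis by (simp add: fg_singleton_zero)
    qed
    note compl = fredholm_completion[OF al(1) dsF(1) bf[unfolded M'] fgN(1)
        al(2) dsD(2) fd bd[unfolded M'] fgN(2) e(1,4) g(1,4)]
    from emb show False
    proof
      assume "embeds_cofinitely B2 B1'"
      then have "embeds_cofinitely (coord ` N2) (coord ` N1')" by (simp add: N N')
      then obtain i U W where i: "adj i i" "\<And>x. i (i x) = i x" "\<And>x. e (i x) = i x" "fg {x. e x = x \<and> i x = 0}"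
        and UW: "adj U W" "\<And>x. W (U x) = g x" "\<And>y. U (W y) = i y" "\<And>x. i (U x) = U x" "\<And>x. U (g x) = U x"
          "\<And>y. g (W y) = W y" "\<And>y. W (i y) = W y"
        by (rule embeds_cofinitely_elim[OF _ sm(2,3) g(1-3) e(1-3)])
          (assumption, assumption, (rule that; assumption))
      have aUW: "alin U" "alin W" using UW(1) by (auto simp: adj_def)
      \<comment> \<open>Here U leads from N2 to N1', whereas C leads from the second coordinate to
        the first, from N1' to N2; hence its inverse W becomes the entry.\<close>
      have "fredholm (hsum std_module std_module)
          (shift_op (hsum std_module std_module) (upper_triangular F (\<lambda>v. coord (W (Ell2 v))) D) \<alpha>)"
        by (rule fredholm_upper_triangular[OF f(1,2) d(1,2) adj_sym[OF UW(1)] _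
              compl[OF i g(1,4,4) zero[OF g(1)] aUW(2) UW(3,2,6,7,4) aUW(1)]])
          (simp add: coord_inverse)
      then show False using not_fredholm[OF adj_sym[OF UW(1)]] by blast
    next
      assume "embeds_cofinitely B1' B2"
      then have "embeds_cofinitely (coord ` N1') (coord ` N2)" by (simp add: N N')
      then obtain i U W where i: "adj i i" "\<And>x. i (i x) = i x" "\<And>x. g (i x) = i x" "fg {x. g x = x \<and> i x = 0}"
        and UW: "adj U W" "\<And>x. W (U x) = e x" "\<And>y. U (W y) = i y" "\<And>x. i (U x) = U x" "\<And>x. U (e x) = U x"
          "\<And>y. e (W y) = W y" "\<And>y. W (i y) = W y"
        by (rule embeds_cofinitely_elim[OF _ sm(3,2) e(1-3) g(1-3)])
          (assumption, assumption, (rule that; assumption))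
      have aUW: "alin U" "alin W" using UW(1) by (auto simp: adj_def)
      have "fredholm (hsum std_module std_module)
          (shift_op (hsum std_module std_module) (upper_triangular F (\<lambda>v. coord (U (Ell2 v))) D) \<alpha>)"
        by (rule fredholm_upper_triangular[OF f(1,2) d(1,2) UW(1) _
              compl[OF e(1,4,4) zero[OF e(1)] i aUW(1) UW(2,3,4,5,6) aUW(2)]])
          (simp add: coord_inverse)
      then show False using not_fredholm[OF UW(1)] by blast
    qed
  qed
  then show "\<alpha> \<in> W_set F D" using \<alpha> unfolding W_set_def by blast
qed

theorem corollary3p10:
  fixes F D :: "(nat \<Rightarrow> 'a::unital_cstar_algebra) \<Rightarrow> nat \<Rightarrow> 'a"
  assumes "F \<in> adjointable_ops std_module std_module"
    and "D \<in> adjointable_ops std_module std_module"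
  shows "W_tilde F D \<subseteq>
      (\<Inter>C \<in> adjointable_ops std_module std_module.
        ess_spectrum (hsum std_module std_module) (upper_triangular F C D))
    \<and> (\<Inter>C \<in> adjointable_ops std_module std_module.
        ess_spectrum (hsum std_module std_module) (upper_triangular F C D)) \<subseteq> W_set F D"
  using W_tilde_subset_ess_spectrum[OF assms] Inter_ess_spectrum_subset_W[OF assms] by blast

end
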